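(* Up to equivalence, the regular complex Hadamard matrices of size $6\times 6$ are exactly the following, where $j=e^{2\pi i/3}$ and $\mathbb T$ is the unit circle: (1) the Tao matrix $$T=\begin{pmatrix}1&1&1&1&1&1\\1&1&j&j&j^2&j^2\\1&j&1&j^2&j^2&j\\1&j&j^2&1&j&j^2\\1&j^2&j^2&j&1&j\\1&j^2&j&j^2&j&1\end{pmatrix};$$ (2) the Haagerup matrices, with $q\in\mathbb T$, $$H^q=\begin{pmatrix}1&1&1&1&1&1\\1&-1&i&i&-i&-i\\1&i&-1&-i&q&-q\\1&i&-i&-1&-q&q\\1&-i&\bar q&-\bar q&i&-1\\1&-i&-\bar q&\bar q&-1&i\end{pmatrix};$$ (3) the matrices, with $r,s\in\mathbb T$, $$F_{23}^{rs}=\begin{pmatrix}1&1&1&1&1&1\\1&j&j^2&r&jr&j^2r\\1&j^2&j&s&j^2s&js\\1&1&1&-1&-1&-1\\1&j&j^2&-r&-jr&-j^2r\\1&j^2&j&-s&-j^2s&-js\end{pmatrix};$$ (4) the matrices, with $r,s\in\mathbb T$, $$F_{32}^{rs}=\begin{pmatrix}1&1&1&1&1&1\\1&-1&r&-r&s&-s\\1&1&j&j&j^2&j^2\\1&-1&jr&-jr&j^2s&-j^2s\\1&1&j^2&j^2&j&j\\1&-1&j^2r&-j^2r&js&-js\end{pmatrix}.$$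
   Context: A complex Hadamard matrix is a square matrix $h\in M_n(\mathbb C)$ whose entries all have modulus $1$ and whose rows are pairwise orthogonal. Two such matrices are equivalent if one can pass from one to the other by permuting the rows, permuting the columns, and multiplying rows or columns by complex numbers of modulus $1$ (transposition is not included). For a prime $p$, a $p$-cycle is a formal sum of all the $p$-th roots of unity, rotated by a scalar $a\in\mathbb T$, that is, $\sum_{k=1}^{p}a e^{2\pi i k/p}$. A complex Hadamard matrix is called regular if, for every two distinct rows $h_i,h_k$, the scalar product $\sum_m h_{im}\bar h_{km}$, viewed as a formal sum of $n$ numbers of modulus $1$, decomposes as a sum of cycles (i.e. the multiset of its $n$ terms is a disjoint union of cycles, possibly for different primes and different rotations). *)

theory Defs
  imports "HOL-Analysis.Analysis" "HOL-Library.Multiset" "HOL-Computational_Algebra.Primes"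
begin

definition complex_hadamard :: "complex^'n^'n \<Rightarrow> bool" where
  "complex_hadamard h \<longleftrightarrow>
     (\<forall>i m. norm (h $ i $ m) = 1) \<and>
     (\<forall>i k. i \<noteq> k \<longrightarrow> (\<Sum>m\<in>UNIV. h $ i $ m * cnj (h $ k $ m)) = 0)"

definition hadamard_equiv :: "complex^'n^'n \<Rightarrow> complex^'n^'n \<Rightarrow> bool" where
  "hadamard_equiv g h \<longleftrightarrow>
     (\<exists>\<sigma> \<tau> a b. bij \<sigma> \<and> bij \<tau> \<and> (\<forall>i. norm (a i) = 1) \<and> (\<forall>m. norm (b m) = 1) \<and>
        (\<forall>i m. g $ i $ m = a i * b m * h $ \<sigma> i $ \<tau> m))"

text \<open>Formal sums of numbers of modulus 1 are represented by multisets of complex numbers;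
  adding formal sums is adding multisets.\<close>

definition root_cycle :: "nat \<Rightarrow> complex \<Rightarrow> complex multiset" where
  "root_cycle p a = image_mset
     (\<lambda>k. a * exp (2 * of_real pi * \<i> * of_nat k / of_nat p)) (mset_set {1..p})"

definition sum_of_cycles :: "complex multiset \<Rightarrow> bool" where
  "sum_of_cycles M \<longleftrightarrow>
     (\<exists>C. (\<forall>c \<in># C. \<exists>p a. prime p \<and> norm a = 1 \<and> c = root_cycle p a) \<and> M = \<Sum>\<^sub># C)"

definition row_product :: "complex^'n^'n \<Rightarrow> 'n \<Rightarrow> 'n \<Rightarrow> complex multiset" where
  "row_product h i k = image_mset (\<lambda>m. h $ i $ m * cnj (h $ k $ m)) (mset_set UNIV)"

definition regular_hadamard :: "complex^'n^'n \<Rightarrow> bool" where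
  "regular_hadamard h \<longleftrightarrow>
     complex_hadamard h \<and> (\<forall>i k. i \<noteq> k \<longrightarrow> sum_of_cycles (row_product h i k))"

definition omega :: complex where
  "omega = exp (2 * of_real pi * \<i> / 3)"

text \<open>\<open>vector\<close> numbers the entries of a list from 1, so the rows and columns of the matrices
  below are indexed by \<open>1, \<dots>, 6\<close> in the type \<open>6\<close> of integers modulo 6, where \<open>6 = 0\<close>.\<close>

definition tao_matrix :: "complex^6^6" where
  "tao_matrix = (let j = omega in vector
    [vector [1, 1,   1,   1,   1,   1  ],
     vector [1, 1,   j,   j,   j^2, j^2],
     vector [1, j,   1,   j^2, j^2, j  ],
     vector [1, j,   j^2, 1,   j,   j^2],
     vector [1, j^2, j^2, j,   1,   j  ],
     vector [1, j^2, j,   j^2, j,   1  ]])"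

definition haagerup_matrix :: "complex \<Rightarrow> complex^6^6" where
  "haagerup_matrix q = vector
    [vector [1, 1,    1,      1,      1,   1  ],
     vector [1, -1,   \<i>,      \<i>,      -\<i>,  -\<i> ],
     vector [1, \<i>,    -1,     -\<i>,     q,   -q ],
     vector [1, \<i>,    -\<i>,     -1,     -q,  q  ],
     vector [1, -\<i>,   cnj q,  -cnj q, \<i>,   -1 ],
     vector [1, -\<i>,   -cnj q, cnj q,  -1,  \<i>  ]]"

definition F23_matrix :: "complex \<Rightarrow> complex \<Rightarrow> complex^6^6" where
  "F23_matrix r s = (let j = omega in vector
    [vector [1, 1,   1,   1,  1,          1         ],
     vector [1, j,   j^2, r,  j * r,      j^2 * r   ],
     vector [1, j^2, j,   s,  j^2 * s,    j * s     ],
     vector [1, 1,   1,   -1, -1,         -1        ],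
     vector [1, j,   j^2, -r, -(j * r),   -(j^2 * r)],
     vector [1, j^2, j,   -s, -(j^2 * s), -(j * s)  ]])"

definition F32_matrix :: "complex \<Rightarrow> complex \<Rightarrow> complex^6^6" where
  "F32_matrix r s = (let j = omega in vector
    [vector [1, 1,  1,       1,          1,       1         ],
     vector [1, -1, r,       -r,         s,       -s        ],
     vector [1, 1,  j,       j,          j^2,     j^2       ],
     vector [1, -1, j * r,   -(j * r),   j^2 * s, -(j^2 * s)],
     vector [1, 1,  j^2,     j^2,        j,       j         ],
     vector [1, -1, j^2 * r, -(j^2 * r), j * s,   -(j * s)  ]])"

end

theory Submission
  imports Defs
begin

text \<open>
  Six numbers of modulus 1 form a sum of cycles iff they split into three antipodal pairs (type 2)
  or into two rotated triples of cube roots of unity (type 3), so every pair of rows has one of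
  these types. Type 3 is studied through cubes and type 2 through squares and fourth powers: the
  relevant power of the quotient of two rows takes at most two or three values, on column sets of
  known sizes, and comparing these column sets for three rows is very restrictive.

  If all pairs of rows have type 3, all quotients have constant cubes, the entries can be taken to be
  cube roots of unity, and the Tao matrix results. If no pair has type 3, the quotient of any two
  rows contains \<open>x, -x, ix, -ix\<close>; some pair of rows consists, up to scaling, of fourth roots of
  unity only, and relative to it all other rows are forced, which gives the Haagerup matrices.
  Otherwise there are three rows with pairs of both kinds. Then either some quotient of two rows
  takes a value \<open>z\<close> three times and \<open>-z\<close> three times, which forces \<open>F\<^sub>2\<^sub>3\<close>, or two pairs
  with a common row have the same antipodal pairing of the columns, which forces \<open>F\<^sub>3\<^sub>2\<close> or
  leads back to the former case.
\<close>

section \<open>Sums of two-cycles and three-cycles\<close>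

text \<open>Column scalars cancel in the quotient of two rows and row scalars become a common
  factor, so all information sits in these quotients. For three rows, the quotients \<open>f\<close>
  and \<open>g\<close> of two of them by the third have \<open>g / f\<close> as the remaining
  quotient, and the argument lives on such triples. The obstacle is that the values of a quotient
  determine neither its pairs nor its triples, and that one quotient can have both types, as
  \<open>x, omega * x, omega\<^sup>2 * x\<close> with their negatives; hence the case distinction is
  "type 3 or not". Powers remove the choice: the cube is constant on a 3-cycle and still odd, so the
  vanishing odd power sums of a type 2 quotient become relations between at most four values. The
  ninth power enters as the cube of the cube, which supplies the second relation needed to solve
  them. The sixth power forgets the sign of the cube, and the fourth power forgets quarter
  turns.\<close>

lemma omega_eq: "omega = Complex (- 1 / 2) (sqrt 3 / 2)"
proof -
  have "omega = cis (2 * pi / 3)"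
    by (simp add: omega_def cis_conv_exp mult.commute)
  then show ?thesis
    by (simp add: cis.ctr cos_120 sin_120)
qed

lemma omega_sq: "omega * omega = - 1 - omega"
  by (simp add: omega_eq complex_eq_iff)

lemma omega_sq_mult: "omega * (omega * z) = - z - omega * z"
  by (simp add: omega_sq mult.assoc[symmetric] algebra_simps)

lemmas omega_simps = omega_sq omega_sq_mult power2_eq_square power3_eq_cube algebra_simps

lemma cnj_omega: "cnj omega = - 1 - omega"
  by (simp add: omega_eq complex_eq_iff)

lemma omega_cube: "omega ^ 3 = 1"
  by (simp add: omega_simps)

lemma norm_omega [simp]: "norm omega = 1"
proof -
  have "norm omega ^ 3 = 1"
    by (metis norm_power omega_cube norm_one)
  then show ?thesis
    using power_eq_1_iff[of "norm omega" 3] by (simp add: )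
qed

lemma omega_neq [simp]: "omega \<noteq> 0" "omega \<noteq> 1" "omega\<^sup>2 \<noteq> 1" "omega\<^sup>2 \<noteq> omega" "1 \<noteq> omega" "omega \<noteq> omega\<^sup>2" "1 \<noteq> omega\<^sup>2" "omega \<noteq> - 1"
  by (auto simp: omega_eq complex_eq_iff power2_eq_square)

lemma cube_root_cases:
  fixes x y :: complex
  assumes "x ^ 3 = y ^ 3"
  shows "x = y \<or> x = omega * y \<or> x = omega\<^sup>2 * y"
proof -
  have "(x - y) * (x - omega * y) * (x - omega\<^sup>2 * y) = x ^ 3 - y ^ 3"
    by (simp add: omega_simps)
  then show ?thesis
    using assms by auto
qed

text \<open>Conjugation inverts numbers of modulus 1, so the second elementary symmetric function
  vanishes along with the first. This leaves \<open>x * x + x * y + y * y = 0\<close>, whose roots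
  in \<open>y\<close> are the two primitive rotations of \<open>x\<close>.\<close>

lemma three_units_sum_zero:
  fixes x y z :: complex
  assumes "norm x = 1" "norm y = 1" "norm z = 1" "x + y + z = 0"
  shows "y = omega * x \<and> z = omega\<^sup>2 * x \<or> y = omega\<^sup>2 * x \<and> z = omega * x"
proof -
  have nz: "x \<noteq> 0" "y \<noteq> 0" "z \<noteq> 0"
    using assms by auto
  have "cnj x + cnj y + cnj z = 0"
    using assms(4) by (metis complex_cnj_add complex_cnj_zero)
  moreover have "cnj x = 1 / x" "cnj y = 1 / y" "cnj z = 1 / z"
    using assms by (auto simp: divide_conv_cnj)
  ultimately have "1 / x + 1 / y + 1 / z = 0" by simp
  then have "x * y + y * z + z * x = 0"
    using nz by (simp add: field_simps)
  moreover have z: "z = - x - y"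
    using assms(4) by (simp add: algebra_simps add_eq_0_iff)
  ultimately have "x * x + x * y + y * y = 0"
    by (simp add: algebra_simps add_eq_0_iff)
  then have "(y - omega * x) * (y - omega\<^sup>2 * x) = 0"
    by (simp add: omega_simps)
  then have "y = omega * x \<or> y = omega\<^sup>2 * x" by simp
  then show ?thesis
    unfolding z by (auto simp: omega_simps)
qed

text \<open>Conjugating the sum shows that the second and third elementary symmetric functions
  agree, so the monic polynomial with roots \<open>x, y, z\<close> vanishes at 1.\<close>

lemma three_units_sum_one:
  fixes x y z :: complex
  assumes "norm x = 1" "norm y = 1" "norm z = 1" "x + y + z = 1"
  shows "x = 1 \<and> z = - y \<or> y = 1 \<and> z = - x \<or> z = 1 \<and> y = - x"
proof -
  have nz: "x \<noteq> 0" "y \<noteq> 0" "z \<noteq> 0"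
    using assms by auto
  have "cnj x + cnj y + cnj z = 1"
    using assms(4) by (metis complex_cnj_add complex_cnj_one)
  moreover have "cnj x = 1 / x" "cnj y = 1 / y" "cnj z = 1 / z"
    using assms by (auto simp: divide_conv_cnj)
  ultimately have "1 / x + 1 / y + 1 / z = 1" by simp
  then have e: "x * y + y * z + z * x = x * y * z"
    using nz by (simp add: field_simps)
  have "(x - 1) * (y - 1) * (z - 1) = (x * y * z - (x * y + y * z + z * x)) + (x + y + z - 1)"
    by (simp add: algebra_simps)
  also have "\<dots> = 0" using e assms(4) by simp
  finally have "x = 1 \<or> y = 1 \<or> z = 1" by simp
  then show ?thesis
    using assms(4) by (auto simp: add_eq_0_iff algebra_simps)
qed

text \<open>A labelling of all columns (or all rows) of a matrix by \<open>c1, \<dots>, c6\<close>.\<close>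

definition cols :: "6 \<Rightarrow> 6 \<Rightarrow> 6 \<Rightarrow> 6 \<Rightarrow> 6 \<Rightarrow> 6 \<Rightarrow> bool" where
  "cols c1 c2 c3 c4 c5 c6 \<longleftrightarrow> distinct [c1, c2, c3, c4, c5, c6]"

lemma cols_UNIV:
  assumes "cols c1 c2 c3 c4 c5 c6"
  shows "UNIV = {c1, c2, c3, c4, c5, c6}"
proof -
  have "card (set [c1, c2, c3, c4, c5, c6]) = 6"
    using assms distinct_card[of "[c1, c2, c3, c4, c5, c6]"] by (simp add: cols_def)
  then have "card {c1, c2, c3, c4, c5, c6} = card (UNIV :: 6 set)" by simp
  then show ?thesis
    by (metis card_subset_eq finite top_greatest)
qed

lemma cols_all:
  assumes "cols c1 c2 c3 c4 c5 c6"
  shows "(\<forall>c. P c) \<longleftrightarrow> P c1 \<and> P c2 \<and> P c3 \<and> P c4 \<and> P c5 \<and> P c6"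
  using cols_UNIV[OF assms] by (metis UNIV_I insertE singletonD)

lemma cols_cases:
  assumes "cols c1 c2 c3 c4 c5 c6"
  shows "c = c1 \<or> c = c2 \<or> c = c3 \<or> c = c4 \<or> c = c5 \<or> c = c6"
  using cols_UNIV[OF assms] by blast

lemma cols_sum:
  fixes f :: "6 \<Rightarrow> 'a :: comm_monoid_add"
  assumes "cols c1 c2 c3 c4 c5 c6"
  shows "(\<Sum>c\<in>UNIV. f c) = f c1 + f c2 + f c3 + f c4 + f c5 + f c6"
  unfolding cols_UNIV[OF assms] using assms by (simp add: cols_def add.assoc)

lemma cols_UNIV_minus:
  assumes "cols c1 c2 c3 c4 c5 c6"
  shows "- {c1, c2, c3} = {c4, c5, c6}" "- {c5, c6} = {c1, c2, c3, c4}"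
  using cols_UNIV[OF assms] assms by (auto simp: cols_def)

section \<open>The two shapes of a sum of cycles with six terms\<close>

definition type2 :: "(6 \<Rightarrow> complex) \<Rightarrow> bool" where
  "type2 f \<longleftrightarrow> (\<exists>c1 c2 c3 c4 c5 c6. cols c1 c2 c3 c4 c5 c6 \<and> f c2 = - f c1 \<and> f c4 = - f c3 \<and> f c6 = - f c5)"

definition type3 :: "(6 \<Rightarrow> complex) \<Rightarrow> bool" where
  "type3 f \<longleftrightarrow> (\<exists>c1 c2 c3 c4 c5 c6. cols c1 c2 c3 c4 c5 c6 \<and>
     f c2 = omega * f c1 \<and> f c3 = omega\<^sup>2 * f c1 \<and> f c5 = omega * f c4 \<and> f c6 = omega\<^sup>2 * f c4)"

lemma root_cycle_2: "root_cycle 2 a = {#- a, a#}"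
proof -
  have *: "{1..2::nat} = {1, 2}" by auto
  have e: "exp (2 * (\<i> * complex_of_real pi)) = 1"
    by (metis exp_two_pi_i mult.assoc mult.commute)
  have "exp (2 * of_real pi * \<i> * 1 / 2) = (-1 :: complex)"
    by (simp add: mult.commute)
  moreover have "exp (2 * of_real pi * \<i> * 2 / 2) = (1 :: complex)"
    by (simp add: e)
  moreover have "exp (complex_of_real pi * (\<i> * 2)) = 1"
    by (metis e mult.assoc mult.commute)
  ultimately show ?thesis
    unfolding root_cycle_def * by simp
qed

lemma root_cycle_3: "root_cycle 3 a = {#omega * a, omega\<^sup>2 * a, a#}"
proof -
  have *: "{1..3::nat} = {1, 2, 3}" by auto
  have e: "exp (2 * (\<i> * complex_of_real pi)) = 1"
    by (metis exp_two_pi_i mult.assoc mult.commute)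
  have "exp (2 * of_real pi * \<i> * 1 / 3) = omega"
    by (simp add: omega_def)
  moreover have "exp (2 * of_real pi * \<i> * 2 / 3) = omega\<^sup>2"
    by (simp add: omega_def exp_double[symmetric])
  moreover have "exp (2 * of_real pi * \<i> * 3 / 3) = (1 :: complex)"
    by (simp add: e)
  ultimately show ?thesis
    unfolding root_cycle_def * by (simp add: mult.commute)
qed

lemma size_root_cycle: "size (root_cycle p a) = p"
  by (simp add: root_cycle_def)

lemma mset_cols:
  assumes "cols c1 c2 c3 c4 c5 c6"
  shows "image_mset f (mset_set UNIV) = {#f c1, f c2, f c3, f c4, f c5, f c6#}"
  unfolding cols_UNIV[OF assms] using assms by (simp add: cols_def)

text \<open>The elements are peeled off one by one, each together with a column that carries it;
  this turns an equality of formal sums into a labelling of the columns.\<close>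

lemma cols_of_mset:
  assumes "image_mset f (mset_set (UNIV :: 6 set)) = {#x1, x2, x3, x4, x5, x6#}"
  obtains c1 c2 c3 c4 c5 c6 where "cols c1 c2 c3 c4 c5 c6"
    "f c1 = x1" "f c2 = x2" "f c3 = x3" "f c4 = x4" "f c5 = x5" "f c6 = x6"
proof -
  have step: "\<exists>c B. A = insert c B \<and> c \<notin> B \<and> finite B \<and> f c = x \<and> image_mset f (mset_set B) = M"
    if "finite A" "image_mset f (mset_set A) = add_mset x M" for A :: "6 set" and x M
  proof -
    have "x \<in># image_mset f (mset_set A)"
      using that(2) by simp
    then obtain c where c: "c \<in> A" "f c = x"
      using that(1) by auto
    then have A: "A = insert c (A - {c})" by auto
    have "mset_set A = add_mset c (mset_set (A - {c}))"
      using that(1) c(1) by (simp add: mset_set.remove)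
    then have "image_mset f (mset_set (A - {c})) = M"
      using that(2) c(2) by simp
    then show ?thesis
      using A c that(1) by blast
  qed
  obtain c1 B1 where 1: "(UNIV :: 6 set) = insert c1 B1" "c1 \<notin> B1" "finite B1" "f c1 = x1"
    "image_mset f (mset_set B1) = {#x2, x3, x4, x5, x6#}"
    using step[OF _ assms] by auto
  obtain c2 B2 where 2: "B1 = insert c2 B2" "c2 \<notin> B2" "finite B2" "f c2 = x2"
    "image_mset f (mset_set B2) = {#x3, x4, x5, x6#}"
    using step[OF 1(3,5)] by auto
  obtain c3 B3 where 3: "B2 = insert c3 B3" "c3 \<notin> B3" "finite B3" "f c3 = x3"
    "image_mset f (mset_set B3) = {#x4, x5, x6#}"
    using step[OF 2(3,5)] by auto
  obtain c4 B4 where 4: "B3 = insert c4 B4" "c4 \<notin> B4" "finite B4" "f c4 = x4"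
    "image_mset f (mset_set B4) = {#x5, x6#}"
    using step[OF 3(3,5)] by auto
  obtain c5 B5 where 5: "B4 = insert c5 B5" "c5 \<notin> B5" "finite B5" "f c5 = x5"
    "image_mset f (mset_set B5) = {#x6#}"
    using step[OF 4(3,5)] by auto
  obtain c6 B6 where 6: "B5 = insert c6 B6" "c6 \<notin> B6" "f c6 = x6"
    using step[OF 5(3,5)] by auto
  show thesis
    by (rule that[of c1 c2 c3 c4 c5 c6]) (use 1 2 3 4 5 6 in \<open>auto simp: cols_def\<close>)
qed

text \<open>A cycle has as many terms as its prime, and \<open>6 = 2 + 2 + 2 = 3 + 3\<close> are the
  only ways to write 6 as a sum of primes, so at most three cycles have to be taken out of
  \<open>C\<close>.\<close>

lemma sum_of_cycles_type:
  assumes "sum_of_cycles (image_mset f (mset_set (UNIV :: 6 set)))"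
  shows "type2 f \<or> type3 f"
proof -
  let ?M = "image_mset f (mset_set (UNIV :: 6 set))"
  obtain C where C: "\<And>c. c \<in># C \<Longrightarrow> \<exists>p a. prime p \<and> norm a = 1 \<and> c = root_cycle p a" "?M = \<Sum>\<^sub># C"
    using assms unfolding sum_of_cycles_def by blast
  have sz: "size (\<Sum>\<^sub># C) = 6"
    unfolding C(2)[symmetric] by simp
  have np: "\<not> prime (6::nat)" "\<not> prime (4::nat)"
    using prime_product[of 2 3] prime_product[of 2 2] by auto
  have "C \<noteq> {#}" using sz by auto
  then obtain c1 C1 where 1: "C = add_mset c1 C1" by (metis multiset_cases)
  obtain p1 a1 where p1: "prime p1" "c1 = root_cycle p1 a1" using C(1)[of c1] 1 by auto
  have s1: "p1 + size (\<Sum>\<^sub># C1) = 6" using sz 1 p1 by (simp add: size_root_cycle)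
  have "C1 \<noteq> {#}" using s1 np p1(1) by auto
  then obtain c2 C2 where 2: "C1 = add_mset c2 C2" by (metis multiset_cases)
  obtain p2 a2 where p2: "prime p2" "c2 = root_cycle p2 a2" using C(1)[of c2] 1 2 by auto
  have s2: "p1 + p2 + size (\<Sum>\<^sub># C2) = 6" using s1 2 p2 by (simp add: size_root_cycle)
  have ge: "p1 \<ge> 2" "p2 \<ge> 2" using p1(1) p2(1) by (auto intro: prime_ge_2_nat)
  show ?thesis
  proof (cases "C2 = {#}")
    case True
    then have "p1 + p2 = 6" using s2 by simp
    then have "p1 = 2 \<and> p2 = 4 \<or> p1 = 3 \<and> p2 = 3 \<or> p1 = 4 \<and> p2 = 2"
      using ge by arith
    then have "p1 = 3" "p2 = 3" using np p1(1) p2(1) by auto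
    then have "?M = {#omega * a1, omega\<^sup>2 * a1, a1, omega * a2, omega\<^sup>2 * a2, a2#}"
      using C(2) 1 2 p1 p2 True by (simp add: root_cycle_3)
    then obtain c1 c2 c3 c4 c5 c6 where c: "cols c1 c2 c3 c4 c5 c6" "f c1 = omega * a1"
      "f c2 = omega\<^sup>2 * a1" "f c3 = a1" "f c4 = omega * a2" "f c5 = omega\<^sup>2 * a2" "f c6 = a2"
      by (rule cols_of_mset)
    \<comment> \<open>\<open>root_cycle\<close> counts from 1 to \<open>p\<close>, so the unrotated
      term comes last, whereas \<open>type3\<close> starts with it.\<close>
    have "cols c3 c1 c2 c6 c4 c5" using c(1) by (auto simp: cols_def)
    then have "type3 f"
      unfolding type3_def using c by metis
    then show ?thesis ..
  next
    case False
    then obtain c3 C3 where 3: "C2 = add_mset c3 C3" by (metis multiset_cases)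
    obtain p3 a3 where p3: "prime p3" "c3 = root_cycle p3 a3" using C(1)[of c3] 1 2 3 by auto
    have s3: "p1 + p2 + p3 + size (\<Sum>\<^sub># C3) = 6" using s2 3 p3 by (simp add: size_root_cycle)
    have ge3: "p3 \<ge> 2" using p3(1) by (auto intro: prime_ge_2_nat)
    have p: "p1 = 2" "p2 = 2" "p3 = 2" "size (\<Sum>\<^sub># C3) = 0" using s3 ge ge3 by linarith+
    from p(4) have "\<Sum>\<^sub># C3 = {#}" by (simp only: size_eq_0_iff_empty)
    then have "?M = {#- a1, a1, - a2, a2, - a3, a3#}"
      using C(2) 1 2 3 p1 p2 p3 p by (simp add: root_cycle_2)
    then obtain c1 c2 c3 c4 c5 c6 where "cols c1 c2 c3 c4 c5 c6" "f c1 = - a1"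
      "f c2 = a1" "f c3 = - a2" "f c4 = a2" "f c5 = - a3" "f c6 = a3"
      by (rule cols_of_mset)
    then have "type2 f"
      unfolding type2_def by (metis minus_minus)
    then show ?thesis ..
  qed
qed

lemma type2_sum_of_cycles:
  assumes "type2 f" "\<And>c. norm (f c) = 1"
  shows "sum_of_cycles (image_mset f (mset_set (UNIV :: 6 set)))"
proof -
  obtain c1 c2 c3 c4 c5 c6 where c: "cols c1 c2 c3 c4 c5 c6" "f c2 = - f c1" "f c4 = - f c3" "f c6 = - f c5"
    using assms(1) unfolding type2_def by blast
  have *: "image_mset f (mset_set UNIV) = \<Sum>\<^sub># {#root_cycle 2 (f c1), root_cycle 2 (f c3), root_cycle 2 (f c5)#}"
    unfolding mset_cols[OF c(1)] by (simp add: root_cycle_2 c)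
  show ?thesis
    unfolding sum_of_cycles_def
  proof (intro exI[of _ "{#root_cycle 2 (f c1), root_cycle 2 (f c3), root_cycle 2 (f c5)#}"] conjI ballI)
    fix c
    assume "c \<in># {#root_cycle 2 (f c1), root_cycle 2 (f c3), root_cycle 2 (f c5)#}"
    then have "c = root_cycle 2 (f c1) \<or> c = root_cycle 2 (f c3) \<or> c = root_cycle 2 (f c5)" by auto
    then show "\<exists>p a. prime p \<and> norm a = 1 \<and> c = root_cycle p a"
      using assms(2) two_is_prime_nat by metis
  qed (rule *)
qed

lemma type3_sum_of_cycles:
  assumes "type3 f" "\<And>c. norm (f c) = 1"
  shows "sum_of_cycles (image_mset f (mset_set (UNIV :: 6 set)))"
proof -
  obtain c1 c2 c3 c4 c5 c6 where c: "cols c1 c2 c3 c4 c5 c6" "f c2 = omega * f c1"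
      "f c3 = omega\<^sup>2 * f c1" "f c5 = omega * f c4" "f c6 = omega\<^sup>2 * f c4"
    using assms(1) unfolding type3_def by blast
  have *: "image_mset f (mset_set UNIV) = \<Sum>\<^sub># {#root_cycle 3 (f c1), root_cycle 3 (f c4)#}"
    unfolding mset_cols[OF c(1)] by (simp add: root_cycle_3 c)
  have prime3: "prime (3 :: nat)" by simp
  show ?thesis
    unfolding sum_of_cycles_def
  proof (intro exI[of _ "{#root_cycle 3 (f c1), root_cycle 3 (f c4)#}"] conjI ballI)
    fix c
    assume "c \<in># {#root_cycle 3 (f c1), root_cycle 3 (f c4)#}"
    then have "c = root_cycle 3 (f c1) \<or> c = root_cycle 3 (f c4)" by auto
    then show "\<exists>p a. prime p \<and> norm a = 1 \<and> c = root_cycle p a"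
      using assms(2) prime3 by metis
  qed (rule *)
qed

section \<open>Regularity of the listed matrices\<close>

lemma vector_6 [simp]:
  "(vector [x1, x2, x3, x4, x5, x6] :: 'a::zero^6) $ 1 = x1"
  "(vector [x1, x2, x3, x4, x5, x6] :: 'a::zero^6) $ 2 = x2"
  "(vector [x1, x2, x3, x4, x5, x6] :: 'a::zero^6) $ 3 = x3"
  "(vector [x1, x2, x3, x4, x5, x6] :: 'a::zero^6) $ 4 = x4"
  "(vector [x1, x2, x3, x4, x5, x6] :: 'a::zero^6) $ 5 = x5"
  "(vector [x1, x2, x3, x4, x5, x6] :: 'a::zero^6) $ 6 = x6"
  unfolding vector_def by simp_all

lemma cols_numerals: "cols 1 2 3 4 5 6"
  by (simp add: cols_def)

lemma all_6: "(\<forall>i::6. P i) \<longleftrightarrow> P 1 \<and> P 2 \<and> P 3 \<and> P 4 \<and> P 5 \<and> P 6"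
  by (rule cols_all[OF cols_numerals])

lemma type2I:
  assumes "cols c1 c2 c3 c4 c5 c6" "f c2 = - f c1" "f c4 = - f c3" "f c6 = - f c5"
  shows "type2 f"
  unfolding type2_def by (intro exI conjI) (rule assms)+

lemma type3I:
  assumes "cols c1 c2 c3 c4 c5 c6"
    "f c2 = omega * f c1" "f c3 = omega\<^sup>2 * f c1" "f c5 = omega * f c4" "f c6 = omega\<^sup>2 * f c4"
  shows "type3 f"
  unfolding type3_def by (intro exI conjI) (rule assms)+

section \<open>Invariance of the types under equivalence and conjugation\<close>

lemma cols_map:
  assumes "cols c1 c2 c3 c4 c5 c6" "bij \<tau>"
  shows "cols (\<tau> c1) (\<tau> c2) (\<tau> c3) (\<tau> c4) (\<tau> c5) (\<tau> c6)"
  using assms by (auto simp: cols_def bij_def inj_def)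

lemma type2_cong:
  assumes "type2 f" "bij \<tau>" "\<And>m. g m = \<kappa> * f (\<tau> m)"
  shows "type2 g"
proof -
  obtain c1 c2 c3 c4 c5 c6 where c: "cols c1 c2 c3 c4 c5 c6" "f c2 = - f c1" "f c4 = - f c3" "f c6 = - f c5"
    using assms(1) unfolding type2_def by blast
  have g: "g (inv \<tau> x) = \<kappa> * f x" for x
    using assms(2,3) by (simp add: bij_def surj_f_inv_f)
  show ?thesis
    unfolding type2_def
    by (intro exI conjI, rule cols_map[OF c(1) bij_imp_bij_inv[OF assms(2)]])
       (simp_all add: g c mult.left_commute)
qed

lemma type3_cong:
  assumes "type3 f" "bij \<tau>" "\<And>m. g m = \<kappa> * f (\<tau> m)"
  shows "type3 g"
proof -
  obtain c1 c2 c3 c4 c5 c6 where c: "cols c1 c2 c3 c4 c5 c6" "f c2 = omega * f c1"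
      "f c3 = omega\<^sup>2 * f c1" "f c5 = omega * f c4" "f c6 = omega\<^sup>2 * f c4"
    using assms(1) unfolding type3_def by blast
  have g: "g (inv \<tau> x) = \<kappa> * f x" for x
    using assms(2,3) by (simp add: bij_def surj_f_inv_f)
  show ?thesis
    unfolding type3_def
    by (intro exI conjI, rule cols_map[OF c(1) bij_imp_bij_inv[OF assms(2)]])
       (simp_all add: g c mult.left_commute)
qed

lemma type2_cnj: "type2 f \<Longrightarrow> type2 (\<lambda>c. cnj (f c))"
  unfolding type2_def by (elim exE, intro exI) auto

lemma type3_cnj:
  assumes "type3 f"
  shows "type3 (\<lambda>c. cnj (f c))"
proof -
  obtain c1 c2 c3 c4 c5 c6 where c: "cols c1 c2 c3 c4 c5 c6" "f c2 = omega * f c1"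
      "f c3 = omega\<^sup>2 * f c1" "f c5 = omega * f c4" "f c6 = omega\<^sup>2 * f c4"
    using assms unfolding type3_def by blast
  have "cols c1 c3 c2 c4 c6 c5" using c(1) by (auto simp: cols_def)
  then show ?thesis
    by (rule type3I) (simp_all add: c cnj_omega omega_simps)
qed

lemma type2_sum: "type2 f \<Longrightarrow> (\<Sum>c\<in>UNIV. f c) = 0"
  unfolding type2_def by (auto simp: cols_sum)

lemma type3_sum: "type3 f \<Longrightarrow> (\<Sum>c\<in>UNIV. f c) = 0"
  unfolding type3_def by (auto simp: cols_sum omega_simps)

definition row_prod :: "complex^6^6 \<Rightarrow> 6 \<Rightarrow> 6 \<Rightarrow> 6 \<Rightarrow> complex" where
  "row_prod h i k m = h $ i $ m * cnj (h $ k $ m)"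

text \<open>Every cycle sums to zero, so orthogonality is already contained in the types.\<close>

lemma regular_iff_types:
  fixes h :: "complex^6^6"
  shows "regular_hadamard h \<longleftrightarrow> (\<forall>i m. norm (h $ i $ m) = 1) \<and>
     (\<forall>i k. i \<noteq> k \<longrightarrow> type2 (row_prod h i k) \<or> type3 (row_prod h i k))"
    (is "_ \<longleftrightarrow> ?U \<and> ?T")
proof
  assume "regular_hadamard h"
  then show "?U \<and> ?T"
    unfolding regular_hadamard_def complex_hadamard_def row_product_def row_prod_def
    using sum_of_cycles_type by blast
next
  assume *: "?U \<and> ?T"
  have [simp]: "row_product h i k = image_mset (row_prod h i k) (mset_set UNIV)" for i k
    by (simp add: row_product_def row_prod_def[abs_def])
  have n: "norm (row_prod h i k m) = 1" for i k m
    using * by (simp add: row_prod_def norm_mult)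
  have "(\<Sum>m\<in>UNIV. h $ i $ m * cnj (h $ k $ m)) = 0" if "i \<noteq> k" for i k
    using * that type2_sum[of "row_prod h i k"] type3_sum[of "row_prod h i k"]
    unfolding row_prod_def by blast
  moreover have "sum_of_cycles (row_product h i k)" if "i \<noteq> k" for i k
    using *[THEN conjunct2, rule_format, OF that] type2_sum_of_cycles[OF _ n] type3_sum_of_cycles[OF _ n]
    by auto
  ultimately show "regular_hadamard h"
    unfolding regular_hadamard_def complex_hadamard_def using * by blast
qed

lemma regular_equiv:
  fixes g h :: "complex^6^6"
  assumes "hadamard_equiv g h" "regular_hadamard h"
  shows "regular_hadamard g"
proof -
  obtain \<sigma> \<tau> a b where e: "bij \<sigma>" "bij \<tau>" "\<forall>i. norm (a i) = 1" "\<forall>m. norm (b m) = 1"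
      "\<And>i m. g $ i $ m = a i * b m * h $ \<sigma> i $ \<tau> m"
    using assms(1) unfolding hadamard_equiv_def by blast
  have h: "norm (h $ i $ m) = 1" "i \<noteq> k \<Longrightarrow> type2 (row_prod h i k) \<or> type3 (row_prod h i k)" for i k m
    using assms(2) unfolding regular_iff_types by auto
  have p: "row_prod g i k m = (a i * cnj (a k)) * row_prod h (\<sigma> i) (\<sigma> k) (\<tau> m)" for i k m
  proof -
    \<comment> \<open>The scalar of column \<open>m\<close> cancels in the product of two rows; only
      a factor common to all columns is left.\<close>
    have "b m * cnj (b m) = 1"
      using e(4) by (simp add: complex_norm_square[symmetric])
    then show ?thesis
      unfolding row_prod_def e(5) by (simp add: algebra_simps)
  qed
  have "type2 (row_prod g i k) \<or> type3 (row_prod g i k)" if "i \<noteq> k" for i k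
  proof -
    have "\<sigma> i \<noteq> \<sigma> k" using that e(1) by (auto simp: bij_def inj_def)
    from h(2)[OF this] show ?thesis
    proof
      assume "type2 (row_prod h (\<sigma> i) (\<sigma> k))"
      then have "type2 (row_prod g i k)"
        by (rule type2_cong[where g="row_prod g i k", OF _ e(2) p])
      then show ?thesis ..
    next
      assume "type3 (row_prod h (\<sigma> i) (\<sigma> k))"
      then have "type3 (row_prod g i k)"
        by (rule type3_cong[where g="row_prod g i k", OF _ e(2) p])
      then show ?thesis ..
    qed
  qed
  moreover have "norm (g $ i $ m) = 1" for i m
    using e(3,4) h(1) by (simp add: e(5) norm_mult)
  ultimately show ?thesis
    unfolding regular_iff_types by blast
qed

definition cyclic_sum :: "(6 \<Rightarrow> complex) \<Rightarrow> bool" where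
  "cyclic_sum f \<longleftrightarrow> type2 f \<or> type3 f"

text \<open>Exchanging two rows conjugates their product, and both types are closed under
  conjugation, so fifteen of the thirty ordered pairs suffice.\<close>

lemma regular_by_upper_types:
  fixes h :: "complex^6^6"
  assumes "\<forall>i m. norm (h $ i $ m) = 1"
    and t: "cyclic_sum (row_prod h 1 2)" "cyclic_sum (row_prod h 1 3)" "cyclic_sum (row_prod h 1 4)"
      "cyclic_sum (row_prod h 1 5)" "cyclic_sum (row_prod h 1 6)" "cyclic_sum (row_prod h 2 3)"
      "cyclic_sum (row_prod h 2 4)" "cyclic_sum (row_prod h 2 5)" "cyclic_sum (row_prod h 2 6)"
      "cyclic_sum (row_prod h 3 4)" "cyclic_sum (row_prod h 3 5)" "cyclic_sum (row_prod h 3 6)"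
      "cyclic_sum (row_prod h 4 5)" "cyclic_sum (row_prod h 4 6)" "cyclic_sum (row_prod h 5 6)"
  shows "regular_hadamard h"
  unfolding regular_iff_types
proof (intro conjI assms(1) allI impI)
  fix i k :: 6
  assume "i \<noteq> k"
  have "\<forall>i k. i \<noteq> k \<longrightarrow> cyclic_sum (row_prod h i k) \<or> cyclic_sum (row_prod h k i)"
    unfolding all_6 using t by simp
  then consider "cyclic_sum (row_prod h i k)" | "cyclic_sum (row_prod h k i)"
    using \<open>i \<noteq> k\<close> by blast
  then show "type2 (row_prod h i k) \<or> type3 (row_prod h i k)"
  proof cases
    case 2
    have "row_prod h i k = (\<lambda>m. cnj (row_prod h k i m))"
      by (simp add: row_prod_def fun_eq_iff mult.commute)
    then show ?thesis
      using 2 type2_cnj[of "row_prod h k i"] type3_cnj[of "row_prod h k i"]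
      unfolding cyclic_sum_def by auto
  qed (simp add: cyclic_sum_def)
qed

section \<open>Explicit cycles for the four kinds of matrices\<close>

lemma cyclic_sumI:
  "type2 f \<Longrightarrow> cyclic_sum f" "type3 f \<Longrightarrow> cyclic_sum f"
  by (simp_all add: cyclic_sum_def)

lemma unit_cnj:
  fixes r :: complex
  assumes "norm r = 1"
  shows "r * cnj r = 1" "cnj r * r = 1" "r * (cnj r * z) = z" "cnj r * (r * z) = z"
proof -
  show "r * cnj r = 1" using assms by (simp add: complex_norm_square[symmetric])
  then show "cnj r * r = 1" "r * (cnj r * z) = z" "cnj r * (r * z) = z"
    by (simp_all add: mult.assoc[symmetric] mult.commute[of "cnj r" r])
qed

text \<open>The six numbers given to \<open>type3I\<close> list the columns of two 3-cycles, each in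
  the order of the factors \<open>1, omega, omega\<^sup>2\<close>; those given to
  \<open>type2I\<close> in the next proofs list three antipodal pairs. Row pairs with the same list
  are grouped.\<close>

lemma regular_tao:
  shows "regular_hadamard (tao_matrix)"
proof (rule regular_by_upper_types)
  show "\<forall>i m. norm (tao_matrix $ i $ m) = 1"
    by (simp add: all_6 tao_matrix_def Let_def norm_mult norm_power)
next
  let ?p = "row_prod (tao_matrix)"
  note [simp] = row_prod_def cols_def tao_matrix_def Let_def cnj_omega omega_simps 
  show "cyclic_sum (?p 1 2)"
    by ((rule cyclic_sumI(2)[OF type3I[of 1 5 3 2 6 4]]; simp)+)
  show "cyclic_sum (?p 1 3)"
    by ((rule cyclic_sumI(2)[OF type3I[of 1 4 2 3 5 6]]; simp)+)
  show "cyclic_sum (?p 1 4)" "cyclic_sum (?p 4 6)"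
    by ((rule cyclic_sumI(2)[OF type3I[of 1 3 2 4 6 5]]; simp)+)
  show "cyclic_sum (?p 1 5)"
    by ((rule cyclic_sumI(2)[OF type3I[of 1 2 4 3 6 5]]; simp)+)
  show "cyclic_sum (?p 1 6)"
    by ((rule cyclic_sumI(2)[OF type3I[of 1 2 3 4 5 6]]; simp)+)
  show "cyclic_sum (?p 2 3)" "cyclic_sum (?p 3 5)"
    by ((rule cyclic_sumI(2)[OF type3I[of 1 3 2 4 5 6]]; simp)+)
  show "cyclic_sum (?p 2 4)"
    by ((rule cyclic_sumI(2)[OF type3I[of 1 4 2 3 6 5]]; simp)+)
  show "cyclic_sum (?p 2 5)"
    by ((rule cyclic_sumI(2)[OF type3I[of 1 2 3 4 6 5]]; simp)+)
  show "cyclic_sum (?p 2 6)"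
    by ((rule cyclic_sumI(2)[OF type3I[of 1 2 4 3 5 6]]; simp)+)
  show "cyclic_sum (?p 3 4)"
    by ((rule cyclic_sumI(2)[OF type3I[of 1 3 4 2 5 6]]; simp)+)
  show "cyclic_sum (?p 3 6)"
    by ((rule cyclic_sumI(2)[OF type3I[of 1 5 2 3 4 6]]; simp)+)
  show "cyclic_sum (?p 4 5)"
    by ((rule cyclic_sumI(2)[OF type3I[of 1 5 2 3 6 4]]; simp)+)
  show "cyclic_sum (?p 5 6)"
    by ((rule cyclic_sumI(2)[OF type3I[of 1 3 4 2 6 5]]; simp)+)
qed

lemma regular_haagerup:
  assumes "norm q = 1"
  shows "regular_hadamard (haagerup_matrix q)"
proof (rule regular_by_upper_types)
  show "\<forall>i m. norm (haagerup_matrix q $ i $ m) = 1"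
    using assms by (simp add: all_6 haagerup_matrix_def Let_def norm_mult norm_power)
next
  let ?p = "row_prod (haagerup_matrix q)"
  note [simp] = row_prod_def cols_def haagerup_matrix_def Let_def cnj_omega omega_simps unit_cnj[OF assms(1)]
  show "cyclic_sum (?p 1 2)" "cyclic_sum (?p 3 6)" "cyclic_sum (?p 4 5)"
    by ((rule cyclic_sumI(1)[OF type2I[of 1 2 3 5 4 6]]; simp)+)
  show "cyclic_sum (?p 1 3)" "cyclic_sum (?p 2 4)" "cyclic_sum (?p 5 6)"
    by ((rule cyclic_sumI(1)[OF type2I[of 1 3 2 4 5 6]]; simp)+)
  show "cyclic_sum (?p 1 4)" "cyclic_sum (?p 2 3)"
    by ((rule cyclic_sumI(1)[OF type2I[of 1 4 2 3 5 6]]; simp)+)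
  show "cyclic_sum (?p 1 5)" "cyclic_sum (?p 2 6)"
    by ((rule cyclic_sumI(1)[OF type2I[of 1 6 2 5 3 4]]; simp)+)
  show "cyclic_sum (?p 1 6)" "cyclic_sum (?p 2 5)" "cyclic_sum (?p 3 4)"
    by ((rule cyclic_sumI(1)[OF type2I[of 1 5 2 6 3 4]]; simp)+)
  show "cyclic_sum (?p 3 5)" "cyclic_sum (?p 4 6)"
    by ((rule cyclic_sumI(1)[OF type2I[of 1 2 3 6 4 5]]; simp)+)
qed

lemma regular_F23:
  assumes "norm r = 1" "norm s = 1"
  shows "regular_hadamard (F23_matrix r s)"
proof (rule regular_by_upper_types)
  show "\<forall>i m. norm (F23_matrix r s $ i $ m) = 1"
    using assms by (simp add: all_6 F23_matrix_def Let_def norm_mult norm_power)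
next
  let ?p = "row_prod (F23_matrix r s)"
  note [simp] = row_prod_def cols_def F23_matrix_def Let_def cnj_omega omega_simps unit_cnj[OF assms(1)] unit_cnj[OF assms(2)]
  show "cyclic_sum (?p 1 2)" "cyclic_sum (?p 1 5)" "cyclic_sum (?p 2 3)" "cyclic_sum (?p 2 6)" "cyclic_sum (?p 3 4)" "cyclic_sum (?p 4 5)" "cyclic_sum (?p 5 6)"
    by ((rule cyclic_sumI(2)[OF type3I[of 1 3 2 4 6 5]]; simp)+)
  show "cyclic_sum (?p 1 3)" "cyclic_sum (?p 1 6)" "cyclic_sum (?p 2 4)" "cyclic_sum (?p 3 5)" "cyclic_sum (?p 4 6)"
    by ((rule cyclic_sumI(2)[OF type3I[of 1 2 3 4 5 6]]; simp)+)
  show "cyclic_sum (?p 1 4)" "cyclic_sum (?p 2 5)" "cyclic_sum (?p 3 6)"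
    by ((rule cyclic_sumI(1)[OF type2I[of 1 4 2 5 3 6]]; simp)+)
qed

lemma regular_F32:
  assumes "norm r = 1" "norm s = 1"
  shows "regular_hadamard (F32_matrix r s)"
proof (rule regular_by_upper_types)
  show "\<forall>i m. norm (F32_matrix r s $ i $ m) = 1"
    using assms by (simp add: all_6 F32_matrix_def Let_def norm_mult norm_power)
next
  let ?p = "row_prod (F32_matrix r s)"
  note [simp] = row_prod_def cols_def F32_matrix_def Let_def cnj_omega omega_simps unit_cnj[OF assms(1)] unit_cnj[OF assms(2)]
  show "cyclic_sum (?p 1 2)" "cyclic_sum (?p 1 4)" "cyclic_sum (?p 1 6)" "cyclic_sum (?p 2 3)" "cyclic_sum (?p 2 5)" "cyclic_sum (?p 3 4)" "cyclic_sum (?p 3 6)" "cyclic_sum (?p 4 5)" "cyclic_sum (?p 5 6)"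
    by ((rule cyclic_sumI(1)[OF type2I[of 1 2 3 4 5 6]]; simp)+)
  show "cyclic_sum (?p 1 3)" "cyclic_sum (?p 2 4)" "cyclic_sum (?p 3 5)" "cyclic_sum (?p 4 6)"
    by ((rule cyclic_sumI(2)[OF type3I[of 1 5 3 2 6 4]]; simp)+)
  show "cyclic_sum (?p 1 5)" "cyclic_sum (?p 2 6)"
    by ((rule cyclic_sumI(2)[OF type3I[of 1 3 5 2 4 6]]; simp)+)
qed

section \<open>Three rows with products of both types\<close>

lemma omega_mult_cube: "(omega * x) ^ 3 = x ^ 3" "(omega\<^sup>2 * x) ^ 3 = x ^ 3"
  by (simp_all add: omega_simps)

lemma type2_involution:
  assumes "type2 f"
  obtains \<pi> where "\<And>c. \<pi> c \<noteq> c" "\<And>c. \<pi> (\<pi> c) = c" "\<And>c. f (\<pi> c) = - f c"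
proof -
  obtain c1 c2 c3 c4 c5 c6 where c: "cols c1 c2 c3 c4 c5 c6" "f c2 = - f c1" "f c4 = - f c3" "f c6 = - f c5"
    using assms(1) unfolding type2_def by blast
  define \<pi> where "\<pi> c = (if c = c1 then c2 else if c = c2 then c1 else if c = c3 then c4
    else if c = c4 then c3 else if c = c5 then c6 else c5)" for c
  have d: "distinct [c1, c2, c3, c4, c5, c6]" using c(1) by (simp add: cols_def)
  have "\<forall>c. \<pi> c \<noteq> c \<and> \<pi> (\<pi> c) = c \<and> f (\<pi> c) = - f c"
    unfolding cols_all[OF c(1)] using d by (auto simp: \<pi>_def c(2-4))
  then show thesis
    using that by blast
qed

lemma type2_odd_power_sum:
  assumes "type2 f" "odd n"
  shows "(\<Sum>c\<in>UNIV. f c ^ n) = 0"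
  using assms unfolding type2_def by (auto simp: cols_sum)

text \<open>\<open>P\<close> holds the columns of one 3-cycle and \<open>- P\<close> those of the
  other. The values of a cycle multiply to their common cube because
  \<open>1 * omega * omega\<^sup>2 = 1\<close>. The cubes \<open>X\<close> and \<open>Y\<close> may
  coincide.\<close>

lemma type3_split:
  assumes "type3 f"
  obtains P X Y where "card P = 3" "\<And>c. c \<in> P \<Longrightarrow> f c ^ 3 = X" "\<And>c. c \<notin> P \<Longrightarrow> f c ^ 3 = Y"
    "sum f P = 0" "sum f (- P) = 0" "prod f P = X" "prod f (- P) = Y"
proof -
  obtain c1 c2 c3 c4 c5 c6 where c: "cols c1 c2 c3 c4 c5 c6" "f c2 = omega * f c1"
      "f c3 = omega\<^sup>2 * f c1" "f c5 = omega * f c4" "f c6 = omega\<^sup>2 * f c4"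
    using assms unfolding type3_def by blast
  have d: "distinct [c1, c2, c3, c4, c5, c6]" using c(1) by (simp add: cols_def)
  have m: "- {c1, c2, c3} = {c4, c5, c6}" by (rule cols_UNIV_minus[OF c(1)])
  have cube: "f c1 ^ 3 = f c1 ^ 3" "f c2 ^ 3 = f c1 ^ 3" "f c3 ^ 3 = f c1 ^ 3"
     "f c4 ^ 3 = f c4 ^ 3" "f c5 ^ 3 = f c4 ^ 3" "f c6 ^ 3 = f c4 ^ 3"
    by (simp_all add: c omega_simps)
  show thesis
  proof (rule that[of "{c1, c2, c3}" "f c1 ^ 3" "f c4 ^ 3"])
    show "f x ^ 3 = f c4 ^ 3" if "x \<notin> {c1, c2, c3}" for x
    proof -
      have "x \<in> {c4, c5, c6}" using that m by blast
      then show ?thesis using cube by auto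
    qed
  qed (use d cube in \<open>auto simp: m c omega_simps\<close>)
qed

text \<open>Two of the three columns lie in the same 3-cycle, whose values are pairwise
  distinct.\<close>

lemma type3_no_triple:
  assumes "type3 f" "\<And>c. f c \<noteq> 0" "distinct [a, b, c]" "f a = f b" "f b = f c"
  shows False
proof -
  obtain c1 c2 c3 c4 c5 c6 where c: "cols c1 c2 c3 c4 c5 c6" "f c2 = omega * f c1"
      "f c3 = omega\<^sup>2 * f c1" "f c5 = omega * f c4" "f c6 = omega\<^sup>2 * f c4"
    using assms(1) unfolding type3_def by blast
  have m: "- {c1, c2, c3} = {c4, c5, c6}" by (rule cols_UNIV_minus[OF c(1)])
  have i1: "inj_on f {c1, c2, c3}"
    unfolding inj_on_def by (use assms(2) in \<open>auto simp: c\<close>)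
  have i2: "inj_on f (- {c1, c2, c3})"
    unfolding m inj_on_def by (use assms(2) in \<open>auto simp: c\<close>)
  show False
    using i1 i2 assms(3-5) unfolding inj_on_def by (metis ComplI distinct_length_2_or_more)
qed

text \<open>This is the relation between the first and the fourth row of
  \<open>F23_matrix r s\<close>, whatever the parameters.\<close>

definition halved :: "(6 \<Rightarrow> complex) \<Rightarrow> bool" where
  "halved f \<longleftrightarrow> (\<exists>c1 c2 c3 c4 c5 c6. cols c1 c2 c3 c4 c5 c6 \<and> f c2 = f c1 \<and> f c3 = f c1 \<and>
     f c4 = - f c1 \<and> f c5 = - f c1 \<and> f c6 = - f c1)"

lemma halvedI:
  assumes "cols c1 c2 c3 c4 c5 c6" "f c2 = f c1" "f c3 = f c1" "f c4 = - f c1" "f c5 = - f c1" "f c6 = - f c1"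
  shows "halved f"
  unfolding halved_def by (intro exI conjI) (rule assms)+

text \<open>Each antipodal pair meets \<open>S\<close> once, since negation exchanges the two cubes.
  The three representatives in \<open>S\<close> have equal cubes. If they all agree,
  \<open>f\<close> is halved; if they all differ, they and their negatives are two 3-cycles. So
  exactly two of them agree.\<close>

lemma type2_antipodal_classes:
  assumes "type2 f" "\<not> type3 f" "\<not> halved f" "card S = 3" "s \<noteq> 0"
    and S: "\<And>c. c \<in> S \<Longrightarrow> f c ^ 3 = s" "\<And>c. c \<notin> S \<Longrightarrow> f c ^ 3 = - s"
  obtains c1 c2 c3 c4 c5 c6 where "cols c1 c2 c3 c4 c5 c6" "S = {c1, c3, c5}"
    "f c2 = - f c1" "f c4 = - f c3" "f c6 = - f c5" "f c3 = f c1" "f c5 \<noteq> f c1"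
proof -
  obtain d1 d2 d3 d4 d5 d6 where d: "cols d1 d2 d3 d4 d5 d6" "f d2 = - f d1" "f d4 = - f d3" "f d6 = - f d5"
    using assms(1) unfolding type2_def by blast
  have opp: "b \<notin> S" if "f b = - f a" "a \<in> S" for a b
    using S(1)[OF that(2)] S(1)[of b] that(1) assms(5) by auto
  have opp': "b \<in> S" if "f b = - f a" "a \<notin> S" for a b
    using S(2)[OF that(2)] S(2)[of b] that(1) assms(5) by auto
  have "\<exists>e1 e2. {e1, e2} = {a, b} \<and> f e2 = - f e1 \<and> e1 \<in> S" if "f b = - f a" for a b
  proof (cases "a \<in> S")
    case True
    then show ?thesis using that by blast
  next
    case False
    then have "b \<in> S" "f a = - f b" "{b, a} = {a, b}" using opp'[OF that] that by auto
    then show ?thesis by blast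
  qed
  then obtain c1 c2 c3 c4 c5 c6 where e: "{c1, c2} = {d1, d2}" "f c2 = - f c1" "c1 \<in> S"
      "{c3, c4} = {d3, d4}" "f c4 = - f c3" "c3 \<in> S" "{c5, c6} = {d5, d6}" "f c6 = - f c5" "c5 \<in> S"
    using d(2-4) by metis
  have c: "cols c1 c2 c3 c4 c5 c6"
    using e(1,4,7) d(1) unfolding cols_def by (auto simp: doubleton_eq_iff)
  have "{c1, c3, c5} \<subseteq> S" using e by auto
  moreover have "card {c1, c3, c5} = 3" using c by (auto simp: cols_def)
  ultimately have S3: "S = {c1, c3, c5}"
    using assms(4) by (metis card_subset_eq finite)
  have p: "f c1 ^ 3 = s" "f c3 ^ 3 = s" "f c5 ^ 3 = s"
    using S(1) e by auto
  consider "f c1 = f c3" "f c3 = f c5" | "f c1 = f c3" "f c5 \<noteq> f c1" | "f c1 = f c5" "f c3 \<noteq> f c1"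
    | "f c3 = f c5" "f c1 \<noteq> f c3" | "f c3 \<noteq> f c1" "f c5 \<noteq> f c1" "f c3 \<noteq> f c5" by metis
  then show thesis
  proof cases
    case 1
    have "cols c1 c3 c5 c2 c4 c6" using c by (auto simp: cols_def)
    then have "halved f" by (rule halvedI) (use 1 e in auto)
    then show ?thesis using assms(3) by blast
  next
    case 2
    then show ?thesis using that[OF c S3] e by metis
  next
    case 3
    have "cols c1 c2 c5 c6 c3 c4" "S = {c1, c5, c3}" using c S3 by (auto simp: cols_def)
    then show ?thesis using that 3 e by metis
  next
    case 4
    have "cols c3 c4 c5 c6 c1 c2" "S = {c3, c5, c1}" using c S3 by (auto simp: cols_def)
    then show ?thesis using that 4 e by metis
  next
    case 5
    have "f c3 = omega * f c1 \<or> f c3 = omega\<^sup>2 * f c1" "f c5 = omega * f c1 \<or> f c5 = omega\<^sup>2 * f c1"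
      using cube_root_cases[of "f c3" "f c1"] cube_root_cases[of "f c5" "f c1"] p 5 by auto
    then consider "f c3 = omega * f c1" "f c5 = omega\<^sup>2 * f c1" | "f c3 = omega\<^sup>2 * f c1" "f c5 = omega * f c1"
      using 5 by auto
    then have "type3 f"
    proof cases
      case 1
      have "cols c1 c3 c5 c2 c4 c6" using c by (auto simp: cols_def)
      then show ?thesis by (rule type3I) (use 1 e in auto)
    next
      case 2
      have "cols c1 c5 c3 c2 c6 c4" using c by (auto simp: cols_def)
      then show ?thesis by (rule type3I) (use 2 e in auto)
    qed
    then show ?thesis using assms(2) by blast
  qed
qed

section \<open>Two triples of columns and the four cells they cut out\<close>

lemma card_Compl_6: "card (- A) = 6 - card A" for A :: "6 set"
  by (simp add: Compl_eq_Diff_UNIV card_Diff_subset)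

text \<open>As both triples have three of the six columns, \<open>n = card (P \<inter> Q)\<close>
  fixes all cell sizes: \<open>n\<close> for the intersection and for the outside,
  \<open>3 - n\<close> for the two differences.\<close>

lemma sum_four_cells:
  fixes \<phi> :: "6 \<Rightarrow> complex"
  assumes "card P = 3" "card Q = 3"
    and "\<And>c. c \<in> P \<Longrightarrow> c \<in> Q \<Longrightarrow> \<phi> c = x" "\<And>c. c \<in> P \<Longrightarrow> c \<notin> Q \<Longrightarrow> \<phi> c = z"
    and "\<And>c. c \<notin> P \<Longrightarrow> c \<in> Q \<Longrightarrow> \<phi> c = w" "\<And>c. c \<notin> P \<Longrightarrow> c \<notin> Q \<Longrightarrow> \<phi> c = y"
  shows "sum \<phi> UNIV = of_nat (card (P \<inter> Q)) * (x + y) + of_nat (3 - card (P \<inter> Q)) * (z + w)"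
proof -
  let ?n = "card (P \<inter> Q)"
  have U: "UNIV = ((P \<inter> Q) \<union> (P - Q)) \<union> ((Q - P) \<union> (- (P \<union> Q)))" by blast
  have "sum \<phi> UNIV = (sum \<phi> (P \<inter> Q) + sum \<phi> (P - Q)) + (sum \<phi> (Q - P) + sum \<phi> (- (P \<union> Q)))"
    by (subst U, subst sum.union_disjoint; (subst sum.union_disjoint)?; (subst sum.union_disjoint)?; auto)
  also have "\<dots> = of_nat ?n * x + of_nat (card (P - Q)) * z + (of_nat (card (Q - P)) * w + of_nat (card (- (P \<union> Q))) * y)"
    using assms(3-6) by simp
  also have "card (P - Q) = 3 - ?n" using assms(1) by (simp add: card_Diff_subset_Int)
  also have "card (Q - P) = 3 - ?n" using assms(2) by (simp add: card_Diff_subset_Int Int_commute)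
  also have "card (- (P \<union> Q)) = ?n"
  proof -
    have "card (P \<union> Q) + ?n = 6" using card_Un_Int[of P Q] assms(1,2) by simp
    moreover have "card (- (P \<union> Q)) = 6 - card (P \<union> Q)" by (rule card_Compl_6)
    ultimately show ?thesis by simp
  qed
  finally show ?thesis by (simp add: algebra_simps)
qed

text \<open>Since \<open>x y = z w\<close>, eliminating one of \<open>x + y\<close> and \<open>z + w\<close> from the two power sums leaves
  the cube of the other.\<close>

lemma four_cells_antipodal:
  fixes x y z w :: complex
  assumes "n \<le> 3" "x * y = z * w"
    and "of_nat n * (x + y) + of_nat (3 - n) * (z + w) = 0"
    and "of_nat n * (x ^ 3 + y ^ 3) + of_nat (3 - n) * (z ^ 3 + w ^ 3) = 0"
  shows "n = 0 \<and> w = - z \<or> n = 3 \<and> y = - x \<or> y = - x \<and> w = - z \<and> (z = x \<or> z = - x)"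
proof -
  consider "n = 0" | "n = 1" | "n = 2" | "n = 3" using assms(1) by linarith
  then show ?thesis
  proof cases
    case 1
    then show ?thesis using assms(3) by (simp add: add_eq_0_iff)
  next
    case 2
    have a: "x + y = - (2 * (z + w))" using assms(3) 2 unfolding eq_neg_iff_add_eq_0 by simp
    have b: "x ^ 3 + y ^ 3 + 2 * (z ^ 3 + w ^ 3) = 0" using assms(4) 2 by simp
    have "x ^ 3 + y ^ 3 + 2 * (z ^ 3 + w ^ 3) = (x + y) ^ 3 - 3 * (x * y) * (x + y) + 2 * ((z + w) ^ 3 - 3 * (z * w) * (z + w))"
      by (simp add: power3_eq_cube algebra_simps)
    also have "\<dots> = - 6 * (z + w) ^ 3"
      unfolding a assms(2) by (simp add: power3_eq_cube algebra_simps)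
    finally have "z + w = 0" using b by simp
    then have w: "w = - z" and y: "y = - x" using a by (simp_all add: add_eq_0_iff)
    then have "(z - x) * (z + x) = 0" using assms(2) by (simp add: algebra_simps)
    then show ?thesis using w y by (auto simp: add_eq_0_iff)
  next
    case 3
    have a: "z + w = - (2 * (x + y))" using assms(3) 3 unfolding eq_neg_iff_add_eq_0 by (simp add: add.commute)
    have b: "2 * (x ^ 3 + y ^ 3) + (z ^ 3 + w ^ 3) = 0" using assms(4) 3 by simp
    have "2 * (x ^ 3 + y ^ 3) + (z ^ 3 + w ^ 3) = (z + w) ^ 3 - 3 * (z * w) * (z + w) + 2 * ((x + y) ^ 3 - 3 * (x * y) * (x + y))"
      by (simp add: power3_eq_cube algebra_simps)
    also have "\<dots> = - 6 * (x + y) ^ 3"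
      unfolding a assms(2) by (simp add: power3_eq_cube algebra_simps)
    finally have "x + y = 0" using b by simp
    then have w: "w = - z" and y: "y = - x" using a by (simp_all add: add_eq_0_iff)
    then have "(z - x) * (z + x) = 0" using assms(2) by (simp add: algebra_simps)
    then show ?thesis using w y by (auto simp: add_eq_0_iff)
  next
    case 4
    then show ?thesis using assms(3) by (simp add: add_eq_0_iff)
  qed
qed

lemma cols_sum_odd_even:
  fixes f :: "6 \<Rightarrow> complex"
  assumes "cols c1 c2 c3 c4 c5 c6" "S = {c1, c3, c5}"
  shows "sum f S = f c1 + f c3 + f c5" "sum f (- S) = f c2 + f c4 + f c6"
proof -
  have "cols c1 c3 c5 c2 c4 c6" using assms(1) by (auto simp: cols_def)
  then have "- S = {c2, c4, c6}" unfolding assms(2) by (rule cols_UNIV_minus)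
  then show "sum f S = f c1 + f c3 + f c5" "sum f (- S) = f c2 + f c4 + f c6"
    using assms by (auto simp: cols_def add.assoc)
qed

text \<open>Only the third weight is different, so subtracting \<open>1 / t\<close> times the first
  relation from the second isolates \<open>d\<close>.\<close>

lemma weighted_sum_zero:
  fixes a b d t u :: complex
  assumes "a + b + d = 0" "a / t + b / t + d / u = 0" "u \<noteq> 0" "t \<noteq> u"
  shows "d = 0"
proof -
  have "a / t + b / t + d / u = (a + b + d) / t + d * (1 / u - 1 / t)"
    by (simp add: add_divide_distrib algebra_simps)
  then show ?thesis using assms by simp
qed

text \<open>On the four cells cut out by the 3-cycles of \<open>g\<close> and of \<open>g / f\<close>, the cube of \<open>f\<close> is constant, with
  values \<open>X / U\<close>, \<open>X / V\<close>, \<open>Y / U\<close>, \<open>Y / V\<close>; its odd power sums vanish because \<open>f\<close> has type 2.\<close>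

lemma type2_type3_type3_halved:
  assumes f: "type2 f" "\<not> type3 f" and g: "type3 g" "type3 (\<lambda>c. g c / f c)"
    and nz: "\<And>c. f c \<noteq> 0" "\<And>c. g c \<noteq> 0"
  shows "halved f"
proof (rule ccontr)
  assume nG: "\<not> halved f"
  let ?k = "\<lambda>c. g c / f c"
  obtain P X Y where P: "card P = 3" "\<And>c. c \<in> P \<Longrightarrow> g c ^ 3 = X" "\<And>c. c \<notin> P \<Longrightarrow> g c ^ 3 = Y"
    "sum g P = 0" "sum g (- P) = 0" "prod g P = X" "prod g (- P) = Y"
    by (rule type3_split[OF g(1)]) (rule that; blast)
  obtain Q U V where Q: "card Q = 3" "\<And>c. c \<in> Q \<Longrightarrow> ?k c ^ 3 = U" "\<And>c. c \<notin> Q \<Longrightarrow> ?k c ^ 3 = V"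
    "sum ?k Q = 0" "sum ?k (- Q) = 0" "prod ?k Q = U" "prod ?k (- Q) = V"
    by (rule type3_split[OF g(2)]) (rule that; blast)
  have cP: "card (- P) = 3" and cQ: "card (- Q) = 3"
    using P(1) Q(1) by (simp_all add: card_Compl_6)
  obtain p p' q q' where pq: "p \<in> P" "p' \<notin> P" "q \<in> Q" "q' \<notin> Q"
  proof -
    have "P \<noteq> {}" "- P \<noteq> {}" "Q \<noteq> {}" "- Q \<noteq> {}" using P(1) Q(1) cP cQ by auto
    then show thesis using that by auto
  qed
  have nzX: "X \<noteq> 0" "Y \<noteq> 0" "U \<noteq> 0" "V \<noteq> 0"
    using P(2)[OF pq(1)] P(3)[OF pq(2)] Q(2)[OF pq(3)] Q(3)[OF pq(4)] nz by (auto simp: power_divide)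
  have F: "f c ^ 3 = g c ^ 3 / ?k c ^ 3" for c
    using nz by (simp add: power_divide)
  let ?n = "card (P \<inter> Q)"
  have F4: "\<And>c. c \<in> P \<Longrightarrow> c \<in> Q \<Longrightarrow> f c ^ 3 = X / U" "\<And>c. c \<in> P \<Longrightarrow> c \<notin> Q \<Longrightarrow> f c ^ 3 = X / V"
     "\<And>c. c \<notin> P \<Longrightarrow> c \<in> Q \<Longrightarrow> f c ^ 3 = Y / U" "\<And>c. c \<notin> P \<Longrightarrow> c \<notin> Q \<Longrightarrow> f c ^ 3 = Y / V"
    using P(2,3) Q(2,3) by (simp_all add: F)
  have n: "?n \<le> 3" using P(1) by (metis card_mono finite inf_le1)
  have "?n = 0 \<and> Y / U = - (X / V) \<or> ?n = 3 \<and> Y / V = - (X / U) \<or>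
     Y / V = - (X / U) \<and> Y / U = - (X / V) \<and> (X / V = X / U \<or> X / V = - (X / U))"
  proof (rule four_cells_antipodal[OF n])
    show "X / U * (Y / V) = X / V * (Y / U)" by simp
    show "of_nat ?n * (X / U + Y / V) + of_nat (3 - ?n) * (X / V + Y / U) = 0"
      using sum_four_cells[OF P(1) Q(1), of "\<lambda>c. f c ^ 3", OF F4]
        type2_odd_power_sum[OF f(1), of 3] by simp
    have F9: "f c ^ 9 = (f c ^ 3) ^ 3" for c by (simp flip: power_mult)
    have "\<And>c. c \<in> P \<Longrightarrow> c \<in> Q \<Longrightarrow> f c ^ 9 = (X / U) ^ 3" "\<And>c. c \<in> P \<Longrightarrow> c \<notin> Q \<Longrightarrow> f c ^ 9 = (X / V) ^ 3"
     "\<And>c. c \<notin> P \<Longrightarrow> c \<in> Q \<Longrightarrow> f c ^ 9 = (Y / U) ^ 3" "\<And>c. c \<notin> P \<Longrightarrow> c \<notin> Q \<Longrightarrow> f c ^ 9 = (Y / V) ^ 3"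
      by (simp_all only: F9 F4 simp_thms if_True)
    from sum_four_cells[OF P(1) Q(1), of "\<lambda>c. f c ^ 9", OF this]
    show "of_nat ?n * ((X / U) ^ 3 + (Y / V) ^ 3) + of_nat (3 - ?n) * ((X / V) ^ 3 + (Y / U) ^ 3) = 0"
      using type2_odd_power_sum[OF f(1), of 9] by simp
  qed
  moreover have "U = V" if "X / V = X / U"
    using that nzX by (simp add: field_simps)
  moreover have "V = - U" if "X / V = - (X / U)"
  proof -
    have "X * U = X * (- V)" using that nzX by (simp add: field_simps)
    then have "U = - V" using nzX(1) mult_left_cancel by blast
    then show ?thesis by simp
  qed
  ultimately consider
      (i) "?n = 0" "Y / U = - (X / V)"
    | (i') "?n = 3" "Y / V = - (X / U)"
    | (ii) "Y / V = - (X / U)" "U = V"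
    | (iii) "Y / V = - (X / U)" "Y / U = - (X / V)" "V = - U"
    by metis
  then show False
  proof cases
    \<comment> \<open>The triples of \<open>g\<close> and \<open>g / f\<close> are complementary, so
      both functions sum to zero over \<open>P\<close>. Two of the three values of \<open>f\<close>
      on \<open>P\<close> agree, and the weights \<open>1 / f\<close> force the third value of
      \<open>g\<close> to vanish.\<close>
    case i
    then have "P \<inter> Q = {}" by simp
    then have "Q \<subseteq> - P" by blast
    then have QP: "Q = - P" using cP Q(1) by (metis card_subset_eq finite)
    have "\<And>c. c \<in> P \<Longrightarrow> f c ^ 3 = X / V" "\<And>c. c \<notin> P \<Longrightarrow> f c ^ 3 = - (X / V)"
      using F4 QP i(2) by auto
    then obtain c1 c2 c3 c4 c5 c6 where c: "cols c1 c2 c3 c4 c5 c6" "P = {c1, c3, c5}" "f c3 = f c1" "f c5 \<noteq> f c1"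
      using type2_antipodal_classes[OF f nG P(1), of "X / V"] nzX by (metis divide_eq_0_iff)
    have "g c1 + g c3 + g c5 = 0" using P(4) cols_sum_odd_even[OF c(1,2)] by metis
    moreover have "?k c1 + ?k c3 + ?k c5 = 0"
      using Q(5) cols_sum_odd_even(1)[OF c(1,2), of ?k] QP by simp
    ultimately show False
      using weighted_sum_zero[of "g c1" "g c3" "g c5" "f c1" "f c5"] nz c(3,4) by simp
  next
    case i'
    then have "P \<inter> Q = P" "P \<inter> Q = Q" using P(1) Q(1) by (metis card_subset_eq finite inf_le1 inf_le2)+
    then have QP: "Q = P" by blast
    have "\<And>c. c \<in> P \<Longrightarrow> f c ^ 3 = X / U" "\<And>c. c \<notin> P \<Longrightarrow> f c ^ 3 = - (X / U)"
      using F4 QP i'(2) by auto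
    then obtain c1 c2 c3 c4 c5 c6 where c: "cols c1 c2 c3 c4 c5 c6" "P = {c1, c3, c5}" "f c3 = f c1" "f c5 \<noteq> f c1"
      using type2_antipodal_classes[OF f nG P(1), of "X / U"] nzX by (metis divide_eq_0_iff)
    have "g c1 + g c3 + g c5 = 0" using P(4) cols_sum_odd_even[OF c(1,2)] by metis
    moreover have "?k c1 + ?k c3 + ?k c5 = 0"
      using Q(4) cols_sum_odd_even(1)[OF c(1,2), of ?k] QP by simp
    ultimately show False
      using weighted_sum_zero[of "g c1" "g c3" "g c5" "f c1" "f c5"] nz c(3,4) by simp
  next
    \<comment> \<open>Now \<open>Y = - X\<close>, and \<open>P\<close> contains one column of each
      antipodal pair of \<open>f\<close>. For the differences of \<open>g\<close> over these pairs,
      the triple sums of \<open>g\<close> and the total sum of \<open>g / f\<close> form a system of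
      the same kind.\<close>
    case ii
    have YX: "Y = - X" using ii nzX by (simp add: field_simps)
    have "\<And>c. c \<in> P \<Longrightarrow> f c ^ 3 = X / U" "\<And>c. c \<notin> P \<Longrightarrow> f c ^ 3 = - (X / U)"
      using F4 ii YX by auto
    then obtain c1 c2 c3 c4 c5 c6 where c: "cols c1 c2 c3 c4 c5 c6" "P = {c1, c3, c5}" "f c3 = f c1" "f c5 \<noteq> f c1"
       "f c2 = - f c1" "f c4 = - f c3" "f c6 = - f c5"
      using type2_antipodal_classes[OF f nG P(1), of "X / U"] nzX by (metis divide_eq_0_iff)
    have "(g c1 - g c2) + (g c3 - g c4) + (g c5 - g c6) = sum g P - sum g (- P)"
      unfolding cols_sum_odd_even[OF c(1,2)] by simp
    then have "(g c1 - g c2) + (g c3 - g c4) + (g c5 - g c6) = 0"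
      using P(4,5) by simp
    moreover have "(g c1 - g c2) / f c1 + (g c3 - g c4) / f c1 + (g c5 - g c6) / f c5
       = ?k c1 + ?k c2 + ?k c3 + ?k c4 + ?k c5 + ?k c6"
      unfolding c(3,5-7) by (simp add: diff_divide_distrib)
    then have "(g c1 - g c2) / f c1 + (g c3 - g c4) / f c1 + (g c5 - g c6) / f c5 = 0"
      using type3_sum[OF g(2)] cols_sum[OF c(1), of ?k] by simp
    ultimately have "g c5 - g c6 = 0"
      by (rule weighted_sum_zero) (use nz c(4) in auto)
    then have "g c5 = g c6" by simp
    moreover have "g c5 ^ 3 = X" "g c6 ^ 3 = - X"
      using P(2)[of c5] P(3)[of c6] c(1) YX unfolding c(2) by (auto simp: cols_def)
    ultimately show False using nzX by simp
  next
    \<comment> \<open>The same argument with \<open>g\<close> and \<open>g / f\<close> exchanged and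
      \<open>f\<close> replaced by \<open>1 / f\<close>.\<close>
    case iii
    have YX: "Y = X" using iii nzX by (simp add: field_simps)
    have "\<And>c. c \<in> Q \<Longrightarrow> f c ^ 3 = X / U" "\<And>c. c \<notin> Q \<Longrightarrow> f c ^ 3 = - (X / U)"
      using F4 iii YX by auto
    then obtain c1 c2 c3 c4 c5 c6 where c: "cols c1 c2 c3 c4 c5 c6" "Q = {c1, c3, c5}" "f c3 = f c1" "f c5 \<noteq> f c1"
       "f c2 = - f c1" "f c4 = - f c3" "f c6 = - f c5"
      using type2_antipodal_classes[OF f nG Q(1), of "X / U"] nzX by (metis divide_eq_0_iff)
    have "(?k c1 - ?k c2) + (?k c3 - ?k c4) + (?k c5 - ?k c6) = sum ?k Q - sum ?k (- Q)"
      unfolding cols_sum_odd_even[OF c(1,2)] by simp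
    then have "(?k c1 - ?k c2) + (?k c3 - ?k c4) + (?k c5 - ?k c6) = 0"
      using Q(4,5) by simp
    moreover have "(?k c1 - ?k c2) / (1 / f c1) + (?k c3 - ?k c4) / (1 / f c1) + (?k c5 - ?k c6) / (1 / f c5)
        = f c1 * ?k c1 + f c2 * ?k c2 + f c3 * ?k c3 + f c4 * ?k c4 + f c5 * ?k c5 + f c6 * ?k c6"
      unfolding c(3,5-7) using nz by (simp add: diff_divide_distrib ring_distribs)
    then have "(?k c1 - ?k c2) / (1 / f c1) + (?k c3 - ?k c4) / (1 / f c1) + (?k c5 - ?k c6) / (1 / f c5) = 0"
      using type3_sum[OF g(1)] cols_sum[OF c(1), of g] nz by simp
    ultimately have "?k c5 - ?k c6 = 0"
      by (rule weighted_sum_zero) (use nz c(4) in auto)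
    then have "?k c5 = ?k c6" by simp
    moreover have "?k c5 ^ 3 = U" "?k c6 ^ 3 = - U"
      using Q(2)[of c5] Q(3)[of c6] c(1) iii(3) unfolding c(2) by (auto simp: cols_def)
    ultimately show False using nzX by simp
  qed
qed

section \<open>Common antipodal pairings\<close>

definition share_matching :: "(6 \<Rightarrow> complex) \<Rightarrow> (6 \<Rightarrow> complex) \<Rightarrow> bool" where
  "share_matching f g \<longleftrightarrow> (\<exists>c1 c2 c3 c4 c5 c6. cols c1 c2 c3 c4 c5 c6 \<and>
     f c2 = - f c1 \<and> f c4 = - f c3 \<and> f c6 = - f c5 \<and> g c2 = - g c1 \<and> g c4 = - g c3 \<and> g c6 = - g c5)"

lemma share_matchingI:
  assumes "cols c1 c2 c3 c4 c5 c6"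
    "f c2 = - f c1" "f c4 = - f c3" "f c6 = - f c5" "g c2 = - g c1" "g c4 = - g c3" "g c6 = - g c5"
  shows "share_matching f g"
  unfolding share_matching_def by (intro exI conjI) (rule assms)+

text \<open>Negation changes the sign of an odd power, so the pairing of \<open>f\<close> exchanges
  \<open>Q\<close> with its complement; three sign changes give the minus sign.\<close>

lemma prod_antipodal:
  assumes "type2 f" "odd n" "s \<noteq> 0" "card Q = 3"
    and "\<And>c. c \<in> Q \<Longrightarrow> f c ^ n = s" "\<And>c. c \<notin> Q \<Longrightarrow> f c ^ n = - s"
  shows "prod f (- Q) = - prod f Q"
proof -
  obtain \<pi> where \<pi>: "\<And>c. \<pi> c \<noteq> c" "\<And>c. \<pi> (\<pi> c) = c" "\<And>c. f (\<pi> c) = - f c"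
    using type2_involution[OF assms(1)] by blast
  have flip: "\<pi> c \<in> Q \<longleftrightarrow> c \<notin> Q" for c
  proof -
    have "f (\<pi> c) ^ n = - (f c ^ n)" using assms(2) by (simp add: \<pi>(3))
    then show ?thesis using assms(3,5,6) by (cases "c \<in> Q"; cases "\<pi> c \<in> Q") auto
  qed
  have "prod f (- Q) = prod (\<lambda>c. f (\<pi> c)) Q"
    by (rule prod.reindex_bij_witness[of _ \<pi> \<pi>]) (auto simp: \<pi>(2) flip)
  also have "\<dots> = (\<Prod>c\<in>Q. (-1) * f c)" by (simp add: \<pi>(3))
  also have "\<dots> = - prod f Q" unfolding prod.distrib using assms(4) by simp
  finally show ?thesis .
qed

lemma card_3_elems:
  assumes "card A = 3"
  obtains a b c where "A = {a, b, c}" "a \<noteq> b" "a \<noteq> c" "b \<noteq> c"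
  using assms by (auto simp: card_3_iff)

lemma three_units_sum_zero_cubes:
  fixes \<phi> :: "6 \<Rightarrow> complex"
  assumes "card A = 3" "sum \<phi> A = 0" "\<And>c. norm (\<phi> c) = 1"
  obtains s where "\<And>c. c \<in> A \<Longrightarrow> \<phi> c ^ 3 = s"
proof -
  obtain a b c where A: "A = {a, b, c}" "a \<noteq> b" "a \<noteq> c" "b \<noteq> c"
    using assms(1) by (rule card_3_elems)
  have "\<phi> a + \<phi> b + \<phi> c = 0" using assms(2) A by (simp add: add.assoc)
  then have "\<phi> b = omega * \<phi> a \<and> \<phi> c = omega\<^sup>2 * \<phi> a \<or> \<phi> b = omega\<^sup>2 * \<phi> a \<and> \<phi> c = omega * \<phi> a"
    by (intro three_units_sum_zero assms(3))
  then have "\<phi> b ^ 3 = \<phi> a ^ 3 \<and> \<phi> c ^ 3 = \<phi> a ^ 3"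
    using omega_mult_cube by metis
  then show thesis
    using that[of "\<phi> a ^ 3"] A(1) by auto
qed

lemma triple_sum_zero:
  fixes a b :: complex
  assumes "3 * a + 3 * b = 0"
  shows "b = - a"
proof -
  have "3 * (a + b) = 0" using assms by (simp only: distrib_left)
  then have "a + b = 0" unfolding mult_eq_0_iff by simp
  then show ?thesis by (simp only: eq_neg_iff_add_eq_0 add.commute)
qed

text \<open>If the cubes of the two 3-cycles of \<open>g / f\<close> were different, then the power sums would force
  the pairings of \<open>f\<close> and of \<open>g\<close> to match the two triples of columns with each other. The
  products over the two triples are then opposite for \<open>f\<close> and for \<open>g\<close>, hence equal for \<open>g / f\<close>.\<close>

lemma type3_quotient_pure:
  assumes f: "type2 f" "type2 g" "type3 (\<lambda>c. g c / f c)"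
    and n: "\<And>c. norm (f c) = 1" "\<And>c. norm (g c) = 1"
  obtains U where "\<And>c. g c ^ 3 = U * f c ^ 3"
proof -
  let ?k = "\<lambda>c. g c / f c"
  have nz: "f c \<noteq> 0" "g c \<noteq> 0" for c using n[of c] by auto
  obtain Q U V where Q: "card Q = 3" "\<And>c. c \<in> Q \<Longrightarrow> ?k c ^ 3 = U" "\<And>c. c \<notin> Q \<Longrightarrow> ?k c ^ 3 = V"
    "sum ?k Q = 0" "sum ?k (- Q) = 0" "prod ?k Q = U" "prod ?k (- Q) = V"
    by (rule type3_split[OF f(3)]) (rule that; blast)
  have cQ: "card (- Q) = 3" using Q(1) by (simp add: card_Compl_6)
  have G: "g c ^ 3 = U * f c ^ 3" if "c \<in> Q" for c
    using Q(2)[OF that] nz by (simp add: power_divide field_simps)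
  have G': "g c ^ 3 = V * f c ^ 3" if "c \<notin> Q" for c
    using Q(3)[OF that] nz by (simp add: power_divide field_simps)
  have split: "sum \<phi> UNIV = sum \<phi> Q + sum \<phi> (- Q)" for \<phi> :: "6 \<Rightarrow> complex"
    using sum.union_disjoint[of Q "- Q" \<phi>] by simp
  have "U = V"
  proof (rule ccontr)
    assume UV: "U \<noteq> V"
    let ?F = "\<lambda>c. f c ^ 3"
    have F0: "sum ?F Q + sum ?F (- Q) = 0"
      using type2_odd_power_sum[OF f(1), of 3] split[of ?F] by simp
    have "sum (\<lambda>c. g c ^ 3) Q + sum (\<lambda>c. g c ^ 3) (- Q) = 0"
      using type2_odd_power_sum[OF f(2), of 3] split[of "\<lambda>c. g c ^ 3"] by simp
    moreover have "sum (\<lambda>c. g c ^ 3) Q = U * sum ?F Q" "sum (\<lambda>c. g c ^ 3) (- Q) = V * sum ?F (- Q)"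
      using G G' by (simp_all add: sum_distrib_left)
    moreover have neg: "sum ?F (- Q) = - sum ?F Q"
      using F0 by (simp only: eq_neg_iff_add_eq_0 add.commute)
    ultimately have "U * sum ?F Q + V * (- sum ?F Q) = 0"
      by (simp only:)
    then have "(U - V) * sum ?F Q = 0"
      by (simp add: left_diff_distrib)
    \<comment> \<open>The cube sums of \<open>f\<close> and of \<open>g\<close> give two linear
      equations for the sums over the two triples, independent because
      \<open>U \<noteq> V\<close>.\<close>
    then have F1: "sum ?F Q = 0" "sum ?F (- Q) = 0" using UV F0 by auto
    have nF: "norm (f c ^ 3) = 1" for c using n by (simp add: norm_power)
    \<comment> \<open>Three unit numbers with sum zero have equal cubes; applied to
      \<open>f c ^ 3\<close>, this makes the ninth power constant on each triple.\<close>
    obtain s where s: "\<And>c. c \<in> Q \<Longrightarrow> (f c ^ 3) ^ 3 = s"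
      using three_units_sum_zero_cubes[OF Q(1) F1(1) nF] by blast
    obtain s' where s': "\<And>c. c \<in> - Q \<Longrightarrow> (f c ^ 3) ^ 3 = s'"
      using three_units_sum_zero_cubes[OF cQ F1(2) nF] by blast
    have pw: "x ^ 9 = (x ^ 3) ^ 3" for x :: complex by simp
    have f9: "f c ^ 9 = s" if "c \<in> Q" for c using s[OF that] by simp
    have f9': "f c ^ 9 = s'" if "c \<notin> Q" for c using s'[of c] that by simp
    have "sum (\<lambda>c. f c ^ 9) Q + sum (\<lambda>c. f c ^ 9) (- Q) = 0"
      using type2_odd_power_sum[OF f(1), of 9] split[of "\<lambda>c. f c ^ 9"] by simp
    then have "3 * s + 3 * s' = 0" using f9 f9' Q(1) cQ by simp
    then have ss: "s' = - s" by (rule triple_sum_zero)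
    have g9: "g c ^ 9 = U ^ 3 * s" if "c \<in> Q" for c
      unfolding pw[of "g c"] G[OF that] using f9[OF that] by (simp add: power_mult_distrib)
    have g9': "g c ^ 9 = V ^ 3 * s'" if "c \<notin> Q" for c
      unfolding pw[of "g c"] G'[OF that] using f9'[OF that] by (simp add: power_mult_distrib)
    have "sum (\<lambda>c. g c ^ 9) Q + sum (\<lambda>c. g c ^ 9) (- Q) = 0"
      using type2_odd_power_sum[OF f(2), of 9] split[of "\<lambda>c. g c ^ 9"] by simp
    then have "3 * (U ^ 3 * s) + 3 * (V ^ 3 * s') = 0" using g9 g9' Q(1) cQ by simp
    then have "V ^ 3 * s' = - (U ^ 3 * s)" by (rule triple_sum_zero)
    then have g9'': "g c ^ 9 = - (U ^ 3 * s)" if "c \<notin> Q" for c using g9'[OF that] by simp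
    obtain c0 where "c0 \<in> Q" using Q(1) by (metis card.empty ex_in_conv zero_neq_numeral)
    then have nzs: "s \<noteq> 0" "U \<noteq> 0" using f9[of c0] Q(2)[of c0] nz by auto
    have "prod f (- Q) = - prod f Q"
      by (rule prod_antipodal[OF f(1) _ nzs(1) Q(1), of 9]) (use f9 f9' ss in auto)
    moreover have "prod g (- Q) = - prod g Q"
      by (rule prod_antipodal[OF f(2) _ _ Q(1), of 9 "U ^ 3 * s"]) (use g9 g9'' nzs in auto)
    moreover have "prod g Q = U * prod f Q" "prod g (- Q) = V * prod f (- Q)"
      unfolding Q(6,7)[symmetric] prod.distrib[symmetric] using nz by simp_all
    moreover have "prod f Q \<noteq> 0" using nz by simp
    ultimately show False using UV by simp
  qed
  then show thesis using that G G' by metis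
qed

text \<open>The cubes of \<open>g\<close> are a constant multiple of those of \<open>f\<close>, so
  columns opposite for \<open>g\<close> are opposite for the cubes of \<open>f\<close>. If
  \<open>f c ^ 6\<close> is constant, both functions have one doubled and one single value on a
  common triple \<open>S\<close>, and a mismatch would repeat a value of \<open>g / f\<close> three
  times. Otherwise one pair of \<open>f\<close> is isolated by its sixth power and must be a pair of
  \<open>g\<close>; the other four columns are then compared directly.\<close>

lemma type2_type2_type3_share:
  assumes f: "type2 f" "\<not> type3 f" "\<not> halved f" and g: "type2 g" "\<not> type3 g" "\<not> halved g"
    and k: "type3 (\<lambda>c. g c / f c)"
    and n: "\<And>c. norm (f c) = 1" "\<And>c. norm (g c) = 1"
  shows "share_matching f g"
proof -
  let ?k = "\<lambda>c. g c / f c"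
  have nz: "f c \<noteq> 0" "g c \<noteq> 0" for c using n[of c] by auto
  obtain U where U: "\<And>c. g c ^ 3 = U * f c ^ 3"
    using type3_quotient_pure[OF f(1) g(1) k n] by blast
  have nzU: "U \<noteq> 0" using U[of 0] nz[of 0] by auto
  have no3: False if "distinct [a, b, c]" "?k a = ?k b" "?k b = ?k c" for a b c
    by (rule type3_no_triple[OF k _ that]) (use nz in simp)
  obtain d1 d2 d3 d4 d5 d6 where d: "cols d1 d2 d3 d4 d5 d6" "f d2 = - f d1" "f d4 = - f d3" "f d6 = - f d5"
    using f(1) unfolding type2_def by blast
  show ?thesis
  proof (cases "\<forall>c. f c ^ 6 = f d1 ^ 6")
    case True
    define s where "s = f d1 ^ 3"
    have s0: "s \<noteq> 0" using nz by (simp add: s_def)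
    have pm: "f c ^ 3 = s \<or> f c ^ 3 = - s" for c
    proof -
      have "(f c ^ 3)\<^sup>2 = s\<^sup>2"
        using True unfolding s_def by (simp flip: power_mult)
      then show ?thesis by (rule power2_eq_iff[THEN iffD1])
    qed
    define S where "S = {c. f c ^ 3 = s}"
    have S: "f c ^ 3 = s" if "c \<in> S" for c using that by (simp add: S_def)
    have S': "f c ^ 3 = - s" if "c \<notin> S" for c using that pm[of c] by (simp add: S_def)
    \<comment> \<open>The cubes are \<open>s\<close> or \<open>- s\<close> and sum to zero, so both
      signs are equally frequent.\<close>
    have "sum (\<lambda>c. f c ^ 3) UNIV = of_nat (card S) * s - of_nat (card (- S)) * s"
    proof -
      have "sum (\<lambda>c. f c ^ 3) UNIV = sum (\<lambda>c. f c ^ 3) S + sum (\<lambda>c. f c ^ 3) (- S)"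
        using sum.union_disjoint[of S "- S" "\<lambda>c. f c ^ 3"] by simp
      then show ?thesis using S S' by simp
    qed
    then have "(of_nat (card S) :: complex) = of_nat (card (- S))"
      using type2_odd_power_sum[OF f(1), of 3] s0 by simp
    then have cS: "card S = 3" using card_Compl_6[of S] by (simp only: of_nat_eq_iff)
    obtain c1 c2 c3 c4 c5 c6 where c: "cols c1 c2 c3 c4 c5 c6" "S = {c1, c3, c5}"
      "f c2 = - f c1" "f c4 = - f c3" "f c6 = - f c5" "f c3 = f c1" "f c5 \<noteq> f c1"
    proof (rule type2_antipodal_classes[OF f cS s0])
      show "f c ^ 3 = s" if "c \<in> S" for c using S[OF that] .
      show "f c ^ 3 = - s" if "c \<notin> S" for c using S'[OF that] .
    qed (rule that)
    have gS: "g c ^ 3 = U * s" if "c \<in> S" for c using S[OF that] U by simp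
    have gS': "g c ^ 3 = - (U * s)" if "c \<notin> S" for c using S'[OF that] U by simp
    have Us: "U * s \<noteq> 0" using s0 nzU by simp
    obtain e1 e2 e3 e4 e5 e6 where e: "cols e1 e2 e3 e4 e5 e6" "S = {e1, e3, e5}"
      "g e2 = - g e1" "g e4 = - g e3" "g e6 = - g e5" "g e3 = g e1" "g e5 \<noteq> g e1"
    proof (rule type2_antipodal_classes[OF g cS Us])
      show "g c ^ 3 = U * s" if "c \<in> S" for c using gS[OF that] .
      show "g c ^ 3 = - (U * s)" if "c \<notin> S" for c using gS'[OF that] .
    qed (rule that)
    define \<gamma> \<delta> where "\<gamma> = g e1" and "\<delta> = g e5"
    have mS: "- S = {c2, c4, c6}" "- S = {e2, e4, e6}"
    proof -
      have "cols c1 c3 c5 c2 c4 c6" "cols e1 e3 e5 e2 e4 e6" using c(1) e(1) by (auto simp: cols_def)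
      then show "- S = {c2, c4, c6}" "- S = {e2, e4, e6}"
        unfolding c(2) using cols_UNIV_minus(1) e(2) c(2) by metis+
    qed
    have gv: "g x = (if x = e5 then \<delta> else \<gamma>)" if "x \<in> {c1, c3, c5}" for x
      using that e unfolding c(2)[symmetric] e(2) \<gamma>_def \<delta>_def by (auto simp: cols_def)
    have gv': "g x = (if x = e6 then - \<delta> else - \<gamma>)" if "x \<in> {c2, c4, c6}" for x
      using that e unfolding mS(1)[symmetric] mS(2) \<gamma>_def \<delta>_def by (auto simp: cols_def)
    have e5: "e5 = c1 \<or> e5 = c3 \<or> e5 = c5" using c(2) e(2) by blast
    have e6: "e6 = c2 \<or> e6 = c4 \<or> e6 = c6" using mS by blast
    have D: "distinct [c1, c2, c3, c4, c5, c6]" using c(1) by (simp add: cols_def)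
    note gs = gv[of c1] gv[of c3] gv[of c5] gv'[of c2] gv'[of c4] gv'[of c6]
    have cc: "cols c1 c4 c3 c2 c5 c6" using D by (auto simp: cols_def)
    have no3': False if "distinct [a, b, c]" "f b = f a" "f c = - f a" "g b = g a" "g c = - g a" for a b c
      by (rule no3[OF that(1)]) (simp_all add: that)
    \<comment> \<open>\<open>e5\<close> and \<open>e6\<close> carry the single value of
      \<open>g\<close> and its negative. If both or neither of them equal \<open>c5\<close> and
      \<open>c6\<close> respectively, then a common pairing is the given one of \<open>f\<close> or
      the one that exchanges \<open>c2\<close> with \<open>c4\<close>, which also suits
      \<open>f\<close> because \<open>f c3 = f c1\<close>.\<close>
    show ?thesis
    proof (cases "e5 = c5 \<longleftrightarrow> e6 = c6")
      case True
      show ?thesis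
      proof (cases "e5 = c5 \<or> e5 = c1 \<and> e6 = c2 \<or> e5 = c3 \<and> e6 = c4")
        case True': True
        show ?thesis
          by (rule share_matchingI[OF c(1)]) (use True True' D e5 e6 gs c in auto)
      next
        case False
        show ?thesis
          by (rule share_matchingI[OF cc]) (use True False D e5 e6 gs c in auto)
      qed
    next
      case False
      \<comment> \<open>When only one of \<open>e5, e6\<close> matches its counterpart in
        \<open>c5, c6\<close>, the quotient \<open>g / f\<close> takes one value on three columns,
        which type 3 forbids.\<close>
      then consider (aa) "e5 = c5" "e6 = c2" | (bb) "e5 = c5" "e6 = c4" | (cc) "e5 = c1" "e6 = c6" | (dd) "e5 = c3" "e6 = c6"
        using e5 e6 by blast
      then show ?thesis
      proof cases
        case aa
        have "g c3 = g c1" "g c4 = - g c1" using gs D aa by auto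
        moreover have "distinct [c1, c3, c4]" "f c3 = f c1" "f c4 = - f c1" using D c by auto
        ultimately show ?thesis using no3'[of c1 c3 c4] by blast
      next
        case bb
        have "g c3 = g c1" "g c2 = - g c1" using gs D bb by auto
        moreover have "distinct [c1, c3, c2]" "f c3 = f c1" "f c2 = - f c1" using D c by auto
        ultimately show ?thesis using no3'[of c1 c3 c2] by blast
      next
        case cc
        have "g c4 = g c2" "g c3 = - g c2" using gs D cc by auto
        moreover have "distinct [c2, c4, c3]" "f c4 = f c2" "f c3 = - f c2" using D c by auto
        ultimately show ?thesis using no3'[of c2 c4 c3] by blast
      next
        case dd
        have "g c4 = g c2" "g c1 = - g c2" using gs D dd by auto
        moreover have "distinct [c2, c4, c1]" "f c4 = f c2" "f c1 = - f c2" using D c by auto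
        ultimately show ?thesis using no3'[of c2 c4 c1] by blast
      qed
    qed
  next
    case False
    let ?F = "\<lambda>c. f c ^ 6"
    \<comment> \<open>The sixth powers of the three pairs are not all equal, so one pair differs
      from both others; it is moved to the last place.\<close>
    have "\<exists>c1 c2 c3 c4 c5 c6. cols c1 c2 c3 c4 c5 c6 \<and> f c2 = - f c1 \<and> f c4 = - f c3 \<and> f c6 = - f c5 \<and>
        ?F c5 \<noteq> ?F c1 \<and> ?F c5 \<noteq> ?F c3"
    proof -
      have F: "?F d2 = ?F d1" "?F d4 = ?F d3" "?F d6 = ?F d5" using d by simp_all
      have "?F d3 \<noteq> ?F d1 \<or> ?F d5 \<noteq> ?F d1" using False F unfolding cols_all[OF d(1)] by auto
      then consider "?F d5 \<noteq> ?F d1" "?F d5 \<noteq> ?F d3" | "?F d3 \<noteq> ?F d1" "?F d3 \<noteq> ?F d5" | "?F d1 \<noteq> ?F d3" "?F d1 \<noteq> ?F d5"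
        by metis
      then show ?thesis
      proof cases
        case 1
        then show ?thesis using d by blast
      next
        case 2
        have "cols d1 d2 d5 d6 d3 d4" using d(1) by (auto simp: cols_def)
        with 2 d show ?thesis by (intro exI[of _ d1] exI[of _ d2] exI[of _ d5] exI[of _ d6] exI[of _ d3] exI[of _ d4] conjI) simp_all
      next
        case 3
        have "cols d3 d4 d5 d6 d1 d2" using d(1) by (auto simp: cols_def)
        with 3 d show ?thesis by (intro exI[of _ d3] exI[of _ d4] exI[of _ d5] exI[of _ d6] exI[of _ d1] exI[of _ d2] conjI) simp_all
      qed
    qed
    then obtain c1 c2 c3 c4 c5 c6 where c: "cols c1 c2 c3 c4 c5 c6" "f c2 = - f c1" "f c4 = - f c3" "f c6 = - f c5"
        "?F c5 \<noteq> ?F c1" "?F c5 \<noteq> ?F c3" by (elim exE conjE) (rule that)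
    obtain \<pi> where \<pi>: "\<And>c. \<pi> c \<noteq> c" "\<And>c. \<pi> (\<pi> c) = c" "\<And>c. g (\<pi> c) = - g c"
      using type2_involution[OF g(1)] by blast
    have F\<pi>: "f (\<pi> c) ^ 3 = - (f c ^ 3)" for c
    proof -
      have "U * f (\<pi> c) ^ 3 = U * - (f c ^ 3)" using U[of "\<pi> c"] U[of c] \<pi>(3)[of c] by simp
      then show ?thesis using nzU mult_left_cancel by blast
    qed
    have F6: "?F (\<pi> c) = ?F c" for c
    proof -
      have "(f (\<pi> c) ^ 3)\<^sup>2 = (f c ^ 3)\<^sup>2" by (simp add: F\<pi>)
      then show ?thesis by (simp flip: power_mult)
    qed
    have D: "distinct [c1, c2, c3, c4, c5, c6]" using c(1) by (simp add: cols_def)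
    have "\<pi> c5 = c6"
      using cols_cases[OF c(1), of "\<pi> c5"] \<pi>(1)[of c5] F6[of c5] c by auto
    then have p6: "\<pi> c6 = c5" "g c6 = - g c5" using \<pi> by metis+
    have p1: "\<pi> c1 = c2 \<or> \<pi> c1 = c3 \<or> \<pi> c1 = c4"
      using cols_cases[OF c(1), of "\<pi> c1"] \<pi>(1)[of c1] \<pi>(2)[of c1] p6 \<open>\<pi> c5 = c6\<close> D by auto
    \<comment> \<open>Here the pairing of \<open>g\<close> crosses the first two pairs of
      \<open>f\<close>. If \<open>f c3 = f c1\<close>, then \<open>f\<close> can be paired in the
      same way. Otherwise \<open>c5\<close> and \<open>c6\<close> use up the value
      \<open>?k c5\<close>, only two values are left for \<open>?k\<close> on the other columns, and
      \<open>?k\<close> comes out constant on the original pairs.\<close>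
    have key: "share_matching f g" if c: "cols c1 c2 c3 c4 c5 c6" "f c2 = - f c1" "f c4 = - f c3" "f c6 = - f c5"
      and p: "\<pi> c1 = c4" "\<pi> c5 = c6" for c1 c2 c3 c4 c5 c6
    proof -
      have D: "distinct [c1, c2, c3, c4, c5, c6]" using c(1) by (simp add: cols_def)
      have p4: "\<pi> c4 = c1" "\<pi> c6 = c5" using \<pi>(2) p by metis+
      have "\<pi> c2 = c3"
        using cols_cases[OF c(1), of "\<pi> c2"] \<pi>(1)[of c2] \<pi>(2)[of c2] p p4 D by auto
      then have gg: "g c4 = - g c1" "g c3 = - g c2" "g c6 = - g c5" using \<pi>(3) p by metis+
      have "f c3 ^ 3 = f c1 ^ 3" using F\<pi>[of c1] p c by simp
      then have r: "f c3 = f c1 \<or> f c3 = omega * f c1 \<or> f c3 = omega\<^sup>2 * f c1" by (rule cube_root_cases)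
      show ?thesis
      proof (cases "f c3 = f c1")
        case True
        have "cols c1 c4 c3 c2 c5 c6" using D by (auto simp: cols_def)
        then show ?thesis
          by (rule share_matchingI) (use True c gg in auto)
      next
        case False
        have k3: "?k c = ?k c5 \<or> ?k c = omega * ?k c5 \<or> ?k c = omega\<^sup>2 * ?k c5" for c
          by (rule cube_root_cases) (use nz in \<open>simp add: power_divide U\<close>)
        have k56: "?k c6 = ?k c5" using gg c by simp
        have kne: "?k c \<noteq> ?k c5" if "c \<in> {c1, c2, c3, c4}" for c
        proof
          assume "?k c = ?k c5"
          moreover have "distinct [c, c5, c6]" using D that by auto
          ultimately show False using no3[of c c5 c6] k56 by metis
        qed
        have kc: "?k c = omega * ?k c5 \<or> ?k c = omega\<^sup>2 * ?k c5" if "c \<in> {c1, c2, c3, c4}" for c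
          using k3[of c] kne[OF that] by blast
        have k0: "?k c5 \<noteq> 0" using nz by simp
        obtain dd where dd: "f c3 = dd * f c1" "dd = omega \<or> dd = omega\<^sup>2" using r False by blast
        have dd0: "dd \<noteq> 0" using dd by auto
        have k14: "?k c1 = dd * ?k c4" using gg c dd nz dd0 by (simp add: field_simps)
        have k23: "?k c2 = dd * ?k c3" using gg c dd nz dd0 by (simp add: field_simps)
        have o3: "omega * omega\<^sup>2 = 1" "omega\<^sup>2 * omega = 1"
          by (simp_all add: omega_simps)
        have kd: "?k c = dd * ?k c5" if "c \<in> {c1, c2, c3, c4}" "dd * ?k c \<noteq> ?k c5" for c
          using kc[OF that(1)] dd(2) that(2) o3 by (metis mult.assoc mult_1)
        have "dd * ?k c4 \<noteq> ?k c5" "dd * ?k c3 \<noteq> ?k c5"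
          using kne[of c1] kne[of c2] unfolding k14 k23 by simp_all
        then have k43: "?k c4 = ?k c3"
          using kd[of c4] kd[of c3] by simp
        then have "?k c1 = ?k c2" unfolding k14 k23 by simp
        then have "- g c2 = g c1" "- g c4 = g c3"
          using k43 c(2,3) nz by (auto simp: field_simps)
        then have "g c2 = - g c1" "g c4 = - g c3"
          by (metis minus_minus)+
        then show ?thesis
          by (intro share_matchingI[OF c(1)]) (use c gg in auto)
      qed
    qed
    show ?thesis
    proof (cases "\<pi> c1 = c2")
      case True
      then have g2: "g c2 = - g c1" "\<pi> c2 = c1" using \<pi> by metis+
      have "\<pi> c3 = c4"
        using cols_cases[OF c(1), of "\<pi> c3"] \<pi>(1)[of c3] \<pi>(2)[of c3] p6 \<open>\<pi> c5 = c6\<close> True g2 D by auto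
      then have "g c4 = - g c3" using \<pi>(3) by metis
      then show ?thesis
        by (intro share_matchingI[OF c(1)]) (use c g2 p6 in auto)
    next
      case False
      with p1 have "\<pi> c1 = c3 \<or> \<pi> c1 = c4" by blast
      then show ?thesis
      proof
        assume "\<pi> c1 = c4"
        then show ?thesis using key[OF c(1-4)] \<open>\<pi> c5 = c6\<close> by blast
      next
        assume "\<pi> c1 = c3"
        moreover have "cols c1 c2 c4 c3 c5 c6" using D by (auto simp: cols_def)
        moreover have "f c3 = - f c4" using c by simp
        ultimately show ?thesis using key[of c1 c2 c4 c3 c5 c6] c(2,4) \<open>\<pi> c5 = c6\<close> by blast
      qed
    qed
  qed
qed

section \<open>The matrices F23 and F32\<close>

text \<open>As all entries have modulus 1, quotients can be used in place of products with conjugates.\<close>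

definition had :: "(6 \<Rightarrow> 6 \<Rightarrow> complex) \<Rightarrow> bool" where
  "had H \<longleftrightarrow> (\<forall>p c. norm (H p c) = 1) \<and> (\<forall>p q. p \<noteq> q \<longrightarrow> (\<Sum>c\<in>UNIV. H p c / H q c) = 0)"

definition rel :: "(6 \<Rightarrow> 6 \<Rightarrow> complex) \<Rightarrow> 6 \<Rightarrow> 6 \<Rightarrow> 6 \<Rightarrow> complex" where
  "rel H p q c = H p c / H q c"

text \<open>\<open>\<rho>\<close> and \<open>\<gamma>\<close> send the row and column numbers of \<open>K\<close> to rows and columns of \<open>H\<close>, inversely to the
  bijections in \<open>hadamard_equiv\<close>.\<close>

definition has_form :: "(6 \<Rightarrow> 6 \<Rightarrow> complex) \<Rightarrow> complex^6^6 \<Rightarrow> bool" where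
  "has_form H K \<longleftrightarrow> (\<exists>\<rho> \<gamma> a b. bij \<rho> \<and> bij \<gamma> \<and> (\<forall>p. norm (a p) = 1) \<and> (\<forall>c. norm (b c) = 1) \<and>
     (\<forall>i m. H (\<rho> i) (\<gamma> m) = a (\<rho> i) * b (\<gamma> m) * K $ i $ m))"

section \<open>Scaling, relabelling and normal forms\<close>

lemma had_norm: "had H \<Longrightarrow> norm (H p c) = 1"
  by (simp add: had_def)

lemma had_nonzero: "had H \<Longrightarrow> H p c \<noteq> 0"
  using had_norm[of H p c] by auto

lemma had_orth: "had H \<Longrightarrow> p \<noteq> q \<Longrightarrow> (\<Sum>c\<in>UNIV. H p c / H q c) = 0"
  by (simp add: had_def)

lemma unit_inverse: "norm (z :: complex) = 1 \<Longrightarrow> cnj z = 1 / z"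
  by (simp add: divide_conv_cnj)

text \<open>Orthogonality of rows says that the transposed matrix of inverse entries, divided by 6,
  is a right inverse. A right inverse of a square matrix is also a left inverse, which is
  orthogonality of columns.\<close>

lemma had_columns:
  assumes "had H" "c \<noteq> d"
  shows "(\<Sum>p\<in>UNIV. H p c / H p d) = 0"
proof -
  have cn: "cnj (H p e) = 1 / H p e" for p e by (rule unit_inverse) (rule had_norm[OF assms(1)])
  define A :: "complex^6^6" where "A = (\<chi> p c. H p c)"
  define B :: "complex^6^6" where "B = (\<chi> c p. 1 / (6 * H p c))"
  have nz: "H p e \<noteq> 0" for p e by (rule had_nonzero[OF assms(1)])
  have "(\<Sum>e\<in>UNIV. H p e * (1 / (6 * H q e))) = (if p = q then 1 else 0)" for p q
  proof -
    have "(\<Sum>e\<in>UNIV. H p e * (1 / (6 * H q e))) = (\<Sum>e\<in>UNIV. H p e / H q e) / 6"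
      by (simp add: sum_divide_distrib mult.commute)
    then show ?thesis
      using had_orth[OF assms(1), of p q] nz by auto
  qed
  then have "A ** B = mat 1"
    by (simp add: A_def B_def matrix_matrix_mult_def mat_def vec_eq_iff)
  then have "B ** A = mat 1"
    by (simp add: matrix_left_right_inverse)
  then have "(B ** A) $ d $ c = 0" using assms(2) by (simp add: mat_def)
  then have "(\<Sum>p\<in>UNIV. (1 / (6 * H p d)) * H p c) = 0"
    by (simp add: A_def B_def matrix_matrix_mult_def)
  moreover have "(\<Sum>p\<in>UNIV. (1 / (6 * H p d)) * H p c) = (\<Sum>p\<in>UNIV. H p c / H p d) / 6"
    by (simp add: sum_divide_distrib mult.commute)
  ultimately show ?thesis by simp
qed

lemma had_scale:
  assumes "had H" "\<And>p. norm (a p) = 1" "\<And>c. norm (b c) = 1"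
  shows "had (\<lambda>p c. a p * b c * H p c)"
proof -
  have nz: "b c \<noteq> 0" for c using assms(3)[of c] by auto
  have "(\<Sum>c\<in>UNIV. (a p * b c * H p c) / (a q * b c * H q c)) = (a p / a q) * (\<Sum>c\<in>UNIV. H p c / H q c)" for p q
    unfolding sum_distrib_left by (rule sum.cong) (use nz in auto)
  then show ?thesis
    using assms unfolding had_def by (simp add: norm_mult)
qed

lemma has_form_scale:
  assumes "has_form (\<lambda>p c. a p * b c * H p c) K" "\<And>p. norm (a p) = 1" "\<And>c. norm (b c) = 1"
  shows "has_form H K"
proof -
  obtain \<rho> \<gamma> a' b' where f: "bij \<rho>" "bij \<gamma>" "\<And>p. norm (a' p) = 1" "\<And>c. norm (b' c) = 1"
     "\<And>i m. a (\<rho> i) * b (\<gamma> m) * H (\<rho> i) (\<gamma> m) = a' (\<rho> i) * b' (\<gamma> m) * K $ i $ m"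
    using assms(1) unfolding has_form_def by blast
  have nz: "a p \<noteq> 0" "b c \<noteq> 0" for p c using assms(2)[of p] assms(3)[of c] by auto
  have "H (\<rho> i) (\<gamma> m) = (a' (\<rho> i) / a (\<rho> i)) * (b' (\<gamma> m) / b (\<gamma> m)) * K $ i $ m" for i m
    using f(5)[of i m] nz by (simp add: field_simps)
  moreover have "norm (a' p / a p) = 1" "norm (b' c / b c) = 1" for p c
    using assms(2,3) f(3,4) by (simp_all add: norm_divide)
  ultimately show ?thesis
    unfolding has_form_def using f(1,2)
    by (intro exI[of _ \<rho>] exI[of _ \<gamma>] exI[of _ "\<lambda>p. a' p / a p"] exI[of _ "\<lambda>c. b' c / b c"]) blast
qed

lemma has_form_equiv:
  assumes "has_form (\<lambda>p c. h $ p $ c) K"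
  shows "hadamard_equiv h K"
proof -
  obtain \<rho> \<gamma> a b where f: "bij \<rho>" "bij \<gamma>" "\<And>p. norm (a p) = 1" "\<And>c. norm (b c) = 1"
     "\<And>i m. h $ \<rho> i $ \<gamma> m = a (\<rho> i) * b (\<gamma> m) * K $ i $ m"
    using assms(1) unfolding has_form_def by blast
  have inv: "\<rho> (inv \<rho> x) = x" "\<gamma> (inv \<gamma> x) = x" for x
    using f(1,2) by (simp_all add: bij_def surj_f_inv_f)
  have "h $ i $ m = a i * b m * K $ inv \<rho> i $ inv \<gamma> m" for i m
    using f(5)[of "inv \<rho> i" "inv \<gamma> m"] inv by simp
  then show ?thesis
    unfolding hadamard_equiv_def using f(3,4) bij_imp_bij_inv[OF f(1)] bij_imp_bij_inv[OF f(2)]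
    by (intro exI[of _ "inv \<rho>"] exI[of _ "inv \<gamma>"] exI[of _ a] exI[of _ b]) blast
qed

lemma cols_bij:
  assumes "cols r1 r2 r3 r4 r5 r6"
  obtains \<rho> :: "6 \<Rightarrow> 6" where "bij \<rho>" "\<rho> 1 = r1" "\<rho> 2 = r2" "\<rho> 3 = r3" "\<rho> 4 = r4" "\<rho> 5 = r5" "\<rho> 6 = r6"
proof -
  define \<rho> :: "6 \<Rightarrow> 6" where "\<rho> i = (if i = 1 then r1 else if i = 2 then r2 else if i = 3 then r3
     else if i = 4 then r4 else if i = 5 then r5 else r6)" for i
  have v: "\<rho> 1 = r1" "\<rho> 2 = r2" "\<rho> 3 = r3" "\<rho> 4 = r4" "\<rho> 5 = r5" "\<rho> 6 = r6"
    by (simp_all add: \<rho>_def)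
  have "\<exists>i. y = \<rho> i" for y using cols_cases[OF assms, of y] v by metis
  then have "surj \<rho>" by (simp add: surj_def)
  then have "bij \<rho>" using finite_UNIV_surj_inj[OF finite_class.finite_UNIV] by (simp add: bij_def)
  then show thesis using that v by blast
qed

text \<open>Row scalars are read off from the column \<open>c1\<close> and column scalars are 1: it
  is meant for matrices whose columns have already been rescaled by making one row constant. What
  remains is 36 equations.\<close>

lemma has_formI:
  assumes "cols r1 r2 r3 r4 r5 r6" "cols c1 c2 c3 c4 c5 c6" "had H"
    and "\<forall>(i, p) \<in> {(1::6, r1), (2, r2), (3, r3), (4, r4), (5, r5), (6, r6)}.
      \<forall>(m, c) \<in> {(1::6, c1), (2, c2), (3, c3), (4, c4), (5, c5), (6, c6)}. H p c = H p c1 * K $ i $ m"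
  shows "has_form H K"
proof -
  obtain \<rho> :: "6 \<Rightarrow> 6" where \<rho>: "bij \<rho>" "\<rho> 1 = r1" "\<rho> 2 = r2" "\<rho> 3 = r3" "\<rho> 4 = r4" "\<rho> 5 = r5" "\<rho> 6 = r6"
    by (rule cols_bij[OF assms(1)]) (rule that; assumption)
  obtain \<gamma> :: "6 \<Rightarrow> 6" where \<gamma>: "bij \<gamma>" "\<gamma> 1 = c1" "\<gamma> 2 = c2" "\<gamma> 3 = c3" "\<gamma> 4 = c4" "\<gamma> 5 = c5" "\<gamma> 6 = c6"
    by (rule cols_bij[OF assms(2)]) (rule that; assumption)
  have "\<forall>i m. H (\<rho> i) (\<gamma> m) = H (\<rho> i) c1 * 1 * K $ i $ m"
    unfolding all_6 \<rho> \<gamma> mult_1_right using assms(4) by simp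
  then show ?thesis
    unfolding has_form_def using \<rho>(1) \<gamma>(1) had_norm[OF assms(3)]
    by (intro exI[of _ \<rho>] exI[of _ \<gamma>] exI[of _ "\<lambda>p. H p c1"] exI[of _ "\<lambda>c. 1"]) simp
qed

lemma cols_extend:
  assumes "distinct xs" "length xs \<le> 6"
  obtains ys :: "6 list" where "distinct (xs @ ys)" "length (xs @ ys) = 6"
proof -
  obtain ys where ys: "set ys = - set xs" "distinct ys"
    using finite_distinct_list[of "- set xs"] by auto
  have "distinct (xs @ ys)" using ys assms(1) by auto
  moreover have "set (xs @ ys) = UNIV" using ys by auto
  then have "length (xs @ ys) = 6" using distinct_card[OF calculation] by simp
  ultimately show thesis by (rule that)
qed

lemma cols_extend_2:
  assumes "r1 \<noteq> r2"
  obtains r3 r4 r5 r6 where "cols r1 r2 r3 r4 r5 r6"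
proof -
  obtain ys where ys: "distinct ([r1, r2] @ ys)" "length ([r1, r2] @ ys) = 6"
    using cols_extend[of "[r1, r2]"] assms by auto
  then obtain r3 r4 r5 r6 where "ys = [r3, r4, r5, r6]"
    by (auto simp: length_Suc_conv numeral_eq_Suc)
  then show thesis using that[of r3 r4 r5 r6] ys by (simp add: cols_def)
qed

lemma cols_extend_3:
  assumes "distinct [r1, r2, r3]"
  obtains r4 r5 r6 where "cols r1 r2 r3 r4 r5 r6"
proof -
  obtain ys where ys: "distinct ([r1, r2, r3] @ ys)" "length ([r1, r2, r3] @ ys) = 6"
    using cols_extend[of "[r1, r2, r3]"] assms by auto
  then obtain r4 r5 r6 where "ys = [r4, r5, r6]"
    by (auto simp: length_Suc_conv numeral_eq_Suc)
  then show thesis using that[of r4 r5 r6] ys by (simp add: cols_def)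
qed

text \<open>Dividing all columns by the entries of one row cancels in every quotient of rows, so
  whatever is stated about \<open>rel\<close> is kept literally.\<close>

lemma normalize_row:
  fixes r :: 6
  assumes "had H"
  defines "N \<equiv> (\<lambda>p c. H p c / H r c)"
  shows "had N" "N r c = 1" "rel N p q = rel H p q" "has_form N K \<Longrightarrow> has_form H K"
proof -
  have nz: "H p c \<noteq> 0" for p c by (rule had_nonzero[OF assms(1)])
  have N: "N = (\<lambda>p c. 1 * (1 / H r c) * H p c)" by (simp add: N_def fun_eq_iff)
  have n: "norm (1 / H r c) = 1" for c using had_norm[OF assms(1)] by (simp add: norm_divide)
  show "had N" unfolding N by (rule had_scale[OF assms(1)]) (simp_all only: n norm_one)
  show "N r c = 1" using nz by (simp add: N_def)
  show "rel N p q = rel H p q" using nz by (simp add: N_def rel_def fun_eq_iff)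
  show "has_form N K \<Longrightarrow> has_form H K"
    unfolding N by (erule has_form_scale) (simp_all only: n norm_one)
qed

section \<open>The family F23\<close>

lemma omega_ratio:
  "(omega\<^sup>2 * x) / (omega * y) = omega * (x / y)"
  "(omega * x) / (omega\<^sup>2 * y) = omega\<^sup>2 * (x / y)"
proof -
  show "(omega\<^sup>2 * x) / (omega * y) = omega * (x / y)"
    by (simp add: power2_eq_square)
  have "omega = omega\<^sup>2 * omega\<^sup>2" by (simp add: omega_simps)
  then have "(omega * x) / (omega\<^sup>2 * y) = (omega\<^sup>2 * (omega\<^sup>2 * x)) / (omega\<^sup>2 * y)"
    by (metis mult.assoc)
  also have "\<dots> = omega\<^sup>2 * (x / y)"
    by (subst mult_divide_mult_cancel_left) simp_all
  finally show "(omega * x) / (omega\<^sup>2 * y) = omega\<^sup>2 * (x / y)" .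
qed

text \<open>Orthogonality to \<open>r1\<close> and \<open>r2\<close> makes the sums over the two
  column triples vanish separately, so every other row is a 3-cycle on each triple, in one of two
  orientations. Orthogonality to \<open>r3\<close> couples the orientations on the two triples, and
  at most two rows can have the same ones, so the four rows split into two and two.\<close>

lemma halved_normalized_F23:
  assumes "had N" "\<And>c. N r1 c = 1" "r1 \<noteq> r2" "cols c1 c2 c3 c4 c5 c6"
    and z: "N r2 c2 = N r2 c1" "N r2 c3 = N r2 c1" "N r2 c4 = - N r2 c1" "N r2 c5 = - N r2 c1" "N r2 c6 = - N r2 c1"
  shows "\<exists>r s. norm r = 1 \<and> norm s = 1 \<and> has_form N (F23_matrix r s)"
proof -
  have nz: "N p c \<noteq> 0" for p c by (rule had_nonzero[OF assms(1)])
  have nm: "norm (N p c) = 1" for p c by (rule had_norm[OF assms(1)])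
  obtain r3 r4 r5 r6 where r: "cols r1 r2 r3 r4 r5 r6" by (rule cols_extend_2[OF assms(3)])
  define L where "L p u v \<longleftrightarrow> N p u = omega * N p c1 \<and> N p v = omega\<^sup>2 * N p c1" for p u v
  define R where "R p u v \<longleftrightarrow> N p u = omega * N p c4 \<and> N p v = omega\<^sup>2 * N p c4" for p u v
  have LR: "(L p c2 c3 \<or> L p c3 c2) \<and> (R p c5 c6 \<or> R p c6 c5)" if "p \<noteq> r1" "p \<noteq> r2" for p
  proof -
    have "N p c1 + N p c2 + N p c3 + N p c4 + N p c5 + N p c6 = 0"
      using had_orth[OF assms(1) that(1)] assms(2) by (simp add: cols_sum[OF assms(4)])
    moreover have "(N p c1 + N p c2 + N p c3 - (N p c4 + N p c5 + N p c6)) / N r2 c1 = 0"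
      using had_orth[OF assms(1) that(2)]
      by (simp add: cols_sum[OF assms(4)] z add_divide_distrib diff_divide_distrib algebra_simps)
    then have "N p c1 + N p c2 + N p c3 - (N p c4 + N p c5 + N p c6) = 0" using nz by simp
    moreover have "S = 0 \<and> T = 0" if "S + T = 0" "S - T = 0" for S T :: complex
      using that by simp
    ultimately have "N p c1 + N p c2 + N p c3 = 0" "N p c4 + N p c5 + N p c6 = 0"
      by (metis add.assoc)+
    then show ?thesis
      using three_units_sum_zero[OF nm nm nm] unfolding L_def R_def by blast
  qed
  have key: ?thesis if c: "cols c1 c2 c3 c4 c5 c6"
    and z: "N r2 c2 = N r2 c1" "N r2 c3 = N r2 c1" "N r2 c4 = - N r2 c1" "N r2 c5 = - N r2 c1" "N r2 c6 = - N r2 c1"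
    and LR: "\<And>p. p \<noteq> r1 \<Longrightarrow> p \<noteq> r2 \<Longrightarrow> (L p c2 c3 \<or> L p c3 c2) \<and> (R p c5 c6 \<or> R p c6 c5)"
    and r3: "L r3 c2 c3" "R r3 c5 c6" for c2 c3 c5 c6
  proof -
    \<comment> \<open>\<open>\<tau>\<close> compares the two triples of a row. The parameters
      \<open>r\<close> and \<open>s\<close> will be its values at \<open>r3\<close> and at a row of
      the opposite orientation.\<close>
    define \<tau> where "\<tau> p = N p c4 / N p c1" for p
    have \<tau>n: "norm (\<tau> p) = 1" for p using nm by (simp add: \<tau>_def norm_divide)
    have w0: "1 + omega + omega\<^sup>2 = 0" by (simp add: omega_simps)
    \<comment> \<open>Equal orientations make the quotient of two rows constant on each triple, and
      the two constants must cancel.\<close>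
    have same: "\<tau> p = - \<tau> q" if "p \<noteq> q" "L p u v" "R p u' v'" "L q u v" "R q u' v'"
      "{u, v} = {c2, c3}" "{u', v'} = {c5, c6}" for p q u v u' v'
    proof -
      have "cols c1 u v c4 u' v'" using that(6,7) c unfolding cols_def by (auto simp: doubleton_eq_iff)
      from cols_sum[OF this, of "\<lambda>c. N p c / N q c"]
      have "3 * (N p c4 / N q c4) + 3 * (N p c1 / N q c1) = 0"
        using had_orth[OF assms(1) that(1)] that(2-5) unfolding L_def R_def by simp
      then have "N p c1 / N q c1 = - (N p c4 / N q c4)" by (rule triple_sum_zero)
      then show ?thesis using nz unfolding \<tau>_def by (simp add: field_simps)
    qed
    \<comment> \<open>The quotient of a mixed row by \<open>r3\<close> would be constant on one
      triple and sum to zero over the other, so the rows could not be orthogonal.\<close>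
    have pm: "L p c2 c3 \<and> R p c5 c6 \<or> L p c3 c2 \<and> R p c6 c5" if "p \<noteq> r1" "p \<noteq> r2" "p \<noteq> r3" for p
    proof (rule ccontr)
      assume "\<not> ?thesis"
      with LR[OF that(1,2)] consider "L p c2 c3" "R p c6 c5" | "L p c3 c2" "R p c5 c6" by blast
      then show False
      proof cases
        case 1
        have "N p c4 / N r3 c4 + N p c5 / N r3 c5 + N p c6 / N r3 c6 = (1 + omega + omega\<^sup>2) * (N p c4 / N r3 c4)"
          using 1(2) r3(2) unfolding R_def by (elim conjE) (simp only: omega_ratio, simp add: algebra_simps add_divide_distrib)
        moreover have "N p c1 / N r3 c1 + N p c2 / N r3 c2 + N p c3 / N r3 c3 = 3 * (N p c1 / N r3 c1)"
          using 1 r3 nz unfolding L_def by simp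
        ultimately have "3 * (N p c1 / N r3 c1) = 0"
          using had_orth[OF assms(1) that(3)] w0 by (simp add: cols_sum[OF c] add.assoc)
        then show False using nz by simp
      next
        case 2
        have "N p c1 / N r3 c1 + N p c2 / N r3 c2 + N p c3 / N r3 c3 = (1 + omega + omega\<^sup>2) * (N p c1 / N r3 c1)"
          using 2(1) r3(1) unfolding L_def by (elim conjE) (simp only: omega_ratio, simp add: algebra_simps add_divide_distrib)
        moreover have "N p c4 / N r3 c4 + N p c5 / N r3 c5 + N p c6 / N r3 c6 = 3 * (N p c4 / N r3 c4)"
          using 2 r3 nz unfolding R_def by simp
        ultimately have "3 * (N p c4 / N r3 c4) = 0"
          using had_orth[OF assms(1) that(3)] w0 by (simp add: cols_sum[OF c] add.assoc)
        then show False using nz by simp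
      qed
    qed
    have fin: ?thesis if rr: "cols r1 r3 v r2 u w" "L u c2 c3" "R u c5 c6"
      "L v c3 c2" "R v c6 c5" "L w c3 c2" "R w c6 c5" for u v w
    proof (intro exI conjI)
      show "norm (\<tau> r3) = 1" "norm (\<tau> v) = 1" by (rule \<tau>n)+
      have t: "\<tau> u = - \<tau> r3" by (rule same[of u r3 c2 c3 c5 c6]) (use rr r3 in \<open>auto simp: cols_def\<close>)
      have t': "\<tau> w = - \<tau> v" by (rule same[of w v c3 c2 c6 c5]) (use rr in \<open>auto simp: cols_def\<close>)
      have e: "N p c4 = N p c1 * \<tau> p" for p using nz by (simp add: \<tau>_def)
      have e': "\<tau> r1 = 1" "\<tau> r2 = - 1" using nz by (simp_all add: \<tau>_def assms(2) z)
      show "has_form N (F23_matrix (\<tau> r3) (\<tau> v))"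
        by (rule has_formI[OF rr(1) c assms(1)])
          (use rr(2-) r3 in \<open>simp add: F23_matrix_def Let_def assms(2) z L_def R_def e e' t t'\<close>)
    qed
    have d: "r4 \<notin> {r1, r2, r3}" "r5 \<notin> {r1, r2, r3}" "r6 \<notin> {r1, r2, r3}" "distinct [r4, r5, r6]"
      using r by (auto simp: cols_def)
    define A B where "A p \<longleftrightarrow> L p c2 c3 \<and> R p c5 c6" and "B p \<longleftrightarrow> L p c3 c2 \<and> R p c6 c5" for p
    \<comment> \<open>The ratios \<open>\<tau>\<close> of equally oriented rows are pairwise
      opposite, which three nonzero numbers cannot be.\<close>
    have no2: False if "p \<noteq> q" "p \<noteq> r3" "q \<noteq> r3" "A p" "A q" for p q
    proof -
      have 1: "\<tau> p = - \<tau> q" by (rule same[of p q c2 c3 c5 c6]) (use that r3 in \<open>simp_all add: A_def\<close>)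
      have 2: "\<tau> p = - \<tau> r3" by (rule same[of p r3 c2 c3 c5 c6]) (use that r3 in \<open>simp_all add: A_def\<close>)
      have 3: "\<tau> q = - \<tau> r3" by (rule same[of q r3 c2 c3 c5 c6]) (use that r3 in \<open>simp_all add: A_def\<close>)
      have "\<tau> r3 = 0" using 1 unfolding 2 3 by simp
      then show False using \<tau>n[of r3] by simp
    qed
    have no3: False if "distinct [p, q, w]" "B p" "B q" "B w" for p q w
    proof -
      have 1: "\<tau> p = - \<tau> q" by (rule same[of p q c3 c2 c6 c5]) (use that in \<open>auto simp: B_def\<close>)
      have 2: "\<tau> p = - \<tau> w" by (rule same[of p w c3 c2 c6 c5]) (use that in \<open>auto simp: B_def\<close>)
      have 3: "\<tau> q = - \<tau> w" by (rule same[of q w c3 c2 c6 c5]) (use that in \<open>auto simp: B_def\<close>)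
      have "\<tau> w = 0" using 1 unfolding 2 3 by simp
      then show False using \<tau>n[of w] by simp
    qed
    have o: "cols r1 r3 r5 r2 r4 r6" "cols r1 r3 r4 r2 r5 r6" "cols r1 r3 r4 r2 r6 r5"
      using r by (auto simp: cols_def)
    have AB: "A p \<or> B p" if "p \<in> {r4, r5, r6}" for p
      using pm[of p] that d unfolding A_def B_def by auto
    consider "A r4" "B r5" "B r6" | "A r5" "B r4" "B r6" | "A r6" "B r4" "B r5"
      using AB[of r4] AB[of r5] AB[of r6] no2[of r4 r5] no2[of r4 r6] no2[of r5 r6] no3[of r4 r5 r6] d
      by auto
    then show ?thesis
      using fin[OF o(1)] fin[OF o(2)] fin[OF o(3)] unfolding A_def B_def by cases blast+
  qed
  have r3: "r3 \<noteq> r1" "r3 \<noteq> r2" using r by (auto simp: cols_def)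
  have cc: "cols c1 c3 c2 c4 c5 c6" "cols c1 c2 c3 c4 c6 c5" "cols c1 c3 c2 c4 c6 c5"
    using assms(4) by (auto simp: cols_def)
  \<comment> \<open>Exchanging labels inside the triples brings \<open>r3\<close> into the
    orientation assumed in \<open>key\<close>.\<close>
  from LR[OF r3] consider "L r3 c2 c3" "R r3 c5 c6" | "L r3 c3 c2" "R r3 c5 c6" | "L r3 c2 c3" "R r3 c6 c5"
    | "L r3 c3 c2" "R r3 c6 c5" by blast
  then show ?thesis
  proof cases
    case 1
    show ?thesis by (rule key[OF assms(4) z LR 1])
  next
    case 2
    show ?thesis by (rule key[OF cc(1) z(2,1,3-5) _ 2]) (use LR in blast)
  next
    case 3
    show ?thesis by (rule key[OF cc(2) z(1-3,5,4) _ 3]) (use LR in blast)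
  next
    case 4
    show ?thesis by (rule key[OF cc(3) z(2,1,3,5,4) _ 4]) (use LR in blast)
  qed
qed

lemma halved_F23:
  assumes "had H" "r1 \<noteq> r2" "halved (rel H r2 r1)"
  shows "\<exists>r s. norm r = 1 \<and> norm s = 1 \<and> has_form H (F23_matrix r s)"
proof -
  define N where "N p c = H p c / H r1 c" for p c
  note n = normalize_row[OF assms(1), of r1, folded N_def]
  obtain c1 c2 c3 c4 c5 c6 where c: "cols c1 c2 c3 c4 c5 c6"
    "rel H r2 r1 c2 = rel H r2 r1 c1" "rel H r2 r1 c3 = rel H r2 r1 c1" "rel H r2 r1 c4 = - rel H r2 r1 c1"
    "rel H r2 r1 c5 = - rel H r2 r1 c1" "rel H r2 r1 c6 = - rel H r2 r1 c1"
    using assms(3) unfolding halved_def by (elim exE conjE) (rule that)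
  have "rel H r2 r1 c = N r2 c" for c by (simp add: N_def rel_def)
  with c(2-) halved_normalized_F23[OF n(1,2) assms(2) c(1)] n(4) show ?thesis by metis
qed

section \<open>The family F32\<close>

lemma chord_eq_cases:
  fixes x y :: complex
  assumes "norm x = 1" "norm y = 1" "norm (1 - x) = norm (1 - y)"
  shows "y = x \<or> y = 1 / x"
proof -
  have nz: "x \<noteq> 0" "y \<noteq> 0" using assms by auto
  \<comment> \<open>The squared distance from 1 is \<open>2 - z - 1 / z\<close>, which determines
    \<open>z\<close> up to inversion.\<close>
  have sq: "complex_of_real ((norm (1 - z))\<^sup>2) = 2 - z - 1 / z" if "norm z = 1" "z \<noteq> 0" for z
    unfolding complex_norm_square using that by (simp add: unit_inverse field_simps)
  have "2 - x - 1 / x = 2 - y - 1 / y"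
    using sq[OF assms(1) nz(1)] sq[OF assms(2) nz(2)] assms(3) by metis
  then have "x + 1 / x = y + 1 / y" by (simp add: algebra_simps)
  then have "(y - x) * (x * y - 1) = 0"
    using nz by (simp add: field_simps)
  then have "y = x \<or> x * y = 1" by simp
  then show ?thesis using nz by (auto simp: field_simps)
qed

text \<open>Two of the three discrete Fourier components of \<open>(x, y, z)\<close> vanish, so the
  vector is a multiple of the remaining character.\<close>

lemma omega_system:
  fixes x y z :: complex
  assumes "x + y + z = 0" "x + omega\<^sup>2 * y + omega * z = 0"
  shows "y = omega\<^sup>2 * x" "z = omega * x"
proof -
  have z: "z = - x - y" using assms(1) by (simp add: algebra_simps add_eq_0_iff)
  have "(1 - omega) * (x - omega * y) = x + omega\<^sup>2 * y + omega * z"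
    unfolding z by (simp add: omega_simps)
  then have "x = omega * y" using assms(2) by simp
  then show "y = omega\<^sup>2 * x" "z = omega * x"
    unfolding z by (simp_all add: omega_simps)
qed

lemma omega_system':
  fixes x y z :: complex
  assumes "x + y + z = 0" "x + omega * y + omega\<^sup>2 * z = 0"
  shows "y = omega * x" "z = omega\<^sup>2 * x"
  using omega_system[of x z y] assms by (simp_all add: add_ac)

text \<open>For \<open>u = t\<close> both proportionality factors are \<open>e\<close>; for
  \<open>u = 1 / t\<close> they are \<open>e * t\<close> and \<open>- (e * t)\<close>. In the
  application \<open>b\<close> and \<open>d\<close> stand for two rows, the indices for two column
  pairs, and \<open>t\<close>, \<open>u\<close> for the quotients within these pairs.\<close>

lemma block_quotient_sign:
  fixes b1 b3 d1 d3 t u e :: complex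
  assumes "b3 * (1 + u) = e * (b1 * (1 + t))" "d3 * (1 - u) = e * (d1 * (1 - t))"
    and "u = t \<or> u = 1 / t" "t \<noteq> 0" "t \<noteq> 1" "t \<noteq> - 1" "d1 \<noteq> 0" "d3 \<noteq> 0" "e \<noteq> 0"
  shows "b3 / d3 = b1 / d1 \<or> b3 / d3 = - (b1 / d1)"
proof -
  have t1: "1 + t \<noteq> 0" "1 - t \<noteq> 0" using assms(5,6) by (auto simp: add_eq_0_iff)
  from assms(3) show ?thesis
  proof
    assume "u = t"
    then have "b3 = e * b1" "d3 = e * d1"
      using assms(1,2) t1 by (simp_all add: mult.assoc[symmetric])
    then show ?thesis using assms(9) by simp
  next
    assume u: "u = 1 / t"
    have "b3 * (1 + t) = (e * t * b1) * (1 + t)"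
      using assms(1,4) unfolding u by (simp add: field_simps)
    then have b: "b3 = e * t * b1" using t1 by simp
    have "d3 * (1 - t) = - (e * t * d1) * (1 - t)"
      using assms(2,4) unfolding u by (simp add: field_simps)
    then have d: "d3 = - (e * t * d1)" using t1(2) mult_right_cancel by blast
    show ?thesis using b d assms(4,9) by simp
  qed
qed

lemma halved_of_blocks:
  assumes "cols c1 c2 c3 c4 c5 c6" "f c2 = - f c1" "f c4 = - f c3" "f c6 = - f c5"
    and "f c3 = f c1 \<or> f c3 = - f c1" "f c5 = f c1 \<or> f c5 = - f c1"
  shows "halved f"
proof -
  have c: "cols c1 c3 c5 c2 c4 c6" "cols c1 c4 c5 c2 c3 c6" "cols c1 c3 c6 c2 c4 c5" "cols c1 c4 c6 c2 c3 c5"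
    using assms(1) by (auto simp: cols_def)
  from assms(5,6) show ?thesis
    by (elim disjE)
       (rule halvedI[OF c(1)] halvedI[OF c(3)] halvedI[OF c(2)] halvedI[OF c(4)]; use assms(2-4) in simp; fail)+
qed

text \<open>The differences over the three column pairs of any further row are determined up to a common
  factor, so the quotients within the three pairs are at equal distance from 1. By orthogonality
  of columns these quotients are \<open>1, t, -t\<close> for the three further rows.\<close>

lemma share_matching_normalized:
  assumes "had N" "\<And>c. N r1 c = 1" "distinct [r1, r2, r3]" "cols c1 c2 c3 c4 c5 c6"
    and u: "N r2 c2 = - N r2 c1" "N r2 c4 = - N r2 c3" "N r2 c6 = - N r2 c5"
    and v: "N r3 c2 = - N r3 c1" "N r3 c4 = - N r3 c3" "N r3 c6 = - N r3 c5"
    and vu: "N r3 c3 / N r2 c3 = omega * (N r3 c1 / N r2 c1)" "N r3 c5 / N r2 c5 = omega\<^sup>2 * (N r3 c1 / N r2 c1)"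
  shows "(\<exists>r s. norm r = 1 \<and> norm s = 1 \<and> has_form N (F32_matrix r s)) \<or> (\<exists>p q. p \<noteq> q \<and> halved (rel N p q))"
proof -
  have nz [simp]: "N p c \<noteq> 0" for p c by (rule had_nonzero[OF assms(1)])
  have nm: "norm (N p c) = 1" for p c by (rule had_norm[OF assms(1)])
  obtain r4 r5 r6 where r: "cols r1 r2 r3 r4 r5 r6" by (rule cols_extend_3[OF assms(3)])
  define S1 S3 S5 where "S1 p = N p c1 + N p c2" and "S3 p = N p c3 + N p c4" and "S5 p = N p c5 + N p c6" for p
  define \<kappa> where "\<kappa> = N r3 c1 / N r2 c1"
  have k0: "\<kappa> \<noteq> 0" by (simp add: \<kappa>_def)
  have v': "N r3 c1 = \<kappa> * N r2 c1" "N r3 c3 = omega * \<kappa> * N r2 c3" "N r3 c5 = omega\<^sup>2 * \<kappa> * N r2 c5"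
    using vu by (simp_all add: \<kappa>_def field_simps)
  have w: "1 / omega = omega\<^sup>2" "1 / omega\<^sup>2 = omega"
    by (simp_all add: field_simps) (simp_all add: omega_simps)
  have S: "S1 p + S3 p + S5 p = 0" if "p \<noteq> r1" for p
    using had_orth[OF assms(1) that] by (simp add: cols_sum[OF assms(4)] assms(2) S1_def S3_def S5_def add_ac)
  \<comment> \<open>On the three pairs \<open>r3\<close> is \<open>r2\<close> times
    \<open>1, omega, omega\<^sup>2\<close>, up to \<open>\<kappa>\<close>. So orthogonality to
    \<open>r2\<close> and to \<open>r3\<close> gives two Fourier relations between the differences
    over the pairs, weighted by \<open>r2\<close>.\<close>
  have D: "N p c3 - N p c4 = omega\<^sup>2 * (N r2 c3 / N r2 c1) * (N p c1 - N p c2)"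
      "N p c5 - N p c6 = omega * (N r2 c5 / N r2 c1) * (N p c1 - N p c2)" if "p \<noteq> r2" "p \<noteq> r3" for p
  proof -
    define E1 E3 E5 where "E1 = (N p c1 - N p c2) / N r2 c1" and "E3 = (N p c3 - N p c4) / N r2 c3"
      and "E5 = (N p c5 - N p c6) / N r2 c5"
    have "E1 + E3 + E5 = 0"
      using had_orth[OF assms(1) that(1)]
      by (simp add: cols_sum[OF assms(4)] u E1_def E3_def E5_def diff_divide_distrib algebra_simps)
    moreover have "(E1 + omega\<^sup>2 * E3 + omega * E5) / \<kappa> = 0"
    proof -
      have "N p c1 / (\<kappa> * N r2 c1) - N p c2 / (\<kappa> * N r2 c1) + N p c3 / (omega * \<kappa> * N r2 c3) - N p c4 / (omega * \<kappa> * N r2 c3)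
          + N p c5 / (omega\<^sup>2 * \<kappa> * N r2 c5) - N p c6 / (omega\<^sup>2 * \<kappa> * N r2 c5) = 0"
        using had_orth[OF assms(1) that(2)] by (simp add: cols_sum[OF assms(4)] v v')
      also have "N p c1 / (\<kappa> * N r2 c1) - N p c2 / (\<kappa> * N r2 c1) + N p c3 / (omega * \<kappa> * N r2 c3) - N p c4 / (omega * \<kappa> * N r2 c3)
          + N p c5 / (omega\<^sup>2 * \<kappa> * N r2 c5) - N p c6 / (omega\<^sup>2 * \<kappa> * N r2 c5)
          = (E1 + (1 / omega) * E3 + (1 / omega\<^sup>2) * E5) / \<kappa>"
        using k0 by (simp add: E1_def E3_def E5_def add_divide_distrib diff_divide_distrib mult_ac)
      finally show ?thesis unfolding w .
    qed
    then have "E1 + omega\<^sup>2 * E3 + omega * E5 = 0" using k0 by simp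
    ultimately have "E3 = omega\<^sup>2 * E1" "E5 = omega * E1" by (rule omega_system)+
    then show "N p c3 - N p c4 = omega\<^sup>2 * (N r2 c3 / N r2 c1) * (N p c1 - N p c2)"
      "N p c5 - N p c6 = omega * (N r2 c5 / N r2 c1) * (N p c1 - N p c2)"
      unfolding E1_def E3_def E5_def by (simp_all add: field_simps)
  qed
  have nD: "norm (N p c3 - N p c4) = norm (N p c1 - N p c2)" "norm (N p c5 - N p c6) = norm (N p c1 - N p c2)"
    if "p \<noteq> r2" "p \<noteq> r3" for p
    unfolding D[OF that] by (simp_all add: norm_mult norm_divide norm_power nm)
  \<comment> \<open>In the orthogonality sum of two paired columns, \<open>r1\<close> contributes 1
    and \<open>r2\<close>, \<open>r3\<close> contribute \<open>- 1\<close> each, so the other rows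
    contribute 1.\<close>
  have col: "N a d' / N a d + N b d' / N b d + N c d' / N c d = 1"
    if "cols r1 r2 r3 a b c" "d' \<noteq> d" "N r2 d' = - N r2 d" "N r3 d' = - N r3 d" for a b c d d'
    using had_columns[OF assms(1) that(2)] by (simp add: cols_sum[OF that(1)] that(3,4) assms(2) add_eq_0_iff algebra_simps)
  have cd: "c2 \<noteq> c1" "c4 \<noteq> c3" "c6 \<noteq> c5" using assms(4) by (auto simp: cols_def)
  have key: ?thesis if abc: "cols r1 r2 r3 a b c" and a: "N a c2 = N a c1" for a b c
  proof -
    have ne: "a \<noteq> r1" "b \<noteq> r1" "c \<noteq> r1" "a \<noteq> r2" "b \<noteq> r2" "c \<noteq> r2" "a \<noteq> r3" "b \<noteq> r3" "c \<noteq> r3"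
       "a \<noteq> b" "a \<noteq> c" "b \<noteq> c" using abc by (auto simp: cols_def)
    have a': "N a c4 = N a c3" "N a c6 = N a c5" using D[of a] ne a by simp_all
    have op: "N c d' / N c d = - (N b d' / N b d)" if "(d, d') \<in> {(c1, c2), (c3, c4), (c5, c6)}" for d d'
    proof -
      have "N a d' / N a d + N b d' / N b d + N c d' / N c d = 1"
        by (rule col[OF abc]) (use that cd u v in auto)
      moreover have "N a d' / N a d = 1" using that a a' by auto
      ultimately show ?thesis by (simp add: add_eq_0_iff)
    qed
    have "2 * (N a c1 + N a c3 + N a c5) = 0" using S[of a] ne a a' by (simp add: S1_def S3_def S5_def)
    then have "N a c1 + N a c3 + N a c5 = 0" by (simp only: mult_eq_0_iff) simp
    then have a3: "N a c3 = omega * N a c1 \<and> N a c5 = omega\<^sup>2 * N a c1 \<or> N a c3 = omega\<^sup>2 * N a c1 \<and> N a c5 = omega * N a c1"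
      by (rule three_units_sum_zero[OF nm nm nm])
    \<comment> \<open>This treats \<open>t = 1\<close> and \<open>t = - 1\<close>: a second row
      \<open>x\<close> is constant on the pairs and the last row \<open>y\<close> changes sign on
      each. Then \<open>a\<close> and \<open>x\<close> are 3-cycles of opposite orientation over the
      pairs, and \<open>y\<close> is determined by \<open>D\<close> up to a factor.\<close>
    have fin: ?thesis if xy: "cols r1 r2 r3 a x y" and x: "N x c2 = N x c1" and y: "N y c2 = - N y c1" "N y c4 = - N y c3" "N y c6 = - N y c5" for x y
    proof -
      have ne': "x \<noteq> r1" "x \<noteq> r2" "x \<noteq> r3" "y \<noteq> r2" "y \<noteq> r3" "x \<noteq> a" using xy by (auto simp: cols_def)
      have x': "N x c4 = N x c3" "N x c6 = N x c5" using D[of x] ne' x by simp_all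
      have "2 * (N x c1 + N x c3 + N x c5) = 0" using S[of x] ne' x x' by (simp add: S1_def S3_def S5_def)
      then have "N x c1 + N x c3 + N x c5 = 0" by (simp only: mult_eq_0_iff) simp
      then have x3: "N x c3 = omega * N x c1 \<and> N x c5 = omega\<^sup>2 * N x c1 \<or> N x c3 = omega\<^sup>2 * N x c1 \<and> N x c5 = omega * N x c1"
        by (rule three_units_sum_zero[OF nm nm nm])
      have not_prop: "\<not> (N x c3 / N a c3 = N x c1 / N a c1 \<and> N x c5 / N a c5 = N x c1 / N a c1)"
      proof
        assume h: "N x c3 / N a c3 = N x c1 / N a c1 \<and> N x c5 / N a c5 = N x c1 / N a c1"
        have "2 * (N x c1 / N a c1) + 2 * (N x c3 / N a c3) + 2 * (N x c5 / N a c5) = 0"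
          using had_orth[OF assms(1) ne'(6)] by (simp add: cols_sum[OF assms(4)] a a' x x' algebra_simps)
        then have "6 * (N x c1 / N a c1) = 0" using h by simp
        then show False by simp
      qed
      have y': "N y c3 = omega\<^sup>2 * (N r2 c3 / N r2 c1) * N y c1" "N y c5 = omega * (N r2 c5 / N r2 c1) * N y c1"
      proof -
        have "2 * N y c3 = 2 * (omega\<^sup>2 * (N r2 c3 / N r2 c1) * N y c1)" "2 * N y c5 = 2 * (omega * (N r2 c5 / N r2 c1) * N y c1)"
          using D[of y] ne' y by simp_all
        then show "N y c3 = omega\<^sup>2 * (N r2 c3 / N r2 c1) * N y c1" "N y c5 = omega * (N r2 c5 / N r2 c1) * N y c1"
          by (simp_all only: mult_cancel_left) simp_all
      qed
      have fin': ?thesis if mn: "cols r1 r2 m r3 n y" and m: "N m c2 = N m c1" "N m c4 = N m c3" "N m c6 = N m c5"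
           "N m c3 = omega * N m c1" "N m c5 = omega\<^sup>2 * N m c1"
         and n: "N n c2 = N n c1" "N n c4 = N n c3" "N n c6 = N n c5"
           "N n c3 = omega\<^sup>2 * N n c1" "N n c5 = omega * N n c1" for m n
      proof -
        have "has_form N (F32_matrix (N r2 c3 / N r2 c1) (N r2 c5 / N r2 c1))"
          by (rule has_formI[OF mn assms(4,1)])
             (simp add: F32_matrix_def Let_def assms(2) m n u v v' y y')
        moreover have "norm (N r2 c3 / N r2 c1) = 1" "norm (N r2 c5 / N r2 c1) = 1"
          by (simp_all add: norm_divide nm)
        ultimately show ?thesis by blast
      qed
      have o: "cols r1 r2 a r3 x y" "cols r1 r2 x r3 a y" using xy by (auto simp: cols_def)
      from a3 x3 not_prop show ?thesis
        using fin'[OF o(1) a a' _ _ x x'] fin'[OF o(2) x x' _ _ a a'] by auto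
    qed
    define t where "t = N b c2 / N b c1"
    have tb: "N b c2 = t * N b c1" and tc: "N c c2 = - t * N c c1"
      using op[of c1 c2] by (simp_all add: t_def field_simps)
    have opp: "N p c4 = - N p c3" "N p c6 = - N p c5"
      if "p = b \<and> N c c2 = N c c1 \<or> p = c \<and> N b c2 = N b c1" for p
    proof -
      have neg: "z = - w" if "x = y" "x / y = - (z / w)" "w \<noteq> 0" "y \<noteq> 0" for x y z w :: complex
        using that by (simp add: field_simps eq_neg_iff_add_eq_0 add.commute)
      have neg': "x = - y" if "z = w" "x / y = - (z / w)" "w \<noteq> 0" "y \<noteq> 0" for x y z w :: complex
        using that by (simp add: field_simps)
      have o: "N c c4 / N c c3 = - (N b c4 / N b c3)" "N c c6 / N c c5 = - (N b c6 / N b c5)"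
        using op[of c3 c4] op[of c5 c6] by simp_all
      from that have "N p c4 = - N p c3 \<and> N p c6 = - N p c5"
      proof (elim disjE conjE)
        assume h: "p = b" "N c c2 = N c c1"
        have "N c c4 = N c c3" "N c c6 = N c c5" using D[of c] ne h(2) by simp_all
        then show ?thesis unfolding h(1) by (intro conjI neg[OF _ o(1)] neg[OF _ o(2)] nz)
      next
        assume h: "p = c" "N b c2 = N b c1"
        have "N b c4 = N b c3" "N b c6 = N b c5" using D[of b] ne h(2) by simp_all
        then show ?thesis unfolding h(1) by (intro conjI neg'[OF _ o(1)] neg'[OF _ o(2)] nz)
      qed
      then show "N p c4 = - N p c3" "N p c6 = - N p c5" by simp_all
    qed
    consider "t = 1" | "t = - 1" | "t \<noteq> 1" "t \<noteq> - 1" by blast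
    then show ?thesis
    proof cases
      case 1
      show ?thesis by (rule fin[OF abc]) (use 1 tb tc opp[of c] in auto)
    next
      case 2
      have "cols r1 r2 r3 a c b" using abc by (auto simp: cols_def)
      then show ?thesis by (rule fin) (use 2 tb tc opp[of b] in auto)
    next
      \<comment> \<open>For all other \<open>t\<close> the quotient of \<open>b\<close> and
        \<open>c\<close> turns out to be halved. Equal differences in absolute value leave only
        \<open>t\<close> and \<open>1 / t\<close> for \<open>t3\<close> and
        \<open>t5\<close>.\<close>
      case 3
      define t3 t5 where "t3 = N b c4 / N b c3" and "t5 = N b c6 / N b c5"
      have tb': "N b c4 = t3 * N b c3" "N b c6 = t5 * N b c5" and tc': "N c c4 = - t3 * N c c3" "N c c6 = - t5 * N c c5"
        using op[of c3 c4] op[of c5 c6] by (simp_all add: t3_def t5_def field_simps)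
      have nt: "norm t = 1" "norm t3 = 1" "norm t5 = 1" by (simp_all add: t_def t3_def t5_def norm_divide nm)
      have "norm (1 - t) = norm (1 - t3)" "norm (1 - t) = norm (1 - t5)"
      proof -
        have f: "norm (x - y * x) = norm (1 - y)" if "norm x = 1" for x y :: complex
          using that norm_mult[of "1 - y" x] by (simp add: algebra_simps)
        show "norm (1 - t) = norm (1 - t3)" "norm (1 - t) = norm (1 - t5)"
          using nD[of b] ne unfolding tb tb' by (simp_all add: f nm)
      qed
      then have t35: "t3 = t \<or> t3 = 1 / t" "t5 = t \<or> t5 = 1 / t"
        using chord_eq_cases nt by blast+
      \<comment> \<open>The row \<open>a\<close> is constant on the pairs with a 3-cycle of values.
        So orthogonality to \<open>r1\<close> and \<open>a\<close> is a Fourier system for the sums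
        over the pairs, with the same ratios \<open>e\<close>, \<open>e'\<close> for both
        rows.\<close>
      have "\<exists>e e'. e \<noteq> 0 \<and> e' \<noteq> 0 \<and> (\<forall>p\<in>{b, c}. S3 p = e * S1 p \<and> S5 p = e' * S1 p)"
      proof -
        have Sa: "S1 p / N a c1 + S3 p / N a c3 + S5 p / N a c5 = 0" if "p \<noteq> a" for p
          using had_orth[OF assms(1) that]
          by (simp add: cols_sum[OF assms(4)] a a' S1_def S3_def S5_def add_divide_distrib add_ac)
        from a3 show ?thesis
        proof
          assume h: "N a c3 = omega * N a c1 \<and> N a c5 = omega\<^sup>2 * N a c1"
          have "S3 p = omega\<^sup>2 * S1 p \<and> S5 p = omega * S1 p" if "p \<in> {b, c}" for p
          proof -
            have "(S1 p + (1 / omega) * S3 p + (1 / omega\<^sup>2) * S5 p) / N a c1 = 0"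
              using Sa[of p] that ne h by (auto simp: add_divide_distrib)
            then have "S1 p + omega\<^sup>2 * S3 p + omega * S5 p = 0" unfolding w by simp
            moreover have "S1 p + S3 p + S5 p = 0" using S[of p] that ne by auto
            ultimately show ?thesis using omega_system by blast
          qed
          then show ?thesis by (intro exI[of _ "omega\<^sup>2"] exI[of _ omega]) auto
        next
          assume h: "N a c3 = omega\<^sup>2 * N a c1 \<and> N a c5 = omega * N a c1"
          have "S3 p = omega * S1 p \<and> S5 p = omega\<^sup>2 * S1 p" if "p \<in> {b, c}" for p
          proof -
            have "(S1 p + (1 / omega\<^sup>2) * S3 p + (1 / omega) * S5 p) / N a c1 = 0"
              using Sa[of p] that ne h by (auto simp: add_divide_distrib)
            then have "S1 p + omega * S3 p + omega\<^sup>2 * S5 p = 0" unfolding w by simp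
            moreover have "S1 p + S3 p + S5 p = 0" using S[of p] that ne by auto
            ultimately show ?thesis using omega_system' by blast
          qed
          then show ?thesis by (intro exI[of _ omega] exI[of _ "omega\<^sup>2"]) auto
        qed
      qed
      then obtain e e' where e: "e \<noteq> 0" "e' \<noteq> 0" "S3 b = e * S1 b" "S5 b = e' * S1 b" "S3 c = e * S1 c" "S5 c = e' * S1 c"
        by blast
      have t0: "t \<noteq> 0" by (simp add: t_def)
      have "N b c3 / N c c3 = N b c1 / N c c1 \<or> N b c3 / N c c3 = - (N b c1 / N c c1)"
        by (rule block_quotient_sign[OF _ _ t35(1) t0 3 _ _ e(1)])
           (use e(3,5) in \<open>simp_all add: S1_def S3_def tb tc tb' tc' algebra_simps\<close>)
      moreover have "N b c5 / N c c5 = N b c1 / N c c1 \<or> N b c5 / N c c5 = - (N b c1 / N c c1)"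
        by (rule block_quotient_sign[OF _ _ t35(2) t0 3 _ _ e(2)])
           (use e(4,6) in \<open>simp_all add: S1_def S5_def tb tc tb' tc' algebra_simps\<close>)
      moreover have "t3 \<noteq> 0" "t5 \<noteq> 0" using nt by auto
      ultimately have "halved (rel N b c)"
        using t0 by (intro halved_of_blocks[OF assms(4)]) (simp_all add: rel_def tb tc tb' tc')
      then show ?thesis using ne by blast
    qed
  qed
  have n1: "norm (N p c2 / N p c1) = 1" for p by (simp add: norm_divide nm)
  \<comment> \<open>Of three unit quotients with sum 1 one is equal to 1; its row takes the role of
    \<open>a\<close>.\<close>
  have "N r4 c2 / N r4 c1 + N r5 c2 / N r5 c1 + N r6 c2 / N r6 c1 = 1"
    by (rule col[OF r cd(1) u(1) v(1)])
  from three_units_sum_one[OF n1 n1 n1 this]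
  consider "N r4 c2 = N r4 c1" | "N r5 c2 = N r5 c1" | "N r6 c2 = N r6 c1"
    by (auto simp: field_simps)
  then show ?thesis
  proof cases
    case 1
    show ?thesis by (rule key[OF r 1])
  next
    case 2
    have "cols r1 r2 r3 r5 r4 r6" using r by (auto simp: cols_def)
    then show ?thesis using 2 by (rule key)
  next
    case 3
    have "cols r1 r2 r3 r6 r4 r5" using r by (auto simp: cols_def)
    then show ?thesis using 3 by (rule key)
  qed
qed

text \<open>The rows \<open>r2\<close> and \<open>r3\<close> are opposite on the same column pairs,
  so their quotient is constant on each pair, and orthogonality makes the three constants a 3-cycle.
  Exchanging two pairs of columns gives it the required orientation.\<close>

lemma share_matching_F32:
  assumes "had H" "distinct [r1, r2, r3]" "share_matching (rel H r2 r1) (rel H r3 r1)"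
  shows "(\<exists>r s. norm r = 1 \<and> norm s = 1 \<and> has_form H (F32_matrix r s)) \<or> (\<exists>p q. p \<noteq> q \<and> halved (rel H p q))"
proof -
  define N where "N p c = H p c / H r1 c" for p c
  note n = normalize_row[OF assms(1), of r1, folded N_def]
  have nz: "N p c \<noteq> 0" for p c by (rule had_nonzero[OF n(1)])
  have nm: "norm (N p c / N q c) = 1" for p q c by (simp add: norm_divide had_norm[OF n(1)])
  have rN: "rel H p r1 c = N p c" for p c by (simp add: N_def rel_def)
  obtain c1 c2 c3 c4 c5 c6 where c: "cols c1 c2 c3 c4 c5 c6"
    and u: "N r2 c2 = - N r2 c1" "N r2 c4 = - N r2 c3" "N r2 c6 = - N r2 c5"
    and v: "N r3 c2 = - N r3 c1" "N r3 c4 = - N r3 c3" "N r3 c6 = - N r3 c5"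
    using assms(3) unfolding share_matching_def rN by (elim exE conjE) (rule that)
  have "r3 \<noteq> r2" using assms(2) by auto
  then have "2 * (N r3 c1 / N r2 c1 + N r3 c3 / N r2 c3 + N r3 c5 / N r2 c5) = 0"
    using had_orth[OF n(1), of r3 r2] by (simp add: cols_sum[OF c] u v algebra_simps)
  then have "N r3 c1 / N r2 c1 + N r3 c3 / N r2 c3 + N r3 c5 / N r2 c5 = 0"
    by (simp only: mult_eq_0_iff) simp
  from three_units_sum_zero[OF nm nm nm this]
  have "(\<exists>r s. norm r = 1 \<and> norm s = 1 \<and> has_form N (F32_matrix r s)) \<or> (\<exists>p q. p \<noteq> q \<and> halved (rel N p q))"
  proof (elim disjE conjE)
    assume "N r3 c3 / N r2 c3 = omega * (N r3 c1 / N r2 c1)" "N r3 c5 / N r2 c5 = omega\<^sup>2 * (N r3 c1 / N r2 c1)"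
    then show ?thesis by (rule share_matching_normalized[OF n(1,2) assms(2) c u v])
  next
    assume h: "N r3 c3 / N r2 c3 = omega\<^sup>2 * (N r3 c1 / N r2 c1)" "N r3 c5 / N r2 c5 = omega * (N r3 c1 / N r2 c1)"
    have "cols c1 c2 c5 c6 c3 c4" using c by (auto simp: cols_def)
    then show ?thesis by (rule share_matching_normalized[OF n(1,2) assms(2) _ u(1,3,2) v(1,3,2) h(2,1)])
  qed
  then show ?thesis using n(3,4) by metis
qed

lemma rel_norm: "had H \<Longrightarrow> norm (rel H p q c) = 1"
  by (simp add: rel_def norm_divide had_norm)

lemma rel_nonzero: "had H \<Longrightarrow> rel H p q c \<noteq> 0"
  using rel_norm[of H p q c] by auto

lemma rel_quotient:
  assumes "had H"
  shows "rel H p r c / rel H q r c = rel H p q c"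
  using had_nonzero[OF assms] by (simp add: rel_def)

section \<open>Only three-cycles: the Tao matrix\<close>

text \<open>Otherwise the column triples of \<open>f\<close> and \<open>g\<close> cross, and one of the level sets of the cube of
  \<open>g / f\<close>, which have at least three elements, lies in a union of two crossing cells with one element each.\<close>

lemma type3_split_compatible:
  assumes "type3 g" "type3 (\<lambda>c. g c / f c)" "\<And>c. f c \<noteq> 0" "\<And>c. g c \<noteq> 0"
    and L: "card L = 3" "\<And>c. c \<in> L \<Longrightarrow> f c ^ 3 = \<alpha>" "\<And>c. c \<notin> L \<Longrightarrow> f c ^ 3 = \<beta>" "\<alpha> \<noteq> \<beta>"
  shows "\<exists>A B. (\<forall>c\<in>L. g c ^ 3 = A) \<and> (\<forall>c. c \<notin> L \<longrightarrow> g c ^ 3 = B)"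
proof -
  let ?k = "\<lambda>c. g c / f c"
  obtain P X Y where P: "card P = 3" "\<And>c. c \<in> P \<Longrightarrow> g c ^ 3 = X" "\<And>c. c \<notin> P \<Longrightarrow> g c ^ 3 = Y"
    "sum g P = 0" "sum g (- P) = 0" "prod g P = X" "prod g (- P) = Y"
    by (rule type3_split[OF assms(1)]) (rule that; blast)
  obtain Q U V where Q: "card Q = 3" "\<And>c. c \<in> Q \<Longrightarrow> ?k c ^ 3 = U" "\<And>c. c \<notin> Q \<Longrightarrow> ?k c ^ 3 = V"
    "sum ?k Q = 0" "sum ?k (- Q) = 0" "prod ?k Q = U" "prod ?k (- Q) = V"
    by (rule type3_split[OF assms(2)]) (rule that; blast)
  have cQ: "card (- Q) = 3" using Q(1) by (simp add: card_Compl_6)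
  have G: "g c ^ 3 = ?k c ^ 3 * f c ^ 3" for c using assms(3) by (simp add: power_divide)
  consider "X = Y" | "U = V" | "P = L" | "P = - L" | "X \<noteq> Y" "U \<noteq> V" "P \<noteq> L" "P \<noteq> - L" by blast
  then show ?thesis
  proof cases
    case 1
    then have "g c ^ 3 = X" for c using P(2,3) by blast
    then show ?thesis by blast
  next
    case 2
    then have "?k c ^ 3 = U" for c using Q(2,3) by blast
    then have "g c ^ 3 = U * f c ^ 3" for c using G[of c] by simp
    then show ?thesis using L(2,3) by metis
  next
    case 3
    then show ?thesis using P(2,3) by blast
  next
    case 4
    then show ?thesis using P(2,3) by blast
  next
    case 5
    let ?D = "(P \<inter> L) \<union> - (P \<union> L)" and ?E = "(P - L) \<union> (L - P)"
    let ?n = "card (P \<inter> L)"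
    have lvl: "card {c'. ?k c' ^ 3 = ?k c ^ 3} = 3" for c
    proof (cases "c \<in> Q")
      case True
      then have "{c'. ?k c' ^ 3 = ?k c ^ 3} = Q" using Q(2,3) 5(2) by auto
      then show ?thesis using Q(1) by simp
    next
      case False
      then have "{c'. ?k c' ^ 3 = ?k c ^ 3} = - Q" using Q(2,3) 5(2) by auto
      then show ?thesis using cQ by simp
    qed
    have ab0: "f c ^ 3 \<noteq> 0" "g c ^ 3 \<noteq> 0" for c using assms(3,4) by simp_all
    \<comment> \<open>Columns separated by exactly one of \<open>P\<close> and \<open>L\<close>
      agree in one cube and differ in the other. So a level set of \<open>?k c ^ 3\<close> stays
      inside \<open>?D\<close> or inside \<open>?E\<close>.\<close>
    have sep: "?k c ^ 3 \<noteq> ?k d ^ 3" if "(c \<in> P \<longleftrightarrow> d \<in> P) \<longleftrightarrow> \<not> (c \<in> L \<longleftrightarrow> d \<in> L)" for c d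
    proof
      assume "?k c ^ 3 = ?k d ^ 3"
      then have e: "g c ^ 3 * f d ^ 3 = g d ^ 3 * f c ^ 3"
        using ab0 by (simp add: power_divide frac_eq_eq)
      show False
      proof (cases "c \<in> P \<longleftrightarrow> d \<in> P")
        case True
        then have "g c ^ 3 = g d ^ 3" using P(2,3) by metis
        then have "f d ^ 3 = f c ^ 3" using e ab0 by simp
        moreover have "f c ^ 3 \<noteq> f d ^ 3" using that True L(2-4) by (cases "c \<in> L"; cases "d \<in> L") auto
        ultimately show False by simp
      next
        case False
        then have "f c ^ 3 = f d ^ 3" using that L(2,3) by metis
        then have "g c ^ 3 = g d ^ 3" using e ab0 by simp
        moreover have "g c ^ 3 \<noteq> g d ^ 3" using False P(2,3) 5(1) by (cases "c \<in> P"; cases "d \<in> P") auto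
        ultimately show False by simp
      qed
    qed
    have cU: "card (P \<union> L) + ?n = 6" using card_Un_Int[of P L] P(1) L(1) by simp
    have cD: "card ?D = 2 * ?n"
    proof -
      have "card (- (P \<union> L)) = ?n" using cU card_Compl_6[of "P \<union> L"] by simp
      then show ?thesis by (subst card_Un_disjoint) auto
    qed
    have n3: "?n \<le> 3" using P(1) by (metis card_mono finite inf_le1)
    have cE: "card ?E = 2 * (3 - ?n)"
    proof -
      have "card (P - L) = 3 - ?n" "card (L - P) = 3 - ?n"
        using P(1) L(1) by (simp_all add: card_Diff_subset_Int Int_commute)
      then show ?thesis by (subst card_Un_disjoint) auto
    qed
    have n0: "?n \<noteq> 0"
    proof
      assume "?n = 0"
      then have "P \<subseteq> - L" by auto
      moreover have "card (- L) = 3" using L(1) by (simp add: card_Compl_6)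
      ultimately show False using P(1) 5(4) by (metis card_subset_eq finite)
    qed
    have n3': "?n \<noteq> 3"
    proof
      assume "?n = 3"
      then have "P \<inter> L = P" "P \<inter> L = L" using P(1) L(1) by (metis card_subset_eq finite inf_le1 inf_le2)+
      then show False using 5(3) by blast
    qed
    from n0 n3 n3' consider "?n = 1" | "?n = 2" by linarith
    then show ?thesis
    proof cases
      case 1
      then obtain c where c: "c \<in> P \<inter> L" by (metis card.empty ex_in_conv zero_neq_one)
      have "{c'. ?k c' ^ 3 = ?k c ^ 3} \<subseteq> ?D"
      proof
        fix d assume "d \<in> {c'. ?k c' ^ 3 = ?k c ^ 3}"
        then have "\<not> ((d \<in> P \<longleftrightarrow> c \<in> P) \<longleftrightarrow> \<not> (d \<in> L \<longleftrightarrow> c \<in> L))" using sep[of d c] by blast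
        then show "d \<in> ?D" using c by blast
      qed
      then have "card {c'. ?k c' ^ 3 = ?k c ^ 3} \<le> card ?D" by (rule card_mono[OF finite])
      then have "3 \<le> card ?D" unfolding lvl .
      then show ?thesis using cD 1 by simp
    next
      case 2
      then have "P - L \<noteq> {}" using n3' P(1) by (metis Diff_eq_empty_iff inf.absorb1)
      then obtain c where c: "c \<in> P - L" by blast
      have "{c'. ?k c' ^ 3 = ?k c ^ 3} \<subseteq> ?E"
      proof
        fix d assume "d \<in> {c'. ?k c' ^ 3 = ?k c ^ 3}"
        then have "\<not> ((d \<in> P \<longleftrightarrow> c \<in> P) \<longleftrightarrow> \<not> (d \<in> L \<longleftrightarrow> c \<in> L))" using sep[of d c] by blast
        then show "d \<in> ?E" using c by blast
      qed
      then have "card {c'. ?k c' ^ 3 = ?k c ^ 3} \<le> card ?E" by (rule card_mono[OF finite])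
      then have "3 \<le> card ?E" unfolding lvl .
      then show ?thesis using cE 2 by simp
    qed
  qed
qed

section \<open>Constancy of the cubes\<close>

definition pure :: "(6 \<Rightarrow> complex) \<Rightarrow> bool" where
  "pure f \<longleftrightarrow> (\<forall>c d. f c ^ 3 = f d ^ 3)"

text \<open>Rows with non-constant cubes are, on \<open>L\<close>, multiples of \<open>(1, \<omega>, \<omega>\<^sup>2)\<close> or \<open>(1, \<omega>\<^sup>2, \<omega>)\<close>, and no two of
  them can be proportional there.\<close>

lemma card_not_pure_le_2:
  assumes H: "had H" and t3: "\<And>p q. p \<noteq> q \<Longrightarrow> type3 (rel H p q)" and L: "card L = 3"
    and const: "\<And>p. \<exists>A B. (\<forall>c\<in>L. rel H p r c ^ 3 = A) \<and> (\<forall>c. c \<notin> L \<longrightarrow> rel H p r c ^ 3 = B)"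
  shows "card {p. \<not> pure (rel H p r)} \<le> 2"
proof -
  obtain l1 l2 l3 where l: "L = {l1, l2, l3}" "l1 \<noteq> l2" "l1 \<noteq> l3" "l2 \<noteq> l3"
    by (rule card_3_elems[OF L]) (rule that; assumption)
  have ori: "rel H p r l2 = omega * rel H p r l1 \<and> rel H p r l3 = omega\<^sup>2 * rel H p r l1 \<or>
      rel H p r l2 = omega\<^sup>2 * rel H p r l1 \<and> rel H p r l3 = omega * rel H p r l1" if np: "\<not> pure (rel H p r)" for p
  proof -
    let ?g = "rel H p r"
    have "p \<noteq> r" using np had_nonzero[OF H] by (auto simp: pure_def rel_def)
    obtain P X Y where P: "card P = 3" "\<And>c. c \<in> P \<Longrightarrow> ?g c ^ 3 = X" "\<And>c. c \<notin> P \<Longrightarrow> ?g c ^ 3 = Y"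
      "sum ?g P = 0" "sum ?g (- P) = 0" "prod ?g P = X" "prod ?g (- P) = Y"
      by (rule type3_split[OF t3[OF \<open>p \<noteq> r\<close>]]) (rule that; blast)
    have XY: "X \<noteq> Y"
    proof
      assume "X = Y"
      then have "?g c ^ 3 = X" for c using P(2,3) by blast
      then show False using np by (simp add: pure_def)
    qed
    obtain A where A: "\<forall>c\<in>L. ?g c ^ 3 = A" using const by blast
    have "L \<subseteq> P \<or> L \<subseteq> - P"
    proof (cases "A = X")
      case True
      then have "L \<subseteq> P" using A P(3) XY by (metis subsetI)
      then show ?thesis ..
    next
      case False
      then have "L \<subseteq> - P" using A P(2) by (metis ComplI subsetI)
      then show ?thesis ..
    qed
    then have "L = P \<or> L = - P"
    proof
      assume "L \<subseteq> P"
      then show ?thesis using L P(1) by (metis card_subset_eq finite)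
    next
      assume "L \<subseteq> - P"
      moreover have "card (- P) = 3" using P(1) by (simp add: card_Compl_6)
      ultimately show ?thesis using L by (metis card_subset_eq finite)
    qed
    then have "sum ?g L = 0" using P(4,5) by auto
    then have "?g l1 + ?g l2 + ?g l3 = 0" using l by (simp add: add.assoc)
    then show ?thesis by (intro three_units_sum_zero rel_norm[OF H])
  qed
  define \<phi> where "\<phi> p \<longleftrightarrow> rel H p r l2 = omega * rel H p r l1" for p
  have "inj_on \<phi> {p. \<not> pure (rel H p r)}"
  proof (rule inj_onI, rule ccontr)
    fix p q
    assume pq: "p \<in> {p. \<not> pure (rel H p r)}" "q \<in> {p. \<not> pure (rel H p r)}" "\<phi> p = \<phi> q" "p \<noteq> q"
    have nz: "rel H p r l1 \<noteq> 0" "rel H q r l1 \<noteq> 0" by (rule rel_nonzero[OF H])+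
    have "rel H p q l1 = rel H p q l2 \<and> rel H p q l2 = rel H p q l3"
      unfolding rel_quotient[OF H, of p r _ q, symmetric]
      using ori[of p] ori[of q] pq(1-3) nz unfolding \<phi>_def by auto
    then show False
      using type3_no_triple[OF t3[OF pq(4)] rel_nonzero[OF H], of l1 l2 l3] l by simp
  qed
  then have "card {p. \<not> pure (rel H p r)} \<le> card (UNIV :: bool set)"
    by (rule card_inj_on_le) auto
  then show ?thesis by simp
qed

text \<open>If the cubes of \<open>rel H u r\<close> vary, then every row has varying cubes relative
  to \<open>r\<close> or relative to \<open>u\<close>. For both reference rows the cubes are
  constant on the same triple \<open>L\<close> and on its complement, so each accounts for at most
  two rows, too few for six.\<close>

lemma all_type3_pure:
  assumes H: "had H" and t3: "\<And>p q. p \<noteq> q \<Longrightarrow> type3 (rel H p q)"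
  shows "pure (rel H u r)"
proof (rule ccontr)
  assume np: "\<not> pure (rel H u r)"
  have nz: "rel H p q c \<noteq> 0" for p q c by (rule rel_nonzero[OF H])
  have "u \<noteq> r" using np had_nonzero[OF H] by (auto simp: pure_def rel_def)
  obtain L \<alpha> \<beta> where L: "card L = 3" "\<And>c. c \<in> L \<Longrightarrow> rel H u r c ^ 3 = \<alpha>" "\<And>c. c \<notin> L \<Longrightarrow> rel H u r c ^ 3 = \<beta>"
    "sum (rel H u r) L = 0" "sum (rel H u r) (- L) = 0" "prod (rel H u r) L = \<alpha>" "prod (rel H u r) (- L) = \<beta>"
    by (rule type3_split[OF t3[OF \<open>u \<noteq> r\<close>]]) (rule that; blast)
  have ab: "\<alpha> \<noteq> \<beta>"
  proof
    assume "\<alpha> = \<beta>"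
    then have "rel H u r c ^ 3 = \<alpha>" for c using L(2,3) by blast
    then show False using np by (simp add: pure_def)
  qed
  have c1: "\<exists>A B. (\<forall>c\<in>L. rel H p r c ^ 3 = A) \<and> (\<forall>c. c \<notin> L \<longrightarrow> rel H p r c ^ 3 = B)" for p
  proof -
    consider "p = r" | "p = u" | "p \<noteq> r" "p \<noteq> u" by blast
    then show ?thesis
    proof cases
      case 1
      then have "rel H p r c = 1" for c using had_nonzero[OF H] by (simp add: rel_def)
      then show ?thesis by simp
    next
      case 2
      then show ?thesis using L(2,3) by blast
    next
      case 3
      have "(\<lambda>c. rel H p r c / rel H u r c) = rel H p u" by (simp add: fun_eq_iff rel_quotient[OF H])
      then have k: "type3 (\<lambda>c. rel H p r c / rel H u r c)" using t3[OF 3(2)] by simp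
      show ?thesis
      proof (rule type3_split_compatible[OF t3[OF 3(1)] k nz nz L(1) _ _ ab])
        show "rel H u r c ^ 3 = \<alpha>" if "c \<in> L" for c using L(2)[OF that] .
        show "rel H u r c ^ 3 = \<beta>" if "c \<notin> L" for c using L(3)[OF that] .
      qed
    qed
  qed
  have a0: "\<alpha> \<noteq> 0" "\<beta> \<noteq> 0" using L(6,7)[symmetric] nz by simp_all
  have c2: "\<exists>A B. (\<forall>c\<in>L. rel H p u c ^ 3 = A) \<and> (\<forall>c. c \<notin> L \<longrightarrow> rel H p u c ^ 3 = B)" for p
  proof -
    obtain A B where AB: "\<forall>c\<in>L. rel H p r c ^ 3 = A" "\<forall>c. c \<notin> L \<longrightarrow> rel H p r c ^ 3 = B"
      using c1[of p] by blast
    have "rel H p u c ^ 3 = rel H p r c ^ 3 / rel H u r c ^ 3" for c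
      by (simp add: rel_quotient[OF H] flip: power_divide)
    then have "\<forall>c\<in>L. rel H p u c ^ 3 = A / \<alpha>" "\<forall>c. c \<notin> L \<longrightarrow> rel H p u c ^ 3 = B / \<beta>"
      using AB L(2,3) by simp_all
    then show ?thesis by blast
  qed
  have "p \<in> {p. \<not> pure (rel H p r)} \<union> {p. \<not> pure (rel H p u)}" for p
  proof (rule ccontr)
    assume "\<not> ?thesis"
    then have "pure (rel H p r)" "pure (rel H p u)" by auto
    moreover have "rel H u r c ^ 3 = rel H p r c ^ 3 / rel H p u c ^ 3" for c
      using had_nonzero[OF H] by (simp add: rel_def flip: power_divide)
    ultimately have "pure (rel H u r)" unfolding pure_def by metis
    then show False using np by simp
  qed
  then have "(UNIV :: 6 set) = {p. \<not> pure (rel H p r)} \<union> {p. \<not> pure (rel H p u)}" by blast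
  then have "card (UNIV :: 6 set) \<le> card {p. \<not> pure (rel H p r)} + card {p. \<not> pure (rel H p u)}"
    by (metis card_Un_le)
  also have "\<dots> \<le> 2 + 2"
    by (intro add_mono card_not_pure_le_2[OF H t3 L(1)] c1 c2)
  finally show False by simp
qed

section \<open>Matrices of cube roots of unity\<close>

lemma normalize_row_col:
  fixes r c0 :: 6
  assumes "had H"
  defines "N \<equiv> (\<lambda>p c. rel H p r c / rel H p r c0)"
  shows "had N" "N r c = 1" "N p c0 = 1" "has_form N K \<Longrightarrow> has_form H K"
    "rel N p q c = (1 / rel H p q c0) * rel H p q c"
proof -
  have nz: "H p c \<noteq> 0" for p c by (rule had_nonzero[OF assms(1)])
  have N: "N = (\<lambda>p c. (1 / rel H p r c0) * (1 / H r c) * H p c)" by (simp add: N_def rel_def fun_eq_iff mult.commute)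
  have n: "norm (1 / rel H p r c0) = 1" "norm (1 / H r c) = 1" for p c
    using had_norm[OF assms(1)] rel_norm[OF assms(1)] by (simp_all add: norm_divide)
  show "had N" unfolding N by (rule had_scale[OF assms(1)]) (simp_all only: n)
  show "N r c = 1" "N p c0 = 1" using nz by (simp_all add: N_def rel_def)
  show "rel N p q c = (1 / rel H p q c0) * rel H p q c" using nz by (simp add: N_def rel_def)
  show "has_form N K \<Longrightarrow> has_form H K"
    unfolding N by (erule has_form_scale) (simp_all only: n)
qed

lemma cube_root_one: "z ^ 3 = 1 \<Longrightarrow> z = 1 \<or> z = omega \<or> z = omega\<^sup>2" for z :: complex
  using cube_root_cases[of z 1] by simp

lemma omega_sq_eq: "omega\<^sup>2 = - 1 - omega"
  by (simp add: power2_eq_square omega_sq)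

lemma two_cube_roots_sum:
  fixes x y :: complex
  assumes "x ^ 3 = 1" "y ^ 3 = 1"
  shows "x + y = - 1 \<Longrightarrow> x = omega \<and> y = omega\<^sup>2 \<or> x = omega\<^sup>2 \<and> y = omega"
    and "x + y = - omega \<Longrightarrow> x = 1 \<and> y = omega\<^sup>2 \<or> x = omega\<^sup>2 \<and> y = 1"
    and "x + y = - (omega\<^sup>2) \<Longrightarrow> x = 1 \<and> y = omega \<or> x = omega \<and> y = 1"
  using cube_root_one[OF assms(1)] cube_root_one[OF assms(2)]
  by (auto simp: omega_sq_eq) (auto simp: omega_eq complex_eq_iff)

text \<open>By the Fourier system the three pair sums are \<open>1 + v2\<close> times
  \<open>1, omega\<^sup>2, omega\<close>. For \<open>v2 \<noteq> 1\<close> each of them is minus a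
  cube root of unity, and such a sum determines its two summands up to order.\<close>

lemma tao_row:
  fixes v2 v3 v4 v5 v6 :: complex
  assumes c: "v2 ^ 3 = 1" "v3 ^ 3 = 1" "v4 ^ 3 = 1" "v5 ^ 3 = 1" "v6 ^ 3 = 1" and "v2 \<noteq> 1"
    and s: "(1 + v2) + (v3 + v4) + (v5 + v6) = 0" "(1 + v2) + omega\<^sup>2 * (v3 + v4) + omega * (v5 + v6) = 0"
  shows "v2 = omega \<and> (v3 = 1 \<and> v4 = omega\<^sup>2 \<or> v3 = omega\<^sup>2 \<and> v4 = 1) \<and> (v5 = omega \<and> v6 = omega\<^sup>2 \<or> v5 = omega\<^sup>2 \<and> v6 = omega) \<or>
    v2 = omega\<^sup>2 \<and> (v3 = omega \<and> v4 = omega\<^sup>2 \<or> v3 = omega\<^sup>2 \<and> v4 = omega) \<and> (v5 = 1 \<and> v6 = omega \<or> v5 = omega \<and> v6 = 1)"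
proof -
  note AB = omega_system[OF s]
  from cube_root_one[OF c(1)] assms(6) show ?thesis
  proof (elim disjE)
    assume v: "v2 = omega"
    have "v3 + v4 = - omega" "v5 + v6 = - 1"
      using AB unfolding v by (simp_all add: omega_simps)
    then show ?thesis
      using v two_cube_roots_sum(2)[OF c(2,3)] two_cube_roots_sum(1)[OF c(4,5)] by blast
  next
    assume v: "v2 = omega\<^sup>2"
    have "v3 + v4 = - 1" "v5 + v6 = - (omega\<^sup>2)"
      using AB unfolding v by (simp_all add: omega_simps)
    then show ?thesis
      using v two_cube_roots_sum(1)[OF c(2,3)] two_cube_roots_sum(3)[OF c(4,5)] by blast
  qed simp
qed

lemma card_remaining_rows: "r1 \<noteq> r2 \<Longrightarrow> card (- {r1, r2 :: 6}) = 4"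
  by (simp add: card_Compl_6)

lemma tao_normalized:
  assumes H: "had N" and t3: "\<And>p q. p \<noteq> q \<Longrightarrow> type3 (rel N p q)"
    and r: "r1 \<noteq> r2" and one: "\<And>c. N r1 c = 1" "\<And>p. N p c1 = 1" and cube: "\<And>p c. N p c ^ 3 = 1"
    and c: "cols c1 c2 c3 c4 c5 c6"
    and u: "N r2 c2 = 1" "N r2 c3 = omega" "N r2 c4 = omega" "N r2 c5 = omega\<^sup>2" "N r2 c6 = omega\<^sup>2"
  shows "has_form N tao_matrix"
proof -
  have nz: "N p c \<noteq> 0" for p c by (rule had_nonzero[OF H])
  have no3: False if "p \<noteq> q" "distinct [a, b, d]" "N p a / N q a = N p b / N q b" "N p b / N q b = N p d / N q d" for p q a b d
    using type3_no_triple[OF t3[OF that(1)] rel_nonzero[OF H] that(2)] that(3,4) by (simp add: rel_def)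
  have D: "distinct [c1, c2, c3, c4, c5, c6]" using c by (simp add: cols_def)
  have row: "N p c2 = omega \<and> (N p c3 = 1 \<and> N p c4 = omega\<^sup>2 \<or> N p c3 = omega\<^sup>2 \<and> N p c4 = 1) \<and> (N p c5 = omega \<and> N p c6 = omega\<^sup>2 \<or> N p c5 = omega\<^sup>2 \<and> N p c6 = omega) \<or>
    N p c2 = omega\<^sup>2 \<and> (N p c3 = omega \<and> N p c4 = omega\<^sup>2 \<or> N p c3 = omega\<^sup>2 \<and> N p c4 = omega) \<and> (N p c5 = 1 \<and> N p c6 = omega \<or> N p c5 = omega \<and> N p c6 = 1)"
    if p: "p \<noteq> r1" "p \<noteq> r2" for p
  proof (rule tao_row[OF cube cube cube cube cube])
    \<comment> \<open>Otherwise the orthogonality sum of the columns \<open>c1\<close> and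
      \<open>c2\<close> has three terms equal to 1 and three terms of real part at least
      \<open>- 1 / 2\<close>.\<close>
    show "N p c2 \<noteq> 1"
    proof
      assume e: "N p c2 = 1"
      obtain s1 s2 s3 where s: "cols r1 r2 p s1 s2 s3" by (rule cols_extend_3[of r1 r2 p]) (use r p in auto)
      have "c2 \<noteq> c1" using D by auto
      from had_columns[OF H this] have "3 + N s1 c2 + N s2 c2 + N s3 c2 = 0"
        by (simp add: cols_sum[OF s] one u e)
      then have "Re (3 + N s1 c2 + N s2 c2 + N s3 c2) = 0" by simp
      moreover have "Re (N s c2) \<ge> - 1 / 2" for s
        using cube_root_one[OF cube[of s c2]] by (auto simp: omega_sq_eq) (auto simp: omega_eq)
      from this[of s1] this[of s2] this[of s3] have "Re (3 + N s1 c2 + N s2 c2 + N s3 c2) > 0" by simp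
      ultimately show False by simp
    qed
    show "1 + N p c2 + (N p c3 + N p c4) + (N p c5 + N p c6) = 0"
      using had_orth[OF H p(1)] by (simp add: cols_sum[OF c] one add_ac)
    have "1 / omega = omega\<^sup>2" "1 / omega\<^sup>2 = omega"
      by (simp_all add: field_simps) (simp_all add: omega_simps)
    then have w: "x / omega = omega\<^sup>2 * x" "x / omega\<^sup>2 = omega * x" for x
      by (metis mult.commute mult_1 times_divide_eq_left)+
    show "1 + N p c2 + omega\<^sup>2 * (N p c3 + N p c4) + omega * (N p c5 + N p c6) = 0"
      using had_orth[OF H p(2)] by (simp add: cols_sum[OF c] one u w algebra_simps)
  qed
  \<comment> \<open>For the four remaining rows, \<open>m p\<close> is the only column besides
    \<open>c1\<close> with the entry 1; it serves to name them.\<close>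
  define m where "m p = (if N p c3 = 1 then c3 else if N p c4 = 1 then c4 else if N p c5 = 1 then c5 else c6)" for p
  have N1: "N p (m p) = 1" if "p \<noteq> r1" "p \<noteq> r2" for p
    using row[OF that] by (auto simp: m_def)
  \<comment> \<open>Two rows with the same \<open>m\<close> would agree in \<open>c1\<close>,
    \<open>c2\<close> and that column, against \<open>type3_no_triple\<close>.\<close>
  have "inj_on m (- {r1, r2})"
  proof (rule inj_onI, rule ccontr)
    fix p q
    assume pq: "p \<in> - {r1, r2}" "q \<in> - {r1, r2}" "m p = m q" "p \<noteq> q"
    have e: "N p (m p) = 1" "N q (m p) = 1"
      using N1[of p] pq(1) N1[of q] pq(2) unfolding pq(3) by auto
    have "m p \<noteq> c1" "m p \<noteq> c2" using D by (auto simp: m_def)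
    moreover have "N p c2 = N q c2"
      using row[of p] row[of q] pq(1,2) e D by (auto simp: m_def split: if_splits)
    ultimately show False
      using no3[OF pq(4), of c1 c2 "m p"] D e nz by (simp add: one)
  qed
  moreover have "m ` (- {r1, r2}) \<subseteq> {c3, c4, c5, c6}" by (auto simp: m_def)
  moreover have "card {c3, c4, c5, c6} = 4" using D by auto
  ultimately have im: "m ` (- {r1, r2}) = {c3, c4, c5, c6}"
    using card_remaining_rows[OF r] by (metis card_image card_subset_eq finite)
  have ex: "\<exists>p. p \<noteq> r1 \<and> p \<noteq> r2 \<and> m p = x" if "x \<in> {c3, c4, c5, c6}" for x
    using that unfolding im[symmetric] by auto
  obtain p3 p4 p5 p6 where p: "p3 \<noteq> r1" "p3 \<noteq> r2" "m p3 = c3" "p4 \<noteq> r1" "p4 \<noteq> r2" "m p4 = c4"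
    "p5 \<noteq> r1" "p5 \<noteq> r2" "m p5 = c5" "p6 \<noteq> r1" "p6 \<noteq> r2" "m p6 = c6"
    using ex[of c3] ex[of c4] ex[of c5] ex[of c6] by auto
  have P: "cols r1 r2 p3 p4 p5 p6" using p r D by (auto simp: cols_def)
  have v3: "N p3 c2 = omega" "N p3 c3 = 1" "N p3 c4 = omega\<^sup>2" "N p3 c5 = omega\<^sup>2 \<and> N p3 c6 = omega \<or> N p3 c5 = omega \<and> N p3 c6 = omega\<^sup>2"
    using row[OF p(1,2)] N1[OF p(1,2)] unfolding p by auto
  have v4: "N p4 c2 = omega" "N p4 c3 = omega\<^sup>2" "N p4 c4 = 1" "N p4 c5 = omega\<^sup>2 \<and> N p4 c6 = omega \<or> N p4 c5 = omega \<and> N p4 c6 = omega\<^sup>2"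
    using row[OF p(4,5)] N1[OF p(4,5)] unfolding p by auto
  have v5: "N p5 c2 = omega\<^sup>2" "N p5 c5 = 1" "N p5 c6 = omega" "N p5 c3 = omega\<^sup>2 \<and> N p5 c4 = omega \<or> N p5 c3 = omega \<and> N p5 c4 = omega\<^sup>2"
    using row[OF p(7,8)] N1[OF p(7,8)] unfolding p by auto
  have v6: "N p6 c2 = omega\<^sup>2" "N p6 c5 = omega" "N p6 c6 = 1" "N p6 c3 = omega\<^sup>2 \<and> N p6 c4 = omega \<or> N p6 c3 = omega \<and> N p6 c4 = omega\<^sup>2"
    using row[OF p(10,11)] N1[OF p(10,11)] unfolding p by auto
  have w: "omega\<^sup>2 / omega = omega" "1 / omega = omega\<^sup>2" "1 / omega\<^sup>2 = omega" "omega / omega\<^sup>2 = omega\<^sup>2"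
    by (simp_all add: field_simps) (simp_all add: omega_simps eval_nat_numeral)
  have ne: "p3 \<noteq> p4" "p3 \<noteq> p5" "p3 \<noteq> p6" using P by (auto simp: cols_def)
  \<comment> \<open>Once the open choice in row \<open>p3\<close> is fixed, the wrong alternative in
    each other row would repeat a quotient by \<open>p3\<close> three times. The other choice for
    \<open>p3\<close> is reduced to this one by exchanging \<open>c5\<close> with \<open>c6\<close>
    and \<open>p5\<close> with \<open>p6\<close>.\<close>
  have fin: ?thesis if P: "cols r1 r2 p3 p4 p5 p6" and c: "cols c1 c2 c3 c4 c5 c6"
    and ne: "p3 \<noteq> p4" "p3 \<noteq> p5" "p3 \<noteq> p6"
    and u: "N r2 c2 = 1" "N r2 c3 = omega" "N r2 c4 = omega" "N r2 c5 = omega\<^sup>2" "N r2 c6 = omega\<^sup>2"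
    and v3: "N p3 c2 = omega" "N p3 c3 = 1" "N p3 c4 = omega\<^sup>2" "N p3 c5 = omega\<^sup>2" "N p3 c6 = omega"
    and v4: "N p4 c2 = omega" "N p4 c3 = omega\<^sup>2" "N p4 c4 = 1" "N p4 c5 = omega\<^sup>2 \<and> N p4 c6 = omega \<or> N p4 c5 = omega \<and> N p4 c6 = omega\<^sup>2"
    and v5: "N p5 c2 = omega\<^sup>2" "N p5 c5 = 1" "N p5 c6 = omega" "N p5 c3 = omega\<^sup>2 \<and> N p5 c4 = omega \<or> N p5 c3 = omega \<and> N p5 c4 = omega\<^sup>2"
    and v6: "N p6 c2 = omega\<^sup>2" "N p6 c5 = omega" "N p6 c6 = 1" "N p6 c3 = omega\<^sup>2 \<and> N p6 c4 = omega \<or> N p6 c3 = omega \<and> N p6 c4 = omega\<^sup>2"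
    for p5 p6 c5 c6
  proof -
    have D: "distinct [c1, c2, c3, c4, c5, c6]" using c by (simp add: cols_def)
    have "N p4 c5 = omega \<and> N p4 c6 = omega\<^sup>2"
      using no3[OF ne(1), of c1 c2 c5] D v3 v4 by (auto simp: one)
    moreover have "N p5 c3 = omega\<^sup>2 \<and> N p5 c4 = omega"
      using no3[OF ne(2), of c1 c4 c6] D v3 v5 by (auto simp: one)
    moreover have "N p6 c3 = omega \<and> N p6 c4 = omega\<^sup>2"
      using no3[OF ne(3), of c3 c4 c5] D v3 v6 by (auto simp: one w)
    ultimately show ?thesis
      by (intro has_formI[OF P c H]) (use u v3 v4 v5 v6 in \<open>simp add: tao_matrix_def Let_def one\<close>)
  qed
  from v3(4) show ?thesis
  proof (elim disjE conjE)
    assume "N p3 c5 = omega\<^sup>2" "N p3 c6 = omega"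
    then show ?thesis by (rule fin[OF P c ne u v3(1-3) _ _ v4 v5 v6])
  next
    assume h: "N p3 c5 = omega" "N p3 c6 = omega\<^sup>2"
    have c': "cols c1 c2 c3 c4 c6 c5" "cols r1 r2 p3 p4 p6 p5" using c P by (auto simp: cols_def)
    show ?thesis
      by (rule fin[OF c'(2,1) ne(1,3,2) u(1-3,5,4) v3(1-3) h(2,1) v4(1-3) _ v6(1,3,2,4) v5(1,3,2,4)])
        (use v4(4) in blast)
  qed
qed

text \<open>As all cubes agree, the two 3-cycles of a quotient run through the same three values;
  matching equal values produces the column pairs of the second Tao row.\<close>

lemma all_type3_tao:
  assumes H: "had H" and t3: "\<And>p q. p \<noteq> q \<Longrightarrow> type3 (rel H p q)"
  shows "has_form H tao_matrix"
proof -
  let ?f = "rel H 2 1"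
  have r: "(1::6) \<noteq> 2" by simp
  obtain d1 d2 d3 d4 d5 d6 where d: "cols d1 d2 d3 d4 d5 d6" "?f d2 = omega * ?f d1"
      "?f d3 = omega\<^sup>2 * ?f d1" "?f d5 = omega * ?f d4" "?f d6 = omega\<^sup>2 * ?f d4"
    using t3[OF r[symmetric]] unfolding type3_def by (elim exE conjE) (rule that)
  have "?f d1 ^ 3 = ?f d4 ^ 3"
    using all_type3_pure[OF H t3, of 2 1] unfolding pure_def by blast
  then have "?f d4 = ?f d1 \<or> ?f d4 = omega * ?f d1 \<or> ?f d4 = omega\<^sup>2 * ?f d1"
    by (intro cube_root_cases) simp
  then obtain e4 e5 e6 where e: "cols d1 e4 d2 e5 d3 e6" "?f e4 = ?f d1" "?f e5 = omega * ?f d1" "?f e6 = omega\<^sup>2 * ?f d1"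
  proof (elim disjE)
    assume h: "?f d4 = ?f d1"
    have "cols d1 d4 d2 d5 d3 d6" using d(1) by (auto simp: cols_def)
    then show thesis by (rule that) (simp_all only: d h)
  next
    assume h: "?f d4 = omega * ?f d1"
    have "cols d1 d6 d2 d4 d3 d5" using d(1) by (auto simp: cols_def)
    then show thesis by (rule that) (simp_all add: d h omega_simps)
  next
    assume h: "?f d4 = omega\<^sup>2 * ?f d1"
    have "cols d1 d5 d2 d6 d3 d4" using d(1) by (auto simp: cols_def)
    then show thesis by (rule that) (simp_all add: d h omega_simps)
  qed
  define N where "N = (\<lambda>p c. rel H p 1 c / rel H p 1 d1)"
  note n = normalize_row_col[OF H, where r = 1 and ?c0.0 = d1, folded N_def]
  have nz: "rel H p q c \<noteq> 0" for p q c by (rule rel_nonzero[OF H])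
  have one: "N 1 c = 1" "N p d1 = 1" for p c
    using n(2,3) by (simp_all add: N_def)
  show ?thesis
  proof (rule n(4), rule tao_normalized[OF n(1) _ r one _ e(1)])
    show "type3 (rel N p q)" if "p \<noteq> q" for p q
      by (rule type3_cong[where \<kappa> = "1 / rel H p q d1", OF t3[OF that] bij_id]) (simp add: n(5))
    show "N p c ^ 3 = 1" for p c
      using all_type3_pure[OF H t3, of p 1] nz unfolding pure_def N_def power_divide by simp
  qed (use e d nz in \<open>simp_all add: N_def\<close>)
qed

section \<open>Only two-cycles: the Haagerup matrices\<close>

lemma involution_four:
  assumes "\<And>c. \<rho> c \<noteq> c" "\<And>c. \<rho> (\<rho> c) = c" "distinct [a, b, c, d]"
    and "\<rho> a \<in> {a, b, c, d}" "\<rho> b \<in> {a, b, c, d}" "\<rho> c \<in> {a, b, c, d}"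
  shows "\<rho> a = b \<and> \<rho> c = d \<or> \<rho> a = c \<and> \<rho> b = d \<or> \<rho> a = d \<and> \<rho> b = c"
proof -
  have "\<rho> a = b \<or> \<rho> a = c \<or> \<rho> a = d" using assms(1,4) by blast
  then show ?thesis
  proof (elim disjE)
    assume h: "\<rho> a = b"
    then have "\<rho> c \<noteq> a" "\<rho> c \<noteq> b" using assms(2,3) by (metis distinct_length_2_or_more)+
    then show ?thesis using h assms(1,6) by blast
  next
    assume h: "\<rho> a = c"
    then have "\<rho> b \<noteq> a" "\<rho> b \<noteq> c" using assms(2,3) by (metis distinct_length_2_or_more)+
    then show ?thesis using h assms(1,5) by blast
  next
    assume h: "\<rho> a = d"
    then have "\<rho> b \<noteq> a" "\<rho> b \<noteq> d" using assms(2,3) by (metis distinct_length_2_or_more)+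
    then show ?thesis using h assms(1,5) by blast
  qed
qed

text \<open>These are the fifteen perfect matchings: five partners for \<open>c1\<close> times three
  matchings of the other four columns. Writing them out opens each case to polynomial
  arithmetic.\<close>

lemma type2_pairings:
  assumes "type2 f" "cols c1 c2 c3 c4 c5 c6"
  shows "f c2 = - f c1 \<and> f c4 = - f c3 \<and> f c6 = - f c5 \<or>
    f c2 = - f c1 \<and> f c5 = - f c3 \<and> f c6 = - f c4 \<or>
    f c2 = - f c1 \<and> f c6 = - f c3 \<and> f c5 = - f c4 \<or>
    f c3 = - f c1 \<and> f c4 = - f c2 \<and> f c6 = - f c5 \<or>
    f c3 = - f c1 \<and> f c5 = - f c2 \<and> f c6 = - f c4 \<or>
    f c3 = - f c1 \<and> f c6 = - f c2 \<and> f c5 = - f c4 \<or>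
    f c4 = - f c1 \<and> f c3 = - f c2 \<and> f c6 = - f c5 \<or>
    f c4 = - f c1 \<and> f c5 = - f c2 \<and> f c6 = - f c3 \<or>
    f c4 = - f c1 \<and> f c6 = - f c2 \<and> f c5 = - f c3 \<or>
    f c5 = - f c1 \<and> f c3 = - f c2 \<and> f c6 = - f c4 \<or>
    f c5 = - f c1 \<and> f c4 = - f c2 \<and> f c6 = - f c3 \<or>
    f c5 = - f c1 \<and> f c6 = - f c2 \<and> f c4 = - f c3 \<or>
    f c6 = - f c1 \<and> f c3 = - f c2 \<and> f c5 = - f c4 \<or>
    f c6 = - f c1 \<and> f c4 = - f c2 \<and> f c5 = - f c3 \<or>
    f c6 = - f c1 \<and> f c5 = - f c2 \<and> f c4 = - f c3"
proof -
  obtain \<rho> where \<rho>: "\<And>c. \<rho> c \<noteq> c" "\<And>c. \<rho> (\<rho> c) = c" "\<And>c. f (\<rho> c) = - f c"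
    using type2_involution[OF assms(1)] by blast
  have P: "f b = - f a" if "\<rho> a = b" for a b using \<rho>(3)[of a] that by simp
  have rest: "\<rho> b = c \<and> \<rho> d = e \<or> \<rho> b = d \<and> \<rho> c = e \<or> \<rho> b = e \<and> \<rho> c = d"
    if "\<rho> c1 = a" "cols c1 a b c d e" for a b c d e
  proof (rule involution_four[OF \<rho>(1,2)])
    have "\<rho> x \<noteq> c1 \<and> \<rho> x \<noteq> a" if "x \<in> {b, c, d, e}" for x
      using that \<open>\<rho> c1 = a\<close> \<open>cols c1 a b c d e\<close> \<rho>(2) unfolding cols_def
      by (metis distinct_length_2_or_more empty_iff insert_iff)
    then show "\<rho> b \<in> {b, c, d, e}" "\<rho> c \<in> {b, c, d, e}" "\<rho> d \<in> {b, c, d, e}"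
      using cols_cases[OF that(2)] by blast+
    show "distinct [b, c, d, e]" using that(2) by (auto simp: cols_def)
  qed
  have o: "cols c1 c3 c2 c4 c5 c6" "cols c1 c4 c2 c3 c5 c6" "cols c1 c5 c2 c3 c4 c6" "cols c1 c6 c2 c3 c4 c5"
    using assms(2) by (auto simp: cols_def)
  have "\<rho> c1 = c2 \<or> \<rho> c1 = c3 \<or> \<rho> c1 = c4 \<or> \<rho> c1 = c5 \<or> \<rho> c1 = c6"
    using cols_cases[OF assms(2), of "\<rho> c1"] \<rho>(1) by blast
  then show ?thesis
  proof (elim disjE)
    assume h: "\<rho> c1 = c2"
    from rest[OF h assms(2)] have "f c4 = - f c3 \<and> f c6 = - f c5 \<or> f c5 = - f c3 \<and> f c6 = - f c4 \<or> f c6 = - f c3 \<and> f c5 = - f c4"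
      using P by metis
    then show ?thesis
      using P[OF h] by (elim disjE conjE) simp_all
  next
    assume h: "\<rho> c1 = c3"
    from rest[OF h o(1)] have "f c4 = - f c2 \<and> f c6 = - f c5 \<or> f c5 = - f c2 \<and> f c6 = - f c4 \<or> f c6 = - f c2 \<and> f c5 = - f c4"
      using P by metis
    then show ?thesis
      using P[OF h] by (elim disjE conjE) simp_all
  next
    assume h: "\<rho> c1 = c4"
    from rest[OF h o(2)] have "f c3 = - f c2 \<and> f c6 = - f c5 \<or> f c5 = - f c2 \<and> f c6 = - f c3 \<or> f c6 = - f c2 \<and> f c5 = - f c3"
      using P by metis
    then show ?thesis
      using P[OF h] by (elim disjE conjE) simp_all
  next
    assume h: "\<rho> c1 = c5"
    from rest[OF h o(3)] have "f c3 = - f c2 \<and> f c6 = - f c4 \<or> f c4 = - f c2 \<and> f c6 = - f c3 \<or> f c6 = - f c2 \<and> f c4 = - f c3"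
      using P by metis
    then show ?thesis
      using P[OF h] by (elim disjE conjE) simp_all
  next
    assume h: "\<rho> c1 = c6"
    from rest[OF h o(4)] have "f c3 = - f c2 \<and> f c5 = - f c4 \<or> f c4 = - f c2 \<and> f c5 = - f c3 \<or> f c5 = - f c2 \<and> f c4 = - f c3"
      using P by metis
    then show ?thesis
      using P[OF h] by (elim disjE conjE) simp_all
  qed
qed

section \<open>Quarter turns in every quotient\<close>

definition quartered :: "(6 \<Rightarrow> complex) \<Rightarrow> bool" where
  "quartered f \<longleftrightarrow> (\<exists>c1 c2 c3 c4 c5 c6. cols c1 c2 c3 c4 c5 c6 \<and>
     f c2 = - f c1 \<and> f c3 = \<i> * f c1 \<and> f c4 = - \<i> * f c1 \<and> f c6 = - f c5)"

lemma quarteredI: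
  assumes c: "cols c1 c2 c3 c4 c5 c6" "f c2 = - f c1" "f c4 = - f c3" "f c6 = - f c5"
    and "(f c1)\<^sup>2 + (f c3)\<^sup>2 = 0"
  shows "quartered f"
proof -
  have "(f c3 - \<i> * f c1) * (f c3 + \<i> * f c1) = 0"
    using assms(5) by (simp add: algebra_simps power2_eq_square)
  then have "f c3 = \<i> * f c1 \<or> f c3 = - (\<i> * f c1)" by (auto simp: add_eq_0_iff2)
  then show ?thesis
  proof
    assume "f c3 = \<i> * f c1"
    then show ?thesis unfolding quartered_def using c
      by (intro exI[of _ c1] exI[of _ c2] exI[of _ c3] exI[of _ c4] exI[of _ c5] exI[of _ c6]) simp
  next
    assume h: "f c3 = - (\<i> * f c1)"
    have "cols c1 c2 c4 c3 c5 c6" using c(1) by (auto simp: cols_def)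
    then show ?thesis unfolding quartered_def using c h
      by (intro exI[of _ c1] exI[of _ c2] exI[of _ c4] exI[of _ c3] exI[of _ c5] exI[of _ c6]) simp
  qed
qed

lemma quartered_of_product:
  assumes c: "cols c1 c2 c3 c4 c5 c6" "f c2 = - f c1" "f c4 = - f c3" "f c6 = - f c5"
    and "((f c1)\<^sup>2 + (f c3)\<^sup>2) * ((f c1)\<^sup>2 + (f c5)\<^sup>2) * ((f c3)\<^sup>2 + (f c5)\<^sup>2) = 0"
  shows "quartered f"
proof -
  have "cols c1 c2 c5 c6 c3 c4" "cols c3 c4 c5 c6 c1 c2" using c(1) by (auto simp: cols_def)
  then show ?thesis
    using assms quarteredI[of c1 c2 c3 c4 c5 c6 f] quarteredI[of c1 c2 c5 c6 c3 c4 f] quarteredI[of c3 c4 c5 c6 c1 c2 f] by auto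
qed

lemma quotient_neg:
  fixes a b c d :: complex
  assumes "c \<noteq> 0" "d \<noteq> 0"
  shows "a / c = - (b / d) \<longleftrightarrow> a * d + b * c = 0"
  using assms by (simp add: field_simps eq_neg_iff_add_eq_0)

text \<open>The pairings of \<open>f\<close> and \<open>g\<close> together form a hexagon. For each
  of the fifteen pairings of \<open>g / f\<close>, clearing denominators leaves three polynomial
  equations in the six values, which make the product of the three sums of squares vanish.\<close>

lemma triple_hexagon:
  fixes a b d x y z :: complex
  assumes c: "cols c1 c2 c3 c4 c5 c6" and k: "type2 (\<lambda>c. g c / f c)"
    and f: "f c1 = a" "f c2 = - a" "f c3 = b" "f c4 = - b" "f c5 = d" "f c6 = - d"
    and g: "g c1 = x" "g c6 = - x" "g c2 = y" "g c3 = - y" "g c4 = z" "g c5 = - z"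
    and nz: "\<And>c. f c \<noteq> 0" "\<And>c. g c \<noteq> 0"
  shows "quartered f"
proof (rule quartered_of_product[OF c])
  have "a * b * d * x * y * z * ((a\<^sup>2 + b\<^sup>2) * (a\<^sup>2 + d\<^sup>2) * (b\<^sup>2 + d\<^sup>2)) = 0"
    using type2_pairings[OF k c, unfolded quotient_neg[OF nz(1) nz(1)]] unfolding f g
    by (elim disjE conjE; algebra)
  moreover have "a * b * d * x * y * z \<noteq> 0"
    using nz(1)[of c1] nz(1)[of c3] nz(1)[of c5] nz(2)[of c1] nz(2)[of c2] nz(2)[of c4] unfolding f g by simp
  ultimately show "((f c1)\<^sup>2 + (f c3)\<^sup>2) * ((f c1)\<^sup>2 + (f c5)\<^sup>2) * ((f c3)\<^sup>2 + (f c5)\<^sup>2) = 0"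
    unfolding f by (simp only: mult_eq_0_iff simp_thms)
qed (simp_all add: f)

text \<open>Here \<open>f\<close> and \<open>g\<close> share one pair and cross on the other four
  columns; the same elimination gives the single factor
  \<open>b\<^sup>2 + d\<^sup>2\<close>.\<close>

lemma triple_shared:
  fixes a b d x y z :: complex
  assumes c: "cols c1 c2 c3 c4 c5 c6" and k: "type2 (\<lambda>c. g c / f c)"
    and f: "f c1 = a" "f c2 = - a" "f c3 = b" "f c4 = - b" "f c5 = d" "f c6 = - d"
    and g: "g c1 = x" "g c2 = - x" "g c3 = y" "g c5 = - y" "g c4 = z" "g c6 = - z"
    and nz: "\<And>c. f c \<noteq> 0" "\<And>c. g c \<noteq> 0"
  shows "quartered f"
proof (rule quartered_of_product[OF c])
  have "a * b * d * x * y * z * (b\<^sup>2 + d\<^sup>2) = 0"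
    using type2_pairings[OF k c, unfolded quotient_neg[OF nz(1) nz(1)]] unfolding f g
    by (elim disjE conjE; algebra)
  moreover have "a * b * d * x * y * z \<noteq> 0"
    using nz(1)[of c1] nz(1)[of c3] nz(1)[of c5] nz(2)[of c1] nz(2)[of c3] nz(2)[of c4] unfolding f g by simp
  ultimately show "((f c1)\<^sup>2 + (f c3)\<^sup>2) * ((f c1)\<^sup>2 + (f c5)\<^sup>2) * ((f c3)\<^sup>2 + (f c5)\<^sup>2) = 0"
    unfolding f by (simp only: mult_eq_0_iff simp_thms)
qed (simp_all add: f)

text \<open>This is the quotient of two functions with the same pairing: it is constant on the
  pairs, and its three unit values sum to zero.\<close>

lemma shared_pairing_type3:
  assumes c: "cols c1 c2 c3 c4 c5 c6" and k: "type2 k" "k c2 = k c1" "k c4 = k c3" "k c6 = k c5" "\<And>c. norm (k c) = 1"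
  shows "type3 k"
proof -
  have "2 * (k c1 + k c3 + k c5) = 0"
    using type2_sum[OF k(1)] by (simp add: cols_sum[OF c] k(2-4) algebra_simps)
  then have "k c1 + k c3 + k c5 = 0" unfolding mult_eq_0_iff by simp
  from three_units_sum_zero[OF k(5) k(5) k(5) this] show ?thesis
  proof (elim disjE conjE)
    assume h: "k c3 = omega * k c1" "k c5 = omega\<^sup>2 * k c1"
    have "cols c1 c3 c5 c2 c4 c6" using c by (auto simp: cols_def)
    then show ?thesis by (rule type3I) (simp_all add: k(2-4) h)
  next
    assume h: "k c3 = omega\<^sup>2 * k c1" "k c5 = omega * k c1"
    have "cols c1 c5 c3 c2 c6 c4" using c by (auto simp: cols_def)
    then show ?thesis by (rule type3I) (simp_all add: k(2-4) h)
  qed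
qed

text \<open>The pairing of \<open>g\<close> equals that of \<open>f\<close>, shares exactly one pair
  with it, or forms a hexagon with it: 1, 6 and 8 of the fifteen cases. The first would give
  \<open>g / f\<close> type 3.\<close>

lemma type2_triple_quartered:
  assumes f: "type2 f" and g: "type2 g" and k: "type2 (\<lambda>c. g c / f c)" "\<not> type3 (\<lambda>c. g c / f c)"
    and n: "\<And>c. norm (f c) = 1" "\<And>c. norm (g c) = 1"
  shows "quartered f"
proof -
  have nz: "f c \<noteq> 0" "g c \<noteq> 0" for c using n[of c] by auto
  obtain c1 c2 c3 c4 c5 c6 where c: "cols c1 c2 c3 c4 c5 c6" "f c2 = - f c1" "f c4 = - f c3" "f c6 = - f c5"
    using f unfolding type2_def by (elim exE conjE) (rule that)
  have shared: "quartered f" if "cols e1 e2 e3 e4 e5 e6" "f e2 = - f e1" "f e4 = - f e3" "f e6 = - f e5"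
    "g e2 = - g e1" "g e5 = - g e3" "g e6 = - g e4" for e1 e2 e3 e4 e5 e6
    by (rule triple_shared[OF that(1) k(1) refl that(2) refl that(3) refl that(4) refl that(5) refl that(6) refl that(7) nz])
  have hexagon: "quartered f" if "cols e1 e2 e3 e4 e5 e6" "f e2 = - f e1" "f e4 = - f e3" "f e6 = - f e5"
    "g e6 = - g e1" "g e3 = - g e2" "g e5 = - g e4" for e1 e2 e3 e4 e5 e6
    by (rule triple_hexagon[OF that(1) k(1) refl that(2) refl that(3) refl that(4) refl that(5) refl that(6) refl that(7) nz])
  from type2_pairings[OF g c(1)] show ?thesis
  proof (elim disjE conjE)
    assume h: "g c2 = - g c1" "g c4 = - g c3" "g c6 = - g c5"
    have "type3 (\<lambda>c. g c / f c)"
      by (rule shared_pairing_type3[OF c(1) k(1)]) (simp_all add: c h nz norm_divide n)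
    then show ?thesis using k(2) by blast
  next
    assume h: "g c2 = - g c1" "g c5 = - g c3" "g c6 = - g c4"
    have "cols c1 c2 c3 c4 c5 c6" using c(1) by (auto simp: cols_def)
    then show ?thesis by (rule shared) (simp_all add: c h)
  next
    assume h: "g c2 = - g c1" "g c6 = - g c3" "g c5 = - g c4"
    have "cols c1 c2 c3 c4 c6 c5" using c(1) by (auto simp: cols_def)
    then show ?thesis by (rule shared) (simp_all add: c h)
  next
    assume h: "g c3 = - g c1" "g c4 = - g c2" "g c6 = - g c5"
    have "cols c5 c6 c1 c2 c3 c4" using c(1) by (auto simp: cols_def)
    then show ?thesis by (rule shared) (simp_all add: c h)
  next
    assume h: "g c3 = - g c1" "g c5 = - g c2" "g c6 = - g c4"
    have "cols c1 c2 c5 c6 c4 c3" using c(1) by (auto simp: cols_def)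
    then show ?thesis by (rule hexagon) (simp_all add: c h)
  next
    assume h: "g c3 = - g c1" "g c6 = - g c2" "g c5 = - g c4"
    have "cols c1 c2 c6 c5 c4 c3" using c(1) by (auto simp: cols_def)
    then show ?thesis by (rule hexagon) (simp_all add: c h)
  next
    assume h: "g c4 = - g c1" "g c3 = - g c2" "g c6 = - g c5"
    have "cols c5 c6 c1 c2 c4 c3" using c(1) by (auto simp: cols_def)
    then show ?thesis by (rule shared) (simp_all add: c h)
  next
    assume h: "g c4 = - g c1" "g c5 = - g c2" "g c6 = - g c3"
    have "cols c1 c2 c5 c6 c3 c4" using c(1) by (auto simp: cols_def)
    then show ?thesis by (rule hexagon) (simp_all add: c h)
  next
    assume h: "g c4 = - g c1" "g c6 = - g c2" "g c5 = - g c3"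
    have "cols c1 c2 c6 c5 c3 c4" using c(1) by (auto simp: cols_def)
    then show ?thesis by (rule hexagon) (simp_all add: c h)
  next
    assume h: "g c5 = - g c1" "g c3 = - g c2" "g c6 = - g c4"
    have "cols c1 c2 c3 c4 c6 c5" using c(1) by (auto simp: cols_def)
    then show ?thesis by (rule hexagon) (simp_all add: c h)
  next
    assume h: "g c5 = - g c1" "g c4 = - g c2" "g c6 = - g c3"
    have "cols c1 c2 c4 c3 c6 c5" using c(1) by (auto simp: cols_def)
    then show ?thesis by (rule hexagon) (simp_all add: c h)
  next
    assume h: "g c5 = - g c1" "g c6 = - g c2" "g c4 = - g c3"
    have "cols c3 c4 c1 c2 c5 c6" using c(1) by (auto simp: cols_def)
    then show ?thesis by (rule shared) (simp_all add: c h)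
  next
    assume h: "g c6 = - g c1" "g c3 = - g c2" "g c5 = - g c4"
    have "cols c1 c2 c3 c4 c5 c6" using c(1) by (auto simp: cols_def)
    then show ?thesis by (rule hexagon) (simp_all add: c h)
  next
    assume h: "g c6 = - g c1" "g c4 = - g c2" "g c5 = - g c3"
    have "cols c1 c2 c4 c3 c5 c6" using c(1) by (auto simp: cols_def)
    then show ?thesis by (rule hexagon) (simp_all add: c h)
  next
    assume h: "g c6 = - g c1" "g c5 = - g c2" "g c4 = - g c3"
    have "cols c3 c4 c1 c2 c6 c5" using c(1) by (auto simp: cols_def)
    then show ?thesis by (rule shared) (simp_all add: c h)
  qed
qed

text \<open>The four shapes of the last four rows of \<open>haagerup_matrix q\<close> after the
  leading 1. The entries that contain \<open>q\<close> are left free up to the sign relation within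
  a row; only the comparison of rows ties them to one another.\<close>

definition haagerup_row :: "complex \<Rightarrow> complex \<Rightarrow> complex \<Rightarrow> complex \<Rightarrow> complex \<Rightarrow> bool" where
  "haagerup_row v2 v3 v4 v5 v6 \<longleftrightarrow>
     v2 = \<i> \<and> (v3 = - 1 \<and> v4 = - \<i> \<or> v3 = - \<i> \<and> v4 = - 1) \<and> v6 = - v5 \<or>
     v2 = - \<i> \<and> v4 = - v3 \<and> (v5 = \<i> \<and> v6 = - 1 \<or> v5 = - 1 \<and> v6 = \<i>)"

lemma imaginary_neq: "\<i> \<noteq> - \<i>" "- \<i> \<noteq> \<i>" "(1::complex) \<noteq> - 1" "\<i> \<noteq> - 1" "- 1 \<noteq> \<i>" "- \<i> \<noteq> - 1" "- 1 \<noteq> - \<i>" "- \<i> \<noteq> 1" "1 \<noteq> - \<i>"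
  by (simp_all add: complex_eq_iff)

lemma haagerup_normalized:
  assumes H: "had N" and r: "r1 \<noteq> r2" and one: "\<And>c. N r1 c = 1" "\<And>p. N p c1 = 1"
    and c: "cols c1 c2 c3 c4 c5 c6"
    and u: "N r2 c2 = - 1" "N r2 c3 = \<i>" "N r2 c4 = \<i>" "N r2 c5 = - \<i>" "N r2 c6 = - \<i>"
    and row: "\<And>p. p \<noteq> r1 \<Longrightarrow> p \<noteq> r2 \<Longrightarrow> haagerup_row (N p c2) (N p c3) (N p c4) (N p c5) (N p c6)"
  shows "\<exists>q. norm q = 1 \<and> has_form N (haagerup_matrix q)"
proof -
  have nz: "N p c \<noteq> 0" for p c by (rule had_nonzero[OF H])
  have nm: "norm (N p c) = 1" for p c by (rule had_norm[OF H])
  have D: "distinct [c1, c2, c3, c4, c5, c6]" using c by (simp add: cols_def)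
  \<comment> \<open>\<open>m p\<close> encodes the shape of row \<open>p\<close> by its diagonal
    position in \<open>haagerup_matrix\<close>. The entry in \<open>c2\<close> is tested first
    because a free entry may be \<open>- 1\<close> as well.\<close>
  define m where "m p = (if N p c2 = \<i> then (if N p c3 = - 1 then c3 else c4) else (if N p c6 = - 1 then c5 else c6))" for p
  have no: False if "x = (- 4 :: complex)" "x = 2 * e" "norm e = 1" for x e
    using that norm_mult[of 2 e] by simp
  have sum0: "1 + N p c2 / N q c2 + N p c3 / N q c3 + N p c4 / N q c4 + N p c5 / N q c5 + N p c6 / N q c6 = 0" if "p \<noteq> q" for p q
    using had_orth[OF H that] by (simp add: cols_sum[OF c] one)
  \<comment> \<open>Two rows of the same shape agree in four columns, and each has opposite entries
    in the other two, so their orthogonality sum is \<open>4 + 2 * e\<close> with \<open>e\<close>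
    of modulus 1.\<close>
  have six: False if "p \<noteq> q" "N p c2 = N q c2" "N p a = N q a" "N p b = N q b" "N p d' = - N p d" "N q d' = - N q d"
    "{a, b, d, d'} = {c3, c4, c5, c6}" "distinct [a, b, d, d']" for p q a b d d'
  proof -
    have "c1 \<notin> {a, b, d, d'}" "c2 \<notin> {a, b, d, d'}" unfolding that(7) using D by auto
    then have "cols c1 c2 a b d d'" using D that(8) by (auto simp: cols_def)
    from cols_sum[OF this, of "\<lambda>c. N p c / N q c"] have "4 + 2 * (N p d / N q d) = 0"
      using had_orth[OF H that(1)] by (simp add: that(2-6) nz one add_ac)
    then have "2 * (N p d / N q d) = - 4" by (simp add: add_eq_0_iff algebra_simps)
    moreover have "norm (N p d / N q d) = 1" by (simp add: norm_divide nm)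
    ultimately show False using no by metis
  qed
  have "inj_on m (- {r1, r2})"
  proof (rule inj_onI, rule ccontr)
    fix p q
    assume pq: "p \<in> - {r1, r2}" "q \<in> - {r1, r2}" "m p = m q" "p \<noteq> q"
    have rp: "haagerup_row (N p c2) (N p c3) (N p c4) (N p c5) (N p c6)"
         "haagerup_row (N q c2) (N q c3) (N q c4) (N q c5) (N q c6)"
      using row pq(1,2) by auto
    have e: "N p c2 = N q c2 \<and> (N p c3 = N q c3 \<and> N p c4 = N q c4 \<and> N p c6 = - N p c5 \<and> N q c6 = - N q c5
       \<or> N p c5 = N q c5 \<and> N p c6 = N q c6 \<and> N p c4 = - N p c3 \<and> N q c4 = - N q c3)"
      using rp pq(3) D imaginary_neq unfolding haagerup_row_def m_def
      by (elim disjE conjE) (simp_all split: if_splits)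
    have "distinct [c3, c4, c5, c6]" "distinct [c5, c6, c3, c4]" "{c5, c6, c3, c4} = {c3, c4, c5, c6}"
      using D by auto
    then show False
      using e six[OF pq(4), where a = c3 and b = c4 and d = c5 and d' = c6]
        six[OF pq(4), where a = c5 and b = c6 and d = c3 and d' = c4] by metis
  qed
  moreover have "m ` (- {r1, r2}) \<subseteq> {c3, c4, c5, c6}" by (auto simp: m_def)
  moreover have "card {c3, c4, c5, c6} = 4" using D by auto
  ultimately have im: "m ` (- {r1, r2}) = {c3, c4, c5, c6}"
    using card_remaining_rows[OF r] by (metis card_image card_subset_eq finite)
  have ex: "\<exists>p. p \<noteq> r1 \<and> p \<noteq> r2 \<and> m p = x" if "x \<in> {c3, c4, c5, c6}" for x
    using that unfolding im[symmetric] by auto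
  obtain p3 p4 p5 p6 where p: "p3 \<noteq> r1" "p3 \<noteq> r2" "m p3 = c3" "p4 \<noteq> r1" "p4 \<noteq> r2" "m p4 = c4"
    "p5 \<noteq> r1" "p5 \<noteq> r2" "m p5 = c5" "p6 \<noteq> r1" "p6 \<noteq> r2" "m p6 = c6"
    using ex[of c3] ex[of c4] ex[of c5] ex[of c6] by auto
  have P: "cols r1 r2 p3 p4 p5 p6" using p r D by (auto simp: cols_def)
  have ne: "p3 \<noteq> p4" "p5 \<noteq> p6" "p3 \<noteq> p5" using P by (auto simp: cols_def)
  have v3: "N p3 c2 = \<i>" "N p3 c3 = - 1" "N p3 c4 = - \<i>" "N p3 c6 = - N p3 c5"
    using row[OF p(1,2)] p(3) D imaginary_neq unfolding haagerup_row_def m_def by (auto split: if_splits)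
  have v4: "N p4 c2 = \<i>" "N p4 c3 = - \<i>" "N p4 c4 = - 1" "N p4 c6 = - N p4 c5"
    using row[OF p(4,5)] p(6) D imaginary_neq unfolding haagerup_row_def m_def by (auto split: if_splits)
  have v5: "N p5 c2 = - \<i>" "N p5 c4 = - N p5 c3" "N p5 c5 = \<i>" "N p5 c6 = - 1"
    using row[OF p(7,8)] p(9) D imaginary_neq unfolding haagerup_row_def m_def by (auto split: if_splits)
  have v6: "N p6 c2 = - \<i>" "N p6 c4 = - N p6 c3" "N p6 c5 = - 1" "N p6 c6 = \<i>"
    using row[OF p(10,11)] p(12) D imaginary_neq unfolding haagerup_row_def m_def by (auto split: if_splits)
  \<comment> \<open>Orthogonality of \<open>p3\<close> to \<open>p4\<close> and to
    \<open>p5\<close>, and of \<open>p5\<close> to \<open>p6\<close>, expresses the other free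
    entries through this one.\<close>
  define q where "q = N p3 c5"
  have q: "norm q = 1" "q \<noteq> 0" using nm nz by (simp_all add: q_def)
  have x4: "N p4 c5 = - q"
  proof -
    have "2 * (1 + q / N p4 c5) = 0"
      using sum0[OF ne(1)] unfolding v3 v4 q_def[symmetric] using nz by (simp add: algebra_simps)
    then have "1 + q / N p4 c5 = 0" unfolding mult_eq_0_iff by simp
    then show ?thesis using nz[of p4 c5] by (simp add: field_simps add_eq_0_iff2)
  qed
  have x5: "N p5 c3 = 1 / q"
  proof -
    have "(1 - \<i>) * (q - 1 / N p5 c3) = 0"
      using sum0[OF ne(3)] unfolding v3 v5 q_def[symmetric] using nz by (simp add: algebra_simps diff_divide_distrib)
    moreover have "1 - \<i> \<noteq> 0" by (simp add: complex_eq_iff)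
    ultimately have "q = 1 / N p5 c3" unfolding mult_eq_0_iff by simp
    then show ?thesis by simp
  qed
  have x6: "N p6 c3 = - (1 / q)"
  proof -
    have "2 * (1 + N p5 c3 / N p6 c3) = 0"
      using sum0[OF ne(2)] unfolding v5 v6 using nz by (simp add: algebra_simps)
    then have "1 + N p5 c3 / N p6 c3 = 0" unfolding mult_eq_0_iff by simp
    then have "N p6 c3 = - N p5 c3" using nz[of p6 c3] by (simp add: field_simps add_eq_0_iff2)
    then show ?thesis using x5 by simp
  qed
  have "has_form N (haagerup_matrix q)"
    by (rule has_formI[OF P c H])
       (simp add: haagerup_matrix_def one u v3 v4 v5 v6 x4 x5 x6 q_def[symmetric] unit_inverse[OF q(1)])
  then show ?thesis using q(1) by blast
qed

section \<open>The exceptional column pair of a quotient\<close>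

definition quartered_at :: "(6 \<Rightarrow> complex) \<Rightarrow> 6 set \<Rightarrow> bool" where
  "quartered_at f D \<longleftrightarrow> (\<exists>c1 c2 c3 c4 c5 c6. cols c1 c2 c3 c4 c5 c6 \<and> D = {c5, c6} \<and>
     f c2 = - f c1 \<and> f c3 = \<i> * f c1 \<and> f c4 = - \<i> * f c1 \<and> f c6 = - f c5)"

lemma quartered_at_exists: "quartered f \<Longrightarrow> \<exists>D. quartered_at f D"
  unfolding quartered_def quartered_at_def by metis

lemma quarter_turns_distinct:
  fixes x :: complex
  assumes "x \<noteq> 0"
  shows "distinct [x, - x, \<i> * x, - \<i> * x]"
proof -
  have "distinct (map (\<lambda>z. z * x) [1, - 1, \<i>, - \<i>])"
    unfolding distinct_map using assms by (auto simp: inj_on_def complex_eq_iff)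
  then show ?thesis by simp
qed

text \<open>The product over the complement of \<open>D\<close> is minus the fourth power because
  \<open>1, - 1, \<i>, - \<i>\<close> multiply to \<open>- 1\<close>.\<close>

lemma quartered_at_facts:
  assumes "quartered_at f D" "\<And>c. f c \<noteq> 0"
  obtains y y' where "card D = 2" "\<And>c. c \<notin> D \<Longrightarrow> f c ^ 4 = y" "\<And>c. c \<in> D \<Longrightarrow> f c ^ 4 = y'" "inj_on f (- D)"
    "\<And>a b. a \<in> D \<Longrightarrow> b \<in> D \<Longrightarrow> a \<noteq> b \<Longrightarrow> f b = - f a" "prod f (- D) = - y"
proof -
  obtain c1 c2 c3 c4 c5 c6 where c: "cols c1 c2 c3 c4 c5 c6" "D = {c5, c6}"
     "f c2 = - f c1" "f c3 = \<i> * f c1" "f c4 = - \<i> * f c1" "f c6 = - f c5"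
    using assms(1) unfolding quartered_at_def by (elim exE conjE) (rule that)
  have d: "distinct [c1, c2, c3, c4, c5, c6]" using c(1) by (simp add: cols_def)
  have m: "- D = {c1, c2, c3, c4}" unfolding c(2) by (rule cols_UNIV_minus(2)[OF c(1)])
  have i4: "\<i> ^ 4 = 1" "(- \<i>) ^ 4 = 1" by (simp_all add: eval_nat_numeral)
  show thesis
  proof (rule that[of "f c1 ^ 4" "f c5 ^ 4"])
    show "f x ^ 4 = f c1 ^ 4" if "x \<notin> D" for x
    proof -
      have "x \<in> {c1, c2, c3, c4}" using that m by blast
      then show ?thesis using c(3-5) by (auto simp: power_mult_distrib i4)
    qed
    show "inj_on f (- D)"
      unfolding m inj_on_def using quarter_turns_distinct[OF assms(2)[of c1]] by (auto simp: c(3-5))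
    show "prod f (- D) = - (f c1 ^ 4)"
      unfolding m using d by (simp add: c(3-5) eval_nat_numeral algebra_simps)
  qed (use d c in auto)
qed

text \<open>\<open>D\<close> and \<open>D'\<close> cover at most four columns. A column outside both
  shows that the common fourth powers outside the two pairs agree, so \<open>D\<close> lies inside
  \<open>D'\<close>.\<close>

lemma quartered_at_unique:
  assumes "quartered_at k D'" "\<And>c. k c \<noteq> 0" "card D = 2" "\<And>c. c \<notin> D \<Longrightarrow> k c ^ 4 = y" "\<And>c. c \<in> D \<Longrightarrow> k c ^ 4 \<noteq> y"
  shows "D' = D"
proof -
  obtain z z' where z: "card D' = 2" "\<And>c. c \<notin> D' \<Longrightarrow> k c ^ 4 = z" "\<And>c. c \<in> D' \<Longrightarrow> k c ^ 4 = z'" "inj_on k (- D')"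
    "\<And>a b. a \<in> D' \<Longrightarrow> b \<in> D' \<Longrightarrow> a \<noteq> b \<Longrightarrow> k b = - k a" "prod k (- D') = - z"
    by (rule quartered_at_facts[OF assms(1,2)]) (rule that; blast)
  have "card (D \<union> D') \<le> 4" using card_Un_le[of D D'] z(1) assms(3) by simp
  then have "D \<union> D' \<noteq> UNIV" by auto
  then obtain c where "c \<notin> D" "c \<notin> D'" by blast
  then have "z = y" using z(2) assms(4) by metis
  then have "D \<subseteq> D'" using z(2) assms(5) by blast
  then show ?thesis using z(1) assms(3) by (metis card_subset_eq finite)
qed

definition special :: "(6 \<Rightarrow> complex) \<Rightarrow> bool" where
  "special f \<longleftrightarrow> (\<forall>c d. f c ^ 4 = f d ^ 4)"

lemma card_2_with:
  assumes "card A = 2" "a \<in> A"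
  obtains b where "A = {a, b}" "b \<noteq> a"
proof -
  obtain x y where "A = {x, y}" "x \<noteq> y" using assms(1) by (auto simp: card_2_iff)
  moreover from this assms(2) have "a = x \<or> a = y" by blast
  ultimately show thesis using that[of x] that[of y] by (auto simp: insert_commute)
qed

text \<open>Relative to a fixed row, each of the other five rows has a column pair \<open>D\<close> on which its fourth power differs
  from the common value elsewhere. Two such pairs cannot be equal; if they shared one column \<open>a\<close>,
  comparing products over their complements would give \<open>g a\<^sup>2 = g b\<^sup>2\<close> with \<open>a \<in> D q\<close>, \<open>b \<notin> D q\<close>. But
  six columns do not contain five disjoint pairs.\<close>

lemma exists_special:
  assumes H: "had H" and i2: "\<And>p q. p \<noteq> q \<Longrightarrow> quartered (rel H p q)"
  shows "\<exists>p q. p \<noteq> q \<and> special (rel H p q)"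
proof (rule ccontr)
  assume "\<not> ?thesis"
  then have ns: "\<not> special (rel H p q)" if "p \<noteq> q" for p q using that by blast
  have nz: "rel H p q c \<noteq> 0" for p q c by (rule rel_nonzero[OF H])
  have "\<forall>p. \<exists>D. p \<noteq> 1 \<longrightarrow> quartered_at (rel H p 1) D" using quartered_at_exists[OF i2] by blast
  then obtain D where D: "\<And>p. p \<noteq> 1 \<Longrightarrow> quartered_at (rel H p 1) (D p)" by metis
  have values_differ: "y \<noteq> y'" if "p \<noteq> q" "\<And>c. c \<notin> E \<Longrightarrow> rel H p q c ^ 4 = y" "\<And>c. c \<in> E \<Longrightarrow> rel H p q c ^ 4 = y'" for p q E y y'
    using ns[OF that(1)] that(2,3) unfolding special_def by metis
  have disj: "D p \<inter> D q = {}" if pq: "p \<noteq> 1" "q \<noteq> 1" "p \<noteq> q" for p q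
  proof (rule ccontr)
    assume ne: "D p \<inter> D q \<noteq> {}"
    let ?f = "rel H p 1" and ?g = "rel H q 1" and ?k = "rel H q p"
    have qp: "q \<noteq> p" using pq by blast
    have k: "?k c = ?g c / ?f c" for c by (simp add: rel_quotient[OF H])
    obtain s \<alpha> where f: "card (D p) = 2" "\<And>c. c \<notin> D p \<Longrightarrow> ?f c ^ 4 = s" "\<And>c. c \<in> D p \<Longrightarrow> ?f c ^ 4 = \<alpha>" "inj_on ?f (- D p)"
      "\<And>a b. a \<in> D p \<Longrightarrow> b \<in> D p \<Longrightarrow> a \<noteq> b \<Longrightarrow> ?f b = - ?f a" "prod ?f (- D p) = - s"
      by (rule quartered_at_facts[OF D[OF pq(1)] nz]) (rule that; blast)
    obtain t \<beta> where g: "card (D q) = 2" "\<And>c. c \<notin> D q \<Longrightarrow> ?g c ^ 4 = t" "\<And>c. c \<in> D q \<Longrightarrow> ?g c ^ 4 = \<beta>" "inj_on ?g (- D q)"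
      "\<And>a b. a \<in> D q \<Longrightarrow> b \<in> D q \<Longrightarrow> a \<noteq> b \<Longrightarrow> ?g b = - ?g a" "prod ?g (- D q) = - t"
      by (rule quartered_at_facts[OF D[OF pq(2)] nz]) (rule that; blast)
    obtain E where E: "quartered_at ?k E" using quartered_at_exists[OF i2[OF qp]] by blast
    obtain z z' where k': "card E = 2" "\<And>c. c \<notin> E \<Longrightarrow> ?k c ^ 4 = z" "\<And>c. c \<in> E \<Longrightarrow> ?k c ^ 4 = z'" "inj_on ?k (- E)"
      "\<And>a b. a \<in> E \<Longrightarrow> b \<in> E \<Longrightarrow> a \<noteq> b \<Longrightarrow> ?k b = - ?k a" "prod ?k (- E) = - z"
      by (rule quartered_at_facts[OF E nz]) (rule that; blast)
    have d: "s \<noteq> \<alpha>" "t \<noteq> \<beta>" "z \<noteq> z'"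
      using values_differ[OF pq(1) f(2,3)] values_differ[OF pq(2) g(2,3)] values_differ[OF qp k'(2,3)] by auto
    have k4: "?k c ^ 4 = ?g c ^ 4 / ?f c ^ 4" for c unfolding k by (rule power_divide)
    obtain a where a: "a \<in> D p" "a \<in> D q" using ne by blast
    obtain b where b: "D p = {a, b}" "b \<noteq> a" by (rule card_2_with[OF f(1) a(1)]) (rule that; assumption)
    obtain c where c: "D q = {a, c}" "c \<noteq> a" by (rule card_2_with[OF g(1) a(2)]) (rule that; assumption)
    have fg: "?f b = - ?f a" "?g c = - ?g a" using f(5)[of a b] g(5)[of a c] b c by auto
    show False
    proof (cases "b = c")
      \<comment> \<open>On a common exceptional pair \<open>f\<close> and \<open>g\<close> both
        change sign, so \<open>?k\<close> does not; but the same pair is exceptional for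
        \<open>?k\<close>, which must change sign there.\<close>
      case True
      have DD: "D q = D p" using b c True by simp
      have "E = D p"
      proof (rule quartered_at_unique[OF E nz f(1), of "t / s"])
        show "?k x ^ 4 = t / s" if "x \<notin> D p" for x using f(2) g(2) that DD by (simp add: k4)
        show "?k x ^ 4 \<noteq> t / s" if "x \<in> D p" for x
        proof
          assume "?k x ^ 4 = t / s"
          then have "\<beta> / \<alpha> = t / s" using f(3) g(3) that DD by (simp add: k4)
          then have "?k c ^ 4 = t / s" for c using f(2,3)[of c] g(2,3)[of c] DD by (cases "c \<in> D p") (simp_all add: k4)
          then show False using ns[OF qp] by (simp add: special_def)
        qed
      qed
      then have "?k b = - ?k a" using k'(5)[of a b] b by simp
      moreover have "?k b = ?k a" using fg True unfolding k by simp
      ultimately show False using nz[of q p a] by simp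
    next
      case False
      define R where "R = - {a, b, c}"
      have "card R = 3" unfolding R_def using b c False by (simp add: card_Compl_6)
      then have "\<not> R \<subseteq> E" using k'(1) card_mono[of E R] by auto
      then obtain x where x: "x \<in> R" "x \<notin> E" by blast
      have st: "s \<noteq> 0" "t \<noteq> 0" using f(2)[of x] g(2)[of x] x b c nz by (auto simp: R_def)
      have z: "z = t / s" using k'(2)[OF x(2)] f(2)[of x] g(2)[of x] x(1) b c by (simp add: k4 R_def)
      have F: "?f a ^ 4 = \<alpha>" "?f b ^ 4 = \<alpha>" "?f c ^ 4 = s" "?g a ^ 4 = \<beta>" "?g b ^ 4 = t" "?g c ^ 4 = \<beta>"
        using f(2,3) g(2,3) b c False by auto
      have a0: "\<alpha> \<noteq> 0" unfolding F(1)[symmetric] using nz by simp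
      have "b \<in> E"
      proof (rule ccontr)
        assume "b \<notin> E"
        then have "t / \<alpha> = t / s" using k'(2)[of b] F z by (simp add: k4)
        then show False using st a0 d(1) by (simp add: field_simps)
      qed
      moreover have "c \<in> E"
      proof (rule ccontr)
        assume "c \<notin> E"
        then have "\<beta> / s = t / s" using k'(2)[of c] F z by (simp add: k4)
        then show False using st d(2) by (simp add: field_simps)
      qed
      ultimately have "{b, c} \<subseteq> E" by blast
      moreover have "card {b, c} = 2" using False by simp
      ultimately have Ebc: "E = {b, c}" using k'(1) by (metis card_subset_eq finite)
      \<comment> \<open>The complements of \<open>D p\<close>, \<open>D q\<close> and
        \<open>E\<close> are \<open>R\<close> together with \<open>c\<close>, \<open>b\<close> and
        \<open>a\<close>. Combining the three product formulas cancels the products over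
        \<open>R\<close>.\<close>
      have ins: "- D p = insert c R" "- D q = insert b R" "- E = insert a R"
        unfolding R_def b(1) c(1) Ebc using b c False by auto
      have nR: "a \<notin> R" "b \<notin> R" "c \<notin> R" by (auto simp: R_def)
      have pf: "?f c * prod ?f R = - s" using f(6) nR unfolding ins by simp
      have pg: "?g b * prod ?g R = - t" using g(6) nR unfolding ins by simp
      have "?k a * prod ?k R = - (t / s)" using k'(6) nR z unfolding ins by simp
      then have pk: "(?g a / ?f a) * (prod ?g R / prod ?f R) = - (t / s)"
        unfolding k by (simp add: prod_dividef)
      have R0: "prod ?f R \<noteq> 0" "prod ?g R \<noteq> 0" using nz by simp_all
      have ts: "t / s = (?g b * prod ?g R) / (?f c * prod ?f R)" unfolding pf pg by simp
      have "(?g a * ?f c + ?g b * ?f a) * prod ?g R = 0"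
        using pk R0 nz unfolding ts by (simp add: field_simps)
      then have e1: "?g a * ?f c = - (?g b * ?f a)"
        using R0 by (simp add: eq_neg_iff_add_eq_0)
      have "?k c = - ?k b" using k'(5)[of b c] Ebc False by simp
      then have e2: "?g b * ?f c = - (?g a * ?f a)"
        unfolding k fg using nz by (simp add: field_simps)
      have "(?g a)\<^sup>2 * ?f c = (?g b)\<^sup>2 * ?f c"
        using e1 e2 by algebra
      then have "(?g a)\<^sup>2 = (?g b)\<^sup>2" using nz by simp
      then have "((?g a)\<^sup>2)\<^sup>2 = ((?g b)\<^sup>2)\<^sup>2" by simp
      then have "\<beta> = t" using F by simp
      then show False using d by simp
    qed
  qed
  have c2: "card (D p) = 2" if "p \<noteq> 1" for p
    by (rule quartered_at_facts[OF D[OF that] nz])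
  have "card (\<Union>p\<in>- {1}. D p) = (\<Sum>p\<in>- {1}. card (D p))"
    by (rule card_UN_disjoint) (use disj in auto)
  also have "\<dots> = (\<Sum>p\<in>- {1::6}. 2)" by (rule sum.cong) (auto simp: c2)
  also have "\<dots> = 10" by (simp add: card_Compl_6)
  finally have "card (\<Union>p\<in>- {1}. D p) = 10" .
  moreover have "card (\<Union>p\<in>- {1}. D p) \<le> card (UNIV :: 6 set)" by (rule card_mono) auto
  ultimately show False by simp
qed

text \<open>Constant fourth powers make the fifth value a quarter turn of the first, so one
  antipodal pair of values occurs once and the other twice. The single pair is put on
  \<open>c1, c2\<close>.\<close>

lemma special_columns:
  assumes "quartered f" "special f"
  obtains c1 c2 c3 c4 c5 c6 where "cols c1 c2 c3 c4 c5 c6" "f c2 = - f c1" "f c3 = \<i> * f c1" "f c4 = \<i> * f c1"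
    "f c5 = - \<i> * f c1" "f c6 = - \<i> * f c1"
proof -
  obtain d1 d2 d3 d4 d5 d6 where d: "cols d1 d2 d3 d4 d5 d6" "f d2 = - f d1" "f d3 = \<i> * f d1" "f d4 = - \<i> * f d1" "f d6 = - f d5"
    using assms(1) unfolding quartered_def by (elim exE conjE) (rule that)
  have "f d5 ^ 4 = f d1 ^ 4" using assms(2) unfolding special_def by blast
  then have "(f d5 - f d1) * (f d5 + f d1) * ((f d5 - \<i> * f d1) * (f d5 + \<i> * f d1)) = 0"
    by (simp add: eval_nat_numeral algebra_simps)
  then consider "f d5 = f d1" | "f d5 = - f d1" | "f d5 = \<i> * f d1" | "f d5 = - \<i> * f d1"
    by (auto simp: add_eq_0_iff2)
  then show thesis
  proof cases
    case 1
    have "cols d3 d4 d2 d6 d1 d5" using d(1) by (auto simp: cols_def)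
    then show ?thesis by (rule that) (simp_all add: d 1)
  next
    case 2
    have "cols d3 d4 d2 d5 d1 d6" using d(1) by (auto simp: cols_def)
    then show ?thesis by (rule that) (simp_all add: d 2)
  next
    case 3
    have "cols d1 d2 d3 d5 d4 d6" using d(1) by (auto simp: cols_def)
    then show ?thesis by (rule that) (simp_all add: d 3)
  next
    case 4
    have "cols d1 d2 d3 d6 d4 d5" using d(1) by (auto simp: cols_def)
    then show ?thesis by (rule that) (simp_all add: d 4)
  qed
qed

section \<open>The case of a row with varying fourth powers\<close>

lemma fourth_root_cases:
  fixes z :: complex
  assumes "z ^ 4 = 1"
  shows "z = 1 \<or> z = - 1 \<or> z = \<i> \<or> z = - \<i>"
proof -
  have "(z - 1) * (z + 1) * ((z - \<i>) * (z + \<i>)) = z ^ 4 - 1"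
    by (simp add: eval_nat_numeral algebra_simps)
  then show ?thesis using assms by (auto simp: add_eq_0_iff2)
qed

text \<open>Eliminating \<open>A\<close> leaves \<open>4 * (e * w) = (1 - e) * v2 - (1 + e)\<close>.
  Since \<open>e\<close> is \<open>\<i>\<close> or \<open>- \<i>\<close>, the right side has norm at
  most twice the square root of 2.\<close>

lemma no_third_special:
  fixes v2 w A :: complex
  assumes "norm v2 = 1" "norm w = 1" "norm e = 1" "1 + v2 + A + 2 * w = 0" "1 - v2 - e * A + 2 * e * w = 0" "e * e = - 1"
  shows False
proof -
  have A: "A = - 1 - v2 - 2 * w" using assms(4) by algebra
  have "4 * (e * w) = (1 - e) * v2 - (1 + e)"
    using assms(5) unfolding A by algebra
  then have "norm (4 * (e * w)) \<le> norm ((1 - e) * v2) + norm (1 + e)"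
    by (metis norm_triangle_ineq4)
  then have le: "4 \<le> norm (1 - e) + norm (1 + e)" using assms(1-3) by (simp add: norm_mult)
  have "(e - \<i>) * (e + \<i>) = 0" using assms(6) by (simp add: algebra_simps)
  then have "e = \<i> \<or> e = - \<i>" by (auto simp: add_eq_0_iff2)
  then have "norm (1 - e) = sqrt 2" "norm (1 + e) = sqrt 2" by (auto simp: cmod_def)
  then have "2 \<le> sqrt 2" using le by simp
  moreover have "sqrt 2 < sqrt 4" by (rule real_sqrt_less_mono) simp
  ultimately show False by simp
qed

text \<open>Dividing by a row of fourth roots of unity keeps fourth powers, so a non-special row has
  the same exceptional pair relative to every special row, and each special row is constant on that
  pair. For \<open>r2\<close> this leaves two possible pairs. Any special row besides
  \<open>r1\<close> and \<open>r2\<close> would be constant on the pair of \<open>v\<close> and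
  violate the norm estimate.\<close>

lemma haagerup_nonspecial:
  assumes H: "had N" and i2: "\<And>p q. p \<noteq> q \<Longrightarrow> quartered (rel N p q)"
    and r: "r1 \<noteq> r2" and one: "\<And>c. N r1 c = 1" "\<And>p. N p c1 = 1"
    and c: "cols c1 c2 c3 c4 c5 c6"
    and u: "N r2 c2 = - 1" "N r2 c3 = \<i>" "N r2 c4 = \<i>" "N r2 c5 = - \<i>" "N r2 c6 = - \<i>"
    and v: "\<not> special (N v)"
  shows "\<exists>q. norm q = 1 \<and> has_form N (haagerup_matrix q)"
proof (rule haagerup_normalized[OF H r one c u])
  have nz: "N p c \<noteq> 0" for p c by (rule had_nonzero[OF H])
  have nm: "norm (N p c) = 1" for p c by (rule had_norm[OF H])
  have rnz: "rel N p q c \<noteq> 0" for p q c by (rule rel_nonzero[OF H])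
  have D: "distinct [c1, c2, c3, c4, c5, c6]" using c by (simp add: cols_def)
  have i4: "\<i> ^ 4 = 1" "(- \<i>) ^ 4 = 1" by (simp_all add: eval_nat_numeral)
  have u4: "N r2 c ^ 4 = 1" for c
  proof -
    have "\<forall>c. N r2 c ^ 4 = 1" unfolding cols_all[OF \<open>cols c1 c2 c3 c4 c5 c6\<close>] u one by (simp add: i4)
    then show ?thesis by blast
  qed
  have one4: "N p c ^ 4 = 1" if "special (N p)" for p c
    using that one(2)[of p] unfolding special_def by (metis power_one)
  have sp2: "special (N r2)" by (simp add: special_def u4)
  have r1': "rel N p r1 = N p" for p by (simp add: rel_def one fun_eq_iff)
  have alt: "\<exists>D. quartered_at (N p) D \<and> (\<forall>q. special (N q) \<longrightarrow> quartered_at (rel N p q) D)" if np: "\<not> special (N p)" for p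
  proof -
    have "p \<noteq> r1" using np one by (auto simp: special_def)
    then obtain D where D: "quartered_at (N p) D" using quartered_at_exists[OF i2[of p r1]] unfolding r1' by blast
    obtain y y' where f: "card D = 2" "\<And>c. c \<notin> D \<Longrightarrow> N p c ^ 4 = y" "\<And>c. c \<in> D \<Longrightarrow> N p c ^ 4 = y'" "inj_on (N p) (- D)"
      "\<And>a b. a \<in> D \<Longrightarrow> b \<in> D \<Longrightarrow> a \<noteq> b \<Longrightarrow> N p b = - N p a" "prod (N p) (- D) = - y"
      by (rule quartered_at_facts[OF D nz]) (rule that; blast)
    have "y \<noteq> y'" using np f(2,3) unfolding special_def by metis
    have "quartered_at (rel N p q) D" if q: "special (N q)" for q
    proof -
      have "p \<noteq> q" using np q by blast
      then obtain E where E: "quartered_at (rel N p q) E" using quartered_at_exists[OF i2] by blast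
      have k4: "rel N p q c ^ 4 = N p c ^ 4" for c by (simp add: rel_def power_divide one4[OF q])
      have "E = D"
        by (rule quartered_at_unique[OF E rnz f(1), of y]) (use f(2,3) \<open>y \<noteq> y'\<close> in \<open>auto simp: k4\<close>)
      then show ?thesis using E by simp
    qed
    then show ?thesis using D by blast
  qed
  have eqD: "N q a = N q b" if "quartered_at (N p) D" "quartered_at (rel N p q) D" "a \<in> D" "b \<in> D" for p q a b D
  proof (cases "a = b")
    case False
    have e1: "N p b = - N p a" by (rule quartered_at_facts[OF that(1) nz]) (use that(3,4) False in blast)
    have e2: "rel N p q b = - rel N p q a" by (rule quartered_at_facts[OF that(2) rnz]) (use that(3,4) False in blast)
    show ?thesis using e2 nz unfolding rel_def e1 by simp
  qed simp
  have D_cases: "D = {c3, c4} \<or> D = {c5, c6}" if "quartered_at (N p) D" "quartered_at (rel N p r2) D" for p D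
  proof -
    have "card D = 2" by (rule quartered_at_facts[OF that(1) nz])
    then obtain a b where ab: "D = {a, b}" "a \<noteq> b" by (auto simp: card_2_iff)
    have "N r2 a = N r2 b" using eqD[OF that] ab by blast
    then show ?thesis
      using cols_cases[OF c, of a] cols_cases[OF c, of b] ab u one(2)[of r2] imaginary_neq by (elim disjE) auto
  qed
  obtain D0 where D0: "quartered_at (N v) D0" "\<And>q. special (N q) \<Longrightarrow> quartered_at (rel N v q) D0"
    using alt[OF v] by blast
  have D0': "D0 = {c3, c4} \<or> D0 = {c5, c6}" by (rule D_cases[OF D0(1) D0(2)[OF sp2]])
  fix p
  assume p: "p \<noteq> r1" "p \<noteq> r2"
  have s1: "1 + N p c2 + N p c3 + N p c4 + N p c5 + N p c6 = 0"
    using had_orth[OF H p(1)] by (simp add: cols_sum[OF c] one)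
  have s2: "1 - N p c2 - \<i> * (N p c3 + N p c4) + \<i> * (N p c5 + N p c6) = 0"
    using had_orth[OF H p(2)] by (simp add: cols_sum[OF c] one u algebra_simps)
  have np: "\<not> special (N p)"
  proof
    assume sp: "special (N p)"
    have eq: "N p a = N p b" if "a \<in> D0" "b \<in> D0" for a b by (rule eqD[OF D0(1) D0(2)[OF sp] that])
    from D0' show False
    proof
      assume "D0 = {c3, c4}"
      then have "N p c4 = N p c3" using eq by blast
      then show False
        using no_third_special[of "N p c2" "N p c3" "- \<i>" "N p c5 + N p c6"] s1 s2 nm by (simp add: algebra_simps)
    next
      assume "D0 = {c5, c6}"
      then have "N p c6 = N p c5" using eq by blast
      then show False
        using no_third_special[of "N p c2" "N p c5" \<i> "N p c3 + N p c4"] s1 s2 nm by (simp add: algebra_simps)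
    qed
  qed
  obtain D' where D': "quartered_at (N p) D'" "quartered_at (rel N p r2) D'"
    using alt[OF np] sp2 by blast
  obtain y y' where f: "card D' = 2" "\<And>c. c \<notin> D' \<Longrightarrow> N p c ^ 4 = y" "\<And>c. c \<in> D' \<Longrightarrow> N p c ^ 4 = y'" "inj_on (N p) (- D')"
    "\<And>a b. a \<in> D' \<Longrightarrow> b \<in> D' \<Longrightarrow> a \<noteq> b \<Longrightarrow> N p b = - N p a" "prod (N p) (- D') = - y"
    by (rule quartered_at_facts[OF D'(1) nz]) (rule that; blast)
  have kinj: "inj_on (rel N p r2) (- D')" by (rule quartered_at_facts[OF D'(2) rnz])
  \<comment> \<open>Outside \<open>D'\<close> both the entries of \<open>p\<close> and their
    quotients by \<open>r2\<close> are pairwise distinct fourth roots of unity; this leaves only the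
    shapes of \<open>haagerup_row\<close>.\<close>
  have injs: "N p a \<noteq> N p b \<and> N p a / N r2 a \<noteq> N p b / N r2 b" if "a \<notin> D'" "b \<notin> D'" "a \<noteq> b" for a b
    using f(4) kinj that unfolding inj_on_def rel_def by blast
  from D_cases[OF D'] show "haagerup_row (N p c2) (N p c3) (N p c4) (N p c5) (N p c6)"
  proof
    assume h: "D' = {c5, c6}"
    have "y = 1" using f(2)[of c1] D one h by auto
    then have q: "N p c2 ^ 4 = 1" "N p c3 ^ 4 = 1" "N p c4 ^ 4 = 1" using f(2) D h by auto
    have n: "N p c6 = - N p c5" using f(5)[of c5 c6] D h by auto
    have i: "N p c2 \<noteq> 1" "N p c3 \<noteq> 1" "N p c4 \<noteq> 1" "N p c2 \<noteq> N p c3" "N p c2 \<noteq> N p c4" "N p c3 \<noteq> N p c4"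
      "N p c2 / - 1 \<noteq> 1" "N p c3 / \<i> \<noteq> 1" "N p c4 / \<i> \<noteq> 1" "N p c2 / - 1 \<noteq> N p c3 / \<i>" "N p c2 / - 1 \<noteq> N p c4 / \<i>"
      using injs[of c2 c1] injs[of c3 c1] injs[of c4 c1] injs[of c2 c3] injs[of c2 c4] injs[of c3 c4] D h
      by (auto simp: u one)
    show ?thesis
      using fourth_root_cases[OF q(1)] fourth_root_cases[OF q(2)] fourth_root_cases[OF q(3)] i n
      unfolding haagerup_row_def by (elim disjE) simp_all
  next
    assume h: "D' = {c3, c4}"
    have "y = 1" using f(2)[of c1] D one h by auto
    then have q: "N p c2 ^ 4 = 1" "N p c5 ^ 4 = 1" "N p c6 ^ 4 = 1" using f(2) D h by auto
    have n: "N p c4 = - N p c3" using f(5)[of c3 c4] D h by auto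
    have i: "N p c2 \<noteq> 1" "N p c5 \<noteq> 1" "N p c6 \<noteq> 1" "N p c2 \<noteq> N p c5" "N p c2 \<noteq> N p c6" "N p c5 \<noteq> N p c6"
      "N p c2 / - 1 \<noteq> 1" "N p c5 / - \<i> \<noteq> 1" "N p c6 / - \<i> \<noteq> 1" "N p c2 / - 1 \<noteq> N p c5 / - \<i>" "N p c2 / - 1 \<noteq> N p c6 / - \<i>"
      using injs[of c2 c1] injs[of c5 c1] injs[of c6 c1] injs[of c2 c5] injs[of c2 c6] injs[of c5 c6] D h
      by (auto simp: u one)
    show ?thesis
      using fourth_root_cases[OF q(1)] fourth_root_cases[OF q(2)] fourth_root_cases[OF q(3)] i n
      unfolding haagerup_row_def by (elim disjE) simp_all
  qed
qed

section \<open>The case of constant fourth powers throughout\<close>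

text \<open>In a quotient with constant fourth powers, \<open>M\<close> carries the antipodal pair
  of values that occurs once; the values occurring twice have the opposite square.\<close>

definition minor :: "(6 \<Rightarrow> complex) \<Rightarrow> 6 set \<Rightarrow> bool" where
  "minor f M \<longleftrightarrow> card M = 2 \<and> sum f M = 0 \<and> (\<exists>s. \<forall>c. (f c)\<^sup>2 = (if c \<in> M then s else - s))"

lemma special_minor:
  assumes "quartered f" "special f"
  shows "\<exists>M. minor f M"
proof -
  obtain c1 c2 c3 c4 c5 c6 where c: "cols c1 c2 c3 c4 c5 c6" "f c2 = - f c1" "f c3 = \<i> * f c1" "f c4 = \<i> * f c1"
    "f c5 = - \<i> * f c1" "f c6 = - \<i> * f c1"
    by (rule special_columns[OF assms]) (rule that; assumption)
  have d: "distinct [c1, c2, c3, c4, c5, c6]" using c(1) by (simp add: cols_def)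
  have "\<forall>x. (f x)\<^sup>2 = (if x \<in> {c1, c2} then (f c1)\<^sup>2 else - (f c1)\<^sup>2)"
    unfolding cols_all[OF c(1)] using d by (auto simp: c(2-) power_mult_distrib)
  moreover have "card {c1, c2} = 2" "sum f {c1, c2} = 0" using d c by auto
  ultimately show ?thesis unfolding minor_def by blast
qed

lemma minor_scale:
  assumes "minor f M"
  shows "minor (\<lambda>c. \<kappa> * f c) M"
proof -
  obtain s where s: "\<And>c. (f c)\<^sup>2 = (if c \<in> M then s else - s)" and M: "card M = 2" "sum f M = 0"
    using assms unfolding minor_def by blast
  have "\<forall>c. (\<kappa> * f c)\<^sup>2 = (if c \<in> M then \<kappa>\<^sup>2 * s else - (\<kappa>\<^sup>2 * s))"
    using s by (simp add: power_mult_distrib)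
  moreover have "sum (\<lambda>c. \<kappa> * f c) M = 0" using M(2) by (simp flip: sum_distrib_left)
  ultimately show ?thesis unfolding minor_def using M(1) by blast
qed

text \<open>With the same \<open>M\<close> for both, \<open>(g c / f c)\<^sup>2\<close> is constant,
  while a minor pair needs two different squares.\<close>

lemma minor_distinct:
  assumes "minor f M" "minor g M" "\<And>c. f c \<noteq> 0" "\<And>c. g c \<noteq> 0"
  shows "\<not> minor (\<lambda>c. g c / f c) M'"
proof
  assume k: "minor (\<lambda>c. g c / f c) M'"
  obtain s where s: "\<And>c. (f c)\<^sup>2 = (if c \<in> M then s else - s)" using assms(1) unfolding minor_def by blast
  obtain t where t: "\<And>c. (g c)\<^sup>2 = (if c \<in> M then t else - t)" using assms(2) unfolding minor_def by blast
  obtain w where w: "card M' = 2" "\<And>c. (g c / f c)\<^sup>2 = (if c \<in> M' then w else - w)" using k unfolding minor_def by blast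
  have "(g c / f c)\<^sup>2 = t / s" for c unfolding power_divide s t by simp
  then have const: "(if c \<in> M' then w else - w) = t / s" for c using w(2) by metis
  have "M' \<noteq> {}" "- M' \<noteq> {}" using w(1) card_Compl_6[of M'] by auto
  then obtain a b where ab: "a \<in> M'" "b \<notin> M'" by blast
  then have "w = - w" using const[of a] const[of b] by simp
  then have "w = 0" by simp
  then show False using w(2)[of a] assms(3)[of a] assms(4)[of a] by (simp split: if_splits)
qed

text \<open>If \<open>M\<close> and \<open>M'\<close> were disjoint, the squares would place the
  minor pair of \<open>g / f\<close> on the two columns outside both, where \<open>g / f\<close>
  then changes sign. The values of \<open>f\<close> off \<open>M\<close> are equal up to sign and
  sum to zero, likewise those of \<open>g\<close> off \<open>M'\<close>; every sign distribution
  compatible with the total sum of \<open>g / f\<close> contradicts that change of sign.\<close>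

lemma minor_disjoint:
  assumes f: "minor f M" "sum f UNIV = 0" and g: "minor g M'" "sum g UNIV = 0"
    and k: "minor (\<lambda>c. g c / f c) M''" "(\<Sum>c\<in>UNIV. g c / f c) = 0"
    and nz: "\<And>c. f c \<noteq> 0" "\<And>c. g c \<noteq> 0"
  shows "M \<inter> M' \<noteq> {}"
proof
  assume dj: "M \<inter> M' = {}"
  obtain s where s: "card M = 2" "sum f M = 0" "\<And>c. (f c)\<^sup>2 = (if c \<in> M then s else - s)"
    using f(1) unfolding minor_def by blast
  obtain t where t: "card M' = 2" "sum g M' = 0" "\<And>c. (g c)\<^sup>2 = (if c \<in> M' then t else - t)"
    using g(1) unfolding minor_def by blast
  obtain w where w: "card M'' = 2" "(\<Sum>c\<in>M''. g c / f c) = 0" "\<And>c. (g c / f c)\<^sup>2 = (if c \<in> M'' then w else - w)"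
    using k(1) unfolding minor_def by blast
  obtain a b where ab: "M = {a, b}" "a \<noteq> b" using s(1) by (auto simp: card_2_iff)
  obtain c d where cd: "M' = {c, d}" "c \<noteq> d" using t(1) by (auto simp: card_2_iff)
  have "distinct [a, b, c, d]" using ab cd dj by auto
  then obtain ys where ys: "distinct ([a, b, c, d] @ ys)" "length ([a, b, c, d] @ ys) = 6"
    using cols_extend[of "[a, b, c, d]"] by auto
  then obtain e h where "ys = [e, h]" by (auto simp: length_Suc_conv numeral_eq_Suc)
  then have C: "cols a b c d e h" using ys by (simp add: cols_def)
  have D: "distinct [a, b, c, d, e, h]" using C by (simp add: cols_def)
  have s0: "s \<noteq> 0" and t0: "t \<noteq> 0" using s(3)[of a] t(3)[of a] nz[of a] by (auto split: if_splits)
  have k2: "(g x / f x)\<^sup>2 = (g x)\<^sup>2 / (f x)\<^sup>2" for x by (rule power_divide)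
  have kv: "(g a / f a)\<^sup>2 = - (t / s)" "(g b / f b)\<^sup>2 = - (t / s)" "(g c / f c)\<^sup>2 = - (t / s)" "(g d / f d)\<^sup>2 = - (t / s)"
     "(g e / f e)\<^sup>2 = t / s" "(g h / f h)\<^sup>2 = t / s"
    unfolding k2 s(3) t(3) using ab cd D by auto
  have w0: "w \<noteq> 0" using w(3)[of a] nz[of a] by (auto split: if_splits)
  have same: "x \<in> M'' \<longleftrightarrow> y \<in> M''" if "(g x / f x)\<^sup>2 = (g y / f y)\<^sup>2" for x y
  proof (rule ccontr)
    assume "\<not> ?thesis"
    then have "w = - w" using that w(3)[of x] w(3)[of y] by (auto split: if_splits)
    then show False using w0 by simp
  qed
  have "M'' = {e, h}"
  proof -
    have iff: "a \<in> M'' \<longleftrightarrow> b \<in> M''" "a \<in> M'' \<longleftrightarrow> c \<in> M''" "a \<in> M'' \<longleftrightarrow> d \<in> M''"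
      using same[of a b] same[of a c] same[of a d] kv by simp_all
    have "a \<notin> M''"
    proof
      assume "a \<in> M''"
      then have "{a, b, c} \<subseteq> M''" using iff by blast
      then have "card {a, b, c} \<le> card M''" by (rule card_mono[OF finite])
      then show False using w(1) D by simp
    qed
    have "M'' \<subseteq> {e, h}"
    proof
      fix x assume "x \<in> M''"
      then show "x \<in> {e, h}" using \<open>a \<notin> M''\<close> iff cols_cases[OF C, of x] by auto
    qed
    moreover have "card {e, h} = 2" using D by simp
    ultimately show ?thesis using w(1) by (metis card_subset_eq finite)
  qed
  then have eh: "g e / f e + g h / f h = 0" using w(2) D by simp
  have "f a + f b = 0" "f a + f b + f c + f d + f e + f h = 0"
    using s(2) f(2) ab D by (simp_all add: cols_sum[OF C])
  then have fe: "f b = - f a" "f c + f d + f e + f h = 0" by algebra+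
  have "g c + g d = 0" "g a + g b + g c + g d + g e + g h = 0"
    using t(2) g(2) cd D by (simp_all add: cols_sum[OF C])
  then have ge: "g d = - g c" "g a + g b + g e + g h = 0" by algebra+
  have rest: "g a / f a - g b / f a + g c / f c - g c / f d = 0"
    using k(2) eh by (simp add: cols_sum[OF C] fe ge add.assoc)
  have sq: "f d = f c \<or> f d = - f c" "f e = f c \<or> f e = - f c" "f h = f c \<or> f h = - f c"
    "g b = g a \<or> g b = - g a" "g e = g a \<or> g e = - g a" "g h = g a \<or> g h = - g a"
    unfolding power2_eq_iff[symmetric] s(3) t(3) using ab cd D by auto
  from sq(1) show False
  proof
    assume d1: "f d = f c"
    then have f2: "f e = - f c" "f h = - f c" using sq(2,3) fe(2) nz(1)[of c] by auto
    have "g b = g a" using rest d1 nz(1)[of a] by (simp add: diff_divide_distrib[symmetric])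
    then have "g e = - g a" "g h = - g a" using sq(5,6) ge(2) nz(2)[of a] by auto
    then show False using eh f2 nz[of a] nz[of c] by simp
  next
    assume d1: "f d = - f c"
    then have f2: "f h = - f e" using fe(2) by (simp add: add_eq_0_iff)
    have "g b \<noteq> g a"
    proof
      assume "g b = g a"
      then show False using rest d1 nz[of c] by simp
    qed
    then have b1: "g b = - g a" using sq(4) by blast
    then have "g h = - g e" using ge(2) by (simp add: add_eq_0_iff)
    then show False using eh f2 nz[of e] by simp
  qed
qed

text \<open>Without a common element, \<open>{a, b}\<close>, \<open>{a, c}\<close> and a pair
  avoiding \<open>a\<close> form a triangle. Any pair that meets all three sides is one of them, so
  there are at most three pairs.\<close>

lemma intersecting_pairs_star:
  assumes "\<And>i. i \<in> I \<Longrightarrow> card (M i) = 2" "inj_on M I" "card I > 3" "\<And>i j. i \<in> I \<Longrightarrow> j \<in> I \<Longrightarrow> i \<noteq> j \<Longrightarrow> M i \<inter> M j \<noteq> {}"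
  shows "\<exists>c. \<forall>i\<in>I. c \<in> M i"
proof (rule ccontr)
  assume no: "\<not> ?thesis"
  have "finite I" using assms(3) by (metis card.infinite not_less_zero)
  moreover have "\<not> card I \<le> Suc 0" using assms(3) by simp
  ultimately obtain i j where ij: "i \<in> I" "j \<in> I" "i \<noteq> j"
    using card_le_Suc0_iff_eq by blast
  obtain a where a: "a \<in> M i" "a \<in> M j" using assms(4)[OF ij] by blast
  obtain b where b: "M i = {a, b}" "b \<noteq> a" by (rule card_2_with[OF assms(1)[OF ij(1)] a(1)]) (rule that; assumption)
  obtain c where c: "M j = {a, c}" "c \<noteq> a" by (rule card_2_with[OF assms(1)[OF ij(2)] a(2)]) (rule that; assumption)
  have bc: "b \<noteq> c"
  proof
    assume "b = c"
    then have "M i = M j" unfolding b(1) c(1) by simp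
    then show False using inj_onD[OF assms(2)] ij by blast
  qed
  obtain k where k: "k \<in> I" "a \<notin> M k" using no by blast
  have "b \<in> M k" using assms(4)[OF ij(1) k(1)] k(2) a b by auto
  moreover have "c \<in> M k" using assms(4)[OF ij(2) k(1)] k(2) a c by auto
  ultimately have "{b, c} \<subseteq> M k" by blast
  moreover have "card {b, c} = 2" using bc by simp
  moreover have "finite (M k)" using assms(1)[OF k(1)] by (metis card.infinite zero_neq_numeral)
  ultimately have Mk: "M k = {b, c}" using assms(1)[OF k(1)] by (metis card_subset_eq)
  have "M l \<in> {{a, b}, {a, c}, {b, c}}" if l: "l \<in> I" for l
  proof (rule ccontr)
    assume n: "M l \<notin> {{a, b}, {a, c}, {b, c}}"
    then have ne: "l \<noteq> i" "l \<noteq> j" "l \<noteq> k" unfolding b(1)[symmetric] c(1)[symmetric] Mk[symmetric] by blast+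
    have m: "M l \<inter> {a, b} \<noteq> {}" "M l \<inter> {a, c} \<noteq> {}" "M l \<inter> {b, c} \<noteq> {}"
      using assms(4)[OF l ij(1) ne(1)] assms(4)[OF l ij(2) ne(2)] assms(4)[OF l k(1) ne(3)]
      unfolding b(1) c(1) Mk .
    have fl: "finite (M l)" using assms(1)[OF l] by (metis card.infinite zero_neq_numeral)
    have sub: "M l = {x, y}" if "x \<in> M l" "y \<in> M l" "x \<noteq> y" for x y
    proof -
      have "{x, y} \<subseteq> M l" "card {x, y} = card (M l)" using that assms(1)[OF l] by auto
      then show ?thesis using card_subset_eq[OF fl] by metis
    qed
    have "a \<in> M l \<and> b \<in> M l \<or> a \<in> M l \<and> c \<in> M l \<or> b \<in> M l \<and> c \<in> M l" using m by blast
    then show False using sub[of a b] sub[of a c] sub[of b c] n b(2) c(2) bc by auto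
  qed
  then have "M ` I \<subseteq> {{a, b}, {a, c}, {b, c}}" by blast
  then have "card (M ` I) \<le> card {{a, b}, {a, c}, {b, c}}" by (rule card_mono[rotated]) simp
  also have "\<dots> \<le> 3" by (simp add: card_insert_if)
  finally show False using card_image[OF assms(2)] assms(3) by simp
qed

lemma square_root_minus_one:
  fixes z :: complex
  assumes "z\<^sup>2 = - 1"
  shows "z = \<i> \<or> z = - \<i>"
proof -
  have "(z - \<i>) * (z + \<i>) = 0" using assms by (simp add: algebra_simps power2_eq_square)
  then show ?thesis by (auto simp: add_eq_0_iff2)
qed

text \<open>\<open>k\<close> is the position of the entry \<open>- 1\<close>. The other entries are
  \<open>\<i>\<close> or \<open>- \<i>\<close>, and the two orthogonality relations select the
  signs.\<close>

lemma special_row: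
  fixes v2 v3 v4 v5 v6 :: complex
  assumes sq: "v2\<^sup>2 = (if k = 2 then 1 else - 1)" "v3\<^sup>2 = (if k = (3::nat) then 1 else - 1)" "v4\<^sup>2 = (if k = 4 then 1 else - 1)"
      "v5\<^sup>2 = (if k = 5 then 1 else - 1)" "v6\<^sup>2 = (if k = 6 then 1 else - 1)"
    and m: "k = 3 \<Longrightarrow> v3 = - 1" "k = 4 \<Longrightarrow> v4 = - 1" "k = 5 \<Longrightarrow> v5 = - 1" "k = 6 \<Longrightarrow> v6 = - 1"
    and "k \<in> {3, 4, 5, 6}"
    and s: "1 + v2 + v3 + v4 + v5 + v6 = 0" "1 - v2 - \<i> * (v3 + v4) + \<i> * (v5 + v6) = 0"
  shows "haagerup_row v2 v3 v4 v5 v6"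
proof -
  from assms(10) consider "k = 3" | "k = 4" | "k = 5" | "k = 6" by auto
  then show ?thesis
  proof cases
    case 1
    then have "v3 = - 1" "v2 = \<i> \<or> v2 = - \<i>" "v4 = \<i> \<or> v4 = - \<i>" "v5 = \<i> \<or> v5 = - \<i>" "v6 = \<i> \<or> v6 = - \<i>"
      using sq m square_root_minus_one by auto
    then show ?thesis using s unfolding haagerup_row_def by (elim disjE) (simp_all add: complex_eq_iff)
  next
    case 2
    then have "v4 = - 1" "v2 = \<i> \<or> v2 = - \<i>" "v3 = \<i> \<or> v3 = - \<i>" "v5 = \<i> \<or> v5 = - \<i>" "v6 = \<i> \<or> v6 = - \<i>"
      using sq m square_root_minus_one by auto
    then show ?thesis using s unfolding haagerup_row_def by (elim disjE) (simp_all add: complex_eq_iff)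
  next
    case 3
    then have "v5 = - 1" "v2 = \<i> \<or> v2 = - \<i>" "v3 = \<i> \<or> v3 = - \<i>" "v4 = \<i> \<or> v4 = - \<i>" "v6 = \<i> \<or> v6 = - \<i>"
      using sq m square_root_minus_one by auto
    then show ?thesis using s unfolding haagerup_row_def by (elim disjE) (simp_all add: complex_eq_iff)
  next
    case 4
    then have "v6 = - 1" "v2 = \<i> \<or> v2 = - \<i>" "v3 = \<i> \<or> v3 = - \<i>" "v4 = \<i> \<or> v4 = - \<i>" "v5 = \<i> \<or> v5 = - \<i>"
      using sq m square_root_minus_one by auto
    then show ?thesis using s unfolding haagerup_row_def by (elim disjE) (simp_all add: complex_eq_iff)
  qed
qed

lemma quartered_scale:
  assumes "quartered f"
  shows "quartered (\<lambda>c. \<kappa> * f c)"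
proof -
  obtain c1 c2 c3 c4 c5 c6 where "cols c1 c2 c3 c4 c5 c6" "f c2 = - f c1" "f c3 = \<i> * f c1" "f c4 = - \<i> * f c1" "f c6 = - f c5"
    using assms unfolding quartered_def by (elim exE conjE) (rule that)
  then show ?thesis unfolding quartered_def
    by (intro exI[of _ c1] exI[of _ c2] exI[of _ c3] exI[of _ c4] exI[of _ c5] exI[of _ c6]) simp
qed

text \<open>The exceptional column pairs of the five rows relative to \<open>r1\<close> are distinct and intersect pairwise, so they
  share a column, which is the one to normalize.\<close>

lemma haagerup_all_special:
  assumes H: "had H" and i2: "\<And>p q. p \<noteq> q \<Longrightarrow> quartered (rel H p q)" and sp: "\<And>p. special (rel H p r1)"
  shows "\<exists>q. norm q = 1 \<and> has_form H (haagerup_matrix q)"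
proof -
  have nz: "rel H p q c \<noteq> 0" for p q c by (rule rel_nonzero[OF H])
  have sp': "special (rel H p q)" for p q
    using sp[of p] sp[of q] unfolding special_def rel_quotient[OF H, of p r1 _ q, symmetric] power_divide by metis
  have min: "\<exists>M. minor (rel H p q) M" if "p \<noteq> q" for p q by (rule special_minor[OF i2[OF that] sp'])
  then have "\<forall>p. \<exists>M. p \<noteq> r1 \<longrightarrow> minor (rel H p r1) M" by blast
  then obtain M where M: "\<And>p. p \<noteq> r1 \<Longrightarrow> minor (rel H p r1) (M p)" by metis
  have sum0: "sum (rel H p q) UNIV = 0" if "p \<noteq> q" for p q
    using had_orth[OF H that] by (simp add: rel_def)
  have kq: "(\<lambda>c. rel H q r1 c / rel H p r1 c) = rel H q p" for p q by (simp add: rel_quotient[OF H] fun_eq_iff)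
  have "\<exists>c. \<forall>p\<in>- {r1}. c \<in> M p"
  proof (rule intersecting_pairs_star)
    show "card (M p) = 2" if "p \<in> - {r1}" for p using M[of p] that unfolding minor_def by simp
    show "inj_on M (- {r1})"
    proof (rule inj_onI, rule ccontr)
      fix p q assume pq: "p \<in> - {r1}" "q \<in> - {r1}" "M p = M q" "p \<noteq> q"
      obtain M' where "minor (rel H q p) M'" using min pq(4) by metis
      moreover have "minor (rel H p r1) (M p)" "minor (rel H q r1) (M p)" using M[of p] M[of q] pq by simp_all
      ultimately show False using minor_distinct[of "rel H p r1" "M p" "rel H q r1" M'] nz unfolding kq by blast
    qed
    show "M p \<inter> M q \<noteq> {}" if pq: "p \<in> - {r1}" "q \<in> - {r1}" "p \<noteq> q" for p q
    proof -
      have ne: "p \<noteq> r1" "q \<noteq> r1" "q \<noteq> p" using pq by auto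
      obtain M' where "minor (rel H q p) M'" using min ne by metis
      then show ?thesis
        using minor_disjoint[OF M[OF ne(1)] sum0[OF ne(1)] M[OF ne(2)] sum0[OF ne(2)], of M'] sum0[OF ne(3)] nz
        unfolding kq by simp
    qed
  qed (simp add: card_Compl_6)
  then obtain c1 where c1: "\<And>p. p \<noteq> r1 \<Longrightarrow> c1 \<in> M p" by auto
  define N where "N = (\<lambda>p c. rel H p r1 c / rel H p r1 c1)"
  note n = normalize_row_col[OF H, where r = r1 and ?c0.0 = c1, folded N_def]
  have one: "N r1 c = 1" "N p c1 = 1" for p c using n(2,3) by (simp_all add: N_def)
  have mN: "minor (N p) (M p)" if "p \<noteq> r1" for p
    using minor_scale[OF M[OF that], of "1 / rel H p r1 c1"] by (simp add: N_def)
  \<comment> \<open>As the shared column now has the entry 1, the squares are 1 on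
    \<open>M p\<close> and \<open>- 1\<close> elsewhere, and the second column of \<open>M p\<close>
    has the entry \<open>- 1\<close>.\<close>
  have m: "\<exists>d. d \<noteq> c1 \<and> N p d = - 1 \<and> (\<forall>c. (N p c)\<^sup>2 = (if c = c1 \<or> c = d then 1 else - 1)) \<and> M p = {c1, d}" if p: "p \<noteq> r1" for p
  proof -
    obtain s where s: "card (M p) = 2" "sum (N p) (M p) = 0" "\<And>c. (N p c)\<^sup>2 = (if c \<in> M p then s else - s)"
      using mN[OF p] unfolding minor_def by blast
    obtain d where d: "M p = {c1, d}" "d \<noteq> c1" by (rule card_2_with[OF s(1) c1[OF p]]) (rule that; assumption)
    have "s = 1" using s(3)[of c1] d one by simp
    moreover have "N p d = - 1" using s(2) d one by (simp add: add_eq_0_iff)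
    ultimately show ?thesis using s(3) d by (intro exI[of _ d]) simp
  qed
  obtain r2 where r2: "r2 \<noteq> r1" by (metis cols_numerals cols_def distinct_length_2_or_more)
  obtain c2 where c2: "c2 \<noteq> c1" "N r2 c2 = - 1" "\<And>c. (N r2 c)\<^sup>2 = (if c = c1 \<or> c = c2 then 1 else - 1)" "M r2 = {c1, c2}"
    using m[OF r2] by blast
  obtain d3 d4 d5 d6 where d: "cols c1 c2 d3 d4 d5 d6" by (rule cols_extend_2[OF c2(1)[symmetric]])
  have "\<exists>c3 c4 c5 c6. cols c1 c2 c3 c4 c5 c6 \<and> N r2 c3 = \<i> \<and> N r2 c4 = \<i> \<and> N r2 c5 = - \<i> \<and> N r2 c6 = - \<i>"
  proof -
    have v: "N r2 x = \<i> \<or> N r2 x = - \<i>" if "x \<in> {d3, d4, d5, d6}" for x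
    proof (rule square_root_minus_one)
      show "(N r2 x)\<^sup>2 = - 1" using c2(3)[of x] that d by (auto simp: cols_def)
    qed
    have s: "N r2 d3 + N r2 d4 + N r2 d5 + N r2 d6 = 0"
      using had_orth[OF n(1) r2] by (simp add: cols_sum[OF d] one c2(2) add.assoc)
    have o: "cols c1 c2 d3 d4 d5 d6" "cols c1 c2 d3 d5 d4 d6" "cols c1 c2 d3 d6 d4 d5"
      "cols c1 c2 d4 d5 d3 d6" "cols c1 c2 d4 d6 d3 d5" "cols c1 c2 d5 d6 d3 d4" using d by (auto simp: cols_def)
    consider "N r2 d3 = \<i>" "N r2 d4 = \<i>" "N r2 d5 = - \<i>" "N r2 d6 = - \<i>"
      | "N r2 d3 = \<i>" "N r2 d5 = \<i>" "N r2 d4 = - \<i>" "N r2 d6 = - \<i>"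
      | "N r2 d3 = \<i>" "N r2 d6 = \<i>" "N r2 d4 = - \<i>" "N r2 d5 = - \<i>"
      | "N r2 d4 = \<i>" "N r2 d5 = \<i>" "N r2 d3 = - \<i>" "N r2 d6 = - \<i>"
      | "N r2 d4 = \<i>" "N r2 d6 = \<i>" "N r2 d3 = - \<i>" "N r2 d5 = - \<i>"
      | "N r2 d5 = \<i>" "N r2 d6 = \<i>" "N r2 d3 = - \<i>" "N r2 d4 = - \<i>"
      using v[of d3] v[of d4] v[of d5] v[of d6] s by (simp, elim disjE) (simp_all add: complex_eq_iff)
    then show ?thesis
      by cases (use o in blast)+
  qed
  then obtain c3 c4 c5 c6 where c: "cols c1 c2 c3 c4 c5 c6" "N r2 c3 = \<i>" "N r2 c4 = \<i>" "N r2 c5 = - \<i>" "N r2 c6 = - \<i>"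
    by blast
  have D: "distinct [c1, c2, c3, c4, c5, c6]" using c(1) by (simp add: cols_def)
  have "\<exists>q. norm q = 1 \<and> has_form N (haagerup_matrix q)"
  proof (rule haagerup_normalized[OF n(1) r2[symmetric] one c(1) c2(2) c(2-5)])
    fix p
    assume p: "p \<noteq> r1" "p \<noteq> r2"
    obtain d where d: "d \<noteq> c1" "N p d = - 1" "\<And>c. (N p c)\<^sup>2 = (if c = c1 \<or> c = d then 1 else - 1)" "M p = {c1, d}"
      using m[OF p(1)] by blast
    \<comment> \<open>Equality would give \<open>p\<close> and \<open>r2\<close> the same minor
      pair, which \<open>minor_distinct\<close> excludes.\<close>
    have "d \<noteq> c2"
    proof
      assume "d = c2"
      then have "minor (rel H r2 r1) (M p)" using M[OF r2] d c2 by simp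
      moreover obtain M' where "minor (rel H r2 p) M'" using min p by metis
      ultimately show False
        using minor_distinct[of "rel H p r1" "M p" "rel H r2 r1" M'] M[OF p(1)] nz unfolding kq by blast
    qed
    define k :: nat where "k = (if d = c3 then 3 else if d = c4 then 4 else if d = c5 then 5 else 6)"
    have s1: "1 + N p c2 + N p c3 + N p c4 + N p c5 + N p c6 = 0"
      using had_orth[OF n(1) p(1)] by (simp add: cols_sum[OF c(1)] one)
    have s2: "1 - N p c2 - \<i> * (N p c3 + N p c4) + \<i> * (N p c5 + N p c6) = 0"
      using had_orth[OF n(1) p(2)] by (simp add: cols_sum[OF c(1)] one c c2(2) algebra_simps)
    have "d = c3 \<or> d = c4 \<or> d = c5 \<or> d = c6" using cols_cases[OF c(1), of d] d(1) \<open>d \<noteq> c2\<close> by blast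
    then show "haagerup_row (N p c2) (N p c3) (N p c4) (N p c5) (N p c6)"
      using D d by (intro special_row[of _ k, OF _ _ _ _ _ _ _ _ _ _ s1 s2]) (auto simp: k_def)
  qed
  then show ?thesis using n(4) by blast
qed

text \<open>Any third row completes two rows to a triple, so all quotients are quartered and a
  special pair exists. The cases differ in whether all rows are special relative to its second
  row.\<close>

lemma all_type2_haagerup:
  assumes H: "had H" and t: "\<And>p q. p \<noteq> q \<Longrightarrow> type2 (rel H p q)" "\<And>p q. p \<noteq> q \<Longrightarrow> \<not> type3 (rel H p q)"
  shows "\<exists>q. norm q = 1 \<and> has_form H (haagerup_matrix q)"
proof -
  have i2: "quartered (rel H p q)" if pq: "p \<noteq> q" for p q
  proof -
    obtain r3 r4 r5 r6 where r: "cols p q r3 r4 r5 r6" by (rule cols_extend_2[OF pq])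
    then have ne: "r3 \<noteq> q" "r3 \<noteq> p" by (auto simp: cols_def)
    have "(\<lambda>c. rel H r3 q c / rel H p q c) = rel H r3 p" by (simp add: rel_quotient[OF H] fun_eq_iff)
    then show ?thesis
      using type2_triple_quartered[OF t(1)[OF pq] t(1)[OF ne(1)]] t(1,2)[OF ne(2)] rel_norm[OF H] by simp
  qed
  obtain r2 r1 where r: "r2 \<noteq> r1" "special (rel H r2 r1)" using exists_special[OF H i2] by blast
  show ?thesis
  proof (cases "\<forall>p. special (rel H p r1)")
    case True
    then show ?thesis using haagerup_all_special[OF H i2] by blast
  next
    case False
    then obtain v where v: "\<not> special (rel H v r1)" by blast
    obtain c1 c2 c3 c4 c5 c6 where c: "cols c1 c2 c3 c4 c5 c6" "rel H r2 r1 c2 = - rel H r2 r1 c1"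
      "rel H r2 r1 c3 = \<i> * rel H r2 r1 c1" "rel H r2 r1 c4 = \<i> * rel H r2 r1 c1"
      "rel H r2 r1 c5 = - \<i> * rel H r2 r1 c1" "rel H r2 r1 c6 = - \<i> * rel H r2 r1 c1"
      by (rule special_columns[OF i2[OF r(1)] r(2)]) (rule that; assumption)
    have nz: "rel H p q c \<noteq> 0" for p q c by (rule rel_nonzero[OF H])
    define N where "N = (\<lambda>p c. rel H p r1 c / rel H p r1 c1)"
    note n = normalize_row_col[OF H, where r = r1 and ?c0.0 = c1, folded N_def]
    have one: "N r1 c = 1" "N p c1 = 1" for p c using n(2,3) by (simp_all add: N_def)
    have iN: "quartered (rel N p q)" if "p \<noteq> q" for p q
    proof -
      have "rel N p q = (\<lambda>c. (1 / rel H p q c1) * rel H p q c)" using n(5) by (simp add: fun_eq_iff)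
      then show ?thesis by (simp only: quartered_scale[OF i2[OF that]])
    qed
    have vN: "\<not> special (N v)"
      using v nz unfolding special_def N_def power_divide by simp
    have u: "N r2 c2 = - 1" "N r2 c3 = \<i>" "N r2 c4 = \<i>" "N r2 c5 = - \<i>" "N r2 c6 = - \<i>"
      using nz by (simp_all add: N_def c)
    have "\<exists>q. norm q = 1 \<and> has_form N (haagerup_matrix q)"
      by (rule haagerup_nonspecial[OF n(1) iN r(1)[symmetric] one c(1) u vN])
    then show ?thesis using n(4) by blast
  qed
qed

section \<open>The classification\<close>

lemma regular_forms:
  assumes H: "had H" and t: "\<And>p q. p \<noteq> q \<Longrightarrow> type2 (rel H p q) \<or> type3 (rel H p q)"
  shows "has_form H tao_matrix \<or> (\<exists>q. norm q = 1 \<and> has_form H (haagerup_matrix q)) \<or>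
     (\<exists>r s. norm r = 1 \<and> norm s = 1 \<and> has_form H (F23_matrix r s)) \<or>
     (\<exists>r s. norm r = 1 \<and> norm s = 1 \<and> has_form H (F32_matrix r s))"
proof -
  define T where "T p q \<longleftrightarrow> type3 (rel H p q)" for p q
  have flip: "rel H q p = (\<lambda>c. cnj (rel H p q c))" for p q
    using had_nonzero[OF H] by (simp add: fun_eq_iff unit_inverse[OF rel_norm[OF H]]) (simp add: rel_def)
  have sym: "T q p" if "T p q" for p q
    using that unfolding T_def by (subst flip) (rule type3_cnj)
  have t2: "type2 (rel H p q)" if "p \<noteq> q" "\<not> T p q" for p q
    using t[OF that(1)] that(2) unfolding T_def by blast
  have nz: "rel H p q c \<noteq> 0" and nm: "norm (rel H p q c) = 1" for p q c
    by (rule rel_nonzero[OF H], rule rel_norm[OF H])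
  have quot: "(\<lambda>c. rel H p r c / rel H q r c) = rel H p q" for p q r
    by (simp add: rel_quotient[OF H] fun_eq_iff)
  have G: ?thesis if "p \<noteq> q" "halved (rel H p q)" for p q
    using halved_F23[OF H that(1)[symmetric] that(2)] by blast
  consider "\<forall>p q. p \<noteq> q \<longrightarrow> T p q" | "\<forall>p q. p \<noteq> q \<longrightarrow> \<not> T p q"
    | p q p' q' where "p \<noteq> q" "T p q" "p' \<noteq> q'" "\<not> T p' q'" by metis
  then show ?thesis
  proof cases
    case 1
    then show ?thesis using all_type3_tao[OF H] unfolding T_def by blast
  next
    case 2
    then show ?thesis using all_type2_haagerup[OF H t2] unfolding T_def by blast
  next
    case 3
    \<comment> \<open>Pairs of different kind can be chosen with a common row: if \<open>p\<close>
      has type 3 with every other row, then \<open>p'\<close> is such a row, with partners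
      \<open>p\<close> and \<open>q'\<close>.\<close>
    have "\<exists>b c d. b \<noteq> c \<and> b \<noteq> d \<and> T b c \<and> \<not> T b d"
    proof (cases "\<exists>s. s \<noteq> p \<and> \<not> T p s")
      case True
      then show ?thesis using 3 by metis
    next
      case False
      then have "p' \<noteq> p" "T p p'" using 3 by metis+
      then show ?thesis using sym[of p p'] 3(3,4) by metis
    qed
    then obtain b c d where bcd: "b \<noteq> c" "b \<noteq> d" "T b c" "\<not> T b d" by blast
    then have cd: "c \<noteq> d" by blast
    have db: "\<not> T d b" using bcd(4) sym by blast
    \<comment> \<open>If the third pair has type 3, the triple has a single pair without type 3, and
      its quotient is halved. If not, the two pairs without type 3 meet in \<open>d\<close>, which
      becomes the reference row for a common pairing.\<close>
    show ?thesis
    proof (cases "T c d")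
      case True
      have "halved (rel H d b)"
      proof (rule type2_type3_type3_halved[of _ "rel H c b"])
        show "type3 (\<lambda>x. rel H c b x / rel H d b x)" using True unfolding quot T_def .
      qed (use t2[OF bcd(2)[symmetric] db] db sym[OF bcd(3)] nz in \<open>auto simp: T_def\<close>)
      then show ?thesis by (rule G[OF bcd(2)[symmetric]])
    next
      case False
      show ?thesis
      proof (cases "halved (rel H b d) \<or> halved (rel H c d)")
        case True
        then show ?thesis using G[OF bcd(2)] G[OF cd] by blast
      next
        case nG: False
        have "share_matching (rel H b d) (rel H c d)"
        proof (rule type2_type2_type3_share)
          show "type3 (\<lambda>x. rel H c d x / rel H b d x)" using sym[OF bcd(3)] unfolding quot T_def .
        qed (use t2[OF bcd(2,4)] t2[OF cd False] bcd(4) False nG nm in \<open>auto simp: T_def\<close>)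
        moreover have "distinct [d, b, c]" using bcd cd by auto
        ultimately show ?thesis using share_matching_F32[OF H] G by blast
      qed
    qed
  qed
qed

lemma regular_had:
  fixes h :: "complex^6^6"
  assumes "regular_hadamard h"
  defines "H \<equiv> (\<lambda>p c. h $ p $ c)"
  shows "had H" "p \<noteq> q \<Longrightarrow> type2 (rel H p q) \<or> type3 (rel H p q)"
proof -
  have h: "\<And>i m. norm (h $ i $ m) = 1" "\<And>i k. i \<noteq> k \<Longrightarrow> type2 (row_prod h i k) \<or> type3 (row_prod h i k)"
    using assms(1) unfolding regular_iff_types by auto
  have r: "row_prod h p q = rel H p q" for p q
    by (simp add: fun_eq_iff row_prod_def rel_def H_def unit_inverse[OF h(1)])
  show t: "type2 (rel H p q) \<or> type3 (rel H p q)" if "p \<noteq> q" for p q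
    using h(2)[OF that] unfolding r .
  have "sum (rel H p q) UNIV = 0" if "p \<noteq> q" for p q
    using t[OF that] type2_sum type3_sum by blast
  then show "had H"
    unfolding had_def using h(1) by (simp add: H_def rel_def)
qed

theorem theorem11p2:
  fixes h :: "complex^6^6"
  shows "regular_hadamard h \<longleftrightarrow>
     hadamard_equiv h tao_matrix \<or>
     (\<exists>q. norm q = 1 \<and> hadamard_equiv h (haagerup_matrix q)) \<or>
     (\<exists>r s. norm r = 1 \<and> norm s = 1 \<and> hadamard_equiv h (F23_matrix r s)) \<or>
     (\<exists>r s. norm r = 1 \<and> norm s = 1 \<and> hadamard_equiv h (F32_matrix r s))"
proof
  assume "regular_hadamard h"
  note H = regular_had[OF this]
  show "hadamard_equiv h tao_matrix \<or>
     (\<exists>q. norm q = 1 \<and> hadamard_equiv h (haagerup_matrix q)) \<or>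
     (\<exists>r s. norm r = 1 \<and> norm s = 1 \<and> hadamard_equiv h (F23_matrix r s)) \<or>
     (\<exists>r s. norm r = 1 \<and> norm s = 1 \<and> hadamard_equiv h (F32_matrix r s))"
    using regular_forms[OF H] has_form_equiv by metis
next
  assume "hadamard_equiv h tao_matrix \<or>
     (\<exists>q. norm q = 1 \<and> hadamard_equiv h (haagerup_matrix q)) \<or>
     (\<exists>r s. norm r = 1 \<and> norm s = 1 \<and> hadamard_equiv h (F23_matrix r s)) \<or>
     (\<exists>r s. norm r = 1 \<and> norm s = 1 \<and> hadamard_equiv h (F32_matrix r s))"
  then show "regular_hadamard h"
    using regular_equiv regular_tao regular_haagerup regular_F23 regular_F32 by metis
qed

end
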